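(* Let $k$ be a local field, $d\ge2$, $V=k^d$, and $\mu$ a probability measure on $SL_d(k)$ with an exponential local moment such that $\Gamma_\mu$ is strongly irreducible and contracting. Let $Z$ be a random variable on $P(V)$ whose law is the unique $\mu$-invariant probability measure $\nu$ on $P(V)$. Then for all $t\in\,]0,1[$, $$\limsup_{n\to\infty}\Big[\sup\big\{\mathbb P\big(\delta(Z,[H])\le t^n\big):\ H\text{ hyperplane of }V\big\}\Big]^{1/n}<1 .$$
   Context: A local field $k$ is $\mathbb R$, $\mathbb C$, a finite extension of some $\mathbb Q_p$, or a field of Laurent series over a finite field, with its usual absolute value. $\Gamma_\mu$ is the smallest closed semigroup containing the support of $\mu$. Exponential local moment: $\int\|g\|^\tau d\mu(g)<\infty$ for some $\tau>0$. Strongly irreducible: no finite union of proper non-zero subspaces of $V$ is preserved. Contracting: there are $\gamma_n\in\Gamma_\mu$ and $r_n\in k$ with $\|r_n\gamma_n\|=1$ such that $r_n\gamma_n$ converges along a subsequence to a rank one endomorphism. $\nu$ is $\mu$-invariant if $\mu\star\nu=\nu$ (existence and uniqueness hold under these assumptions). $V$ carries the canonical norm (Euclidean/Hermitian if $k$ archimedean, Max norm otherwise), $V^*$ the dual norm; $\delta([x],[y])=\|x\wedge y\|/(\|x\|\|y\|)$ on $P(V)$. For a hyperplane $H=\ker f$, $f\in V^*\setminus\{0\}$, $\delta([x],[H])=|f(x)|/(\|f\|\|x\|)$. *)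

theory Defs
  imports
    "HOL-Probability.Probability_Measure"
    "HOL-Computational_Algebra.Formal_Laurent_Series"
begin

text \<open>
  A field with an absolute value, carrying the induced metric.  The library constant
  \<open>norm\<close> is reserved for real normed vector spaces, hence the new parameter.
\<close>

class absval_field = field + metric_space +
  fixes absval :: "'a \<Rightarrow> real"
  assumes absval_eq_0_iff: "absval x = 0 \<longleftrightarrow> x = 0"
    and absval_mult: "absval (x * y) = absval x * absval y"
    and absval_triangle: "absval (x + y) \<le> absval x + absval y"
    and dist_absval: "dist x y = absval (x - y)"

instantiation real :: absval_field
begin
definition absval_real :: "real \<Rightarrow> real" where "absval_real x = \<bar>x\<bar>"
instance by standard (auto simp: absval_real_def abs_mult dist_real_def)
end

instantiation complex :: absval_field
begin
definition absval_complex :: "complex \<Rightarrow> real" where "absval_complex z = cmod z"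
instance by standard (auto simp: absval_complex_def norm_mult norm_triangle_ineq dist_norm)
end

definition subfield_set :: "'k::field set \<Rightarrow> bool" where
  "subfield_set F \<longleftrightarrow> 0 \<in> F \<and> 1 \<in> F \<and>
     (\<forall>x\<in>F. \<forall>y\<in>F. x + y \<in> F \<and> x * y \<in> F) \<and>
     (\<forall>x\<in>F. - x \<in> F \<and> inverse x \<in> F)"

definition ring_hom_on :: "'a::field set \<Rightarrow> ('a \<Rightarrow> 'b::field) \<Rightarrow> bool" where
  "ring_hom_on A \<phi> \<longleftrightarrow> \<phi> 1 = 1 \<and>
     (\<forall>x\<in>A. \<forall>y\<in>A. \<phi> (x + y) = \<phi> x + \<phi> y \<and> \<phi> (x * y) = \<phi> x * \<phi> y)"

definition padic_absval :: "nat \<Rightarrow> rat \<Rightarrow> real" where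
  "padic_absval p q = (if q = 0 then 0 else
     real p powi (int (multiplicity (int p) (snd (quotient_of q)))
                - int (multiplicity (int p) (fst (quotient_of q)))))"

definition is_real_field :: "'k::absval_field itself \<Rightarrow> bool" where
  "is_real_field _ \<longleftrightarrow> (\<exists>\<phi>::real \<Rightarrow> 'k. bij \<phi> \<and> ring_hom_on UNIV \<phi> \<and>
     (\<forall>x. absval (\<phi> x) = \<bar>x\<bar>))"

definition is_complex_field :: "'k::absval_field itself \<Rightarrow> bool" where
  "is_complex_field _ \<longleftrightarrow> (\<exists>\<phi>::complex \<Rightarrow> 'k. bij \<phi> \<and> ring_hom_on UNIV \<phi> \<and>
     (\<forall>z. absval (\<phi> z) = cmod z))"

text \<open>
  \<open>is_padic_subfield p K\<close>: the set \<open>K\<close> with the restricted absolute value is a completion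
  of the rationals for the \<open>p\<close>-adic absolute value, i.e. a copy of \<open>Q_p\<close>.
\<close>

definition is_padic_subfield :: "nat \<Rightarrow> 'k::absval_field set \<Rightarrow> bool" where
  "is_padic_subfield p K \<longleftrightarrow> (\<exists>\<iota>::rat \<Rightarrow> 'k. ring_hom_on UNIV \<iota> \<and>
     (\<forall>q. absval (\<iota> q) = padic_absval p q) \<and> complete K \<and> K = closure (range \<iota>))"

definition is_padic_extension :: "'k::absval_field itself \<Rightarrow> bool" where
  "is_padic_extension _ \<longleftrightarrow> (\<exists>p (K :: 'k set). prime p \<and> is_padic_subfield p K \<and>
     (\<exists>B. finite B \<and> (\<forall>x. \<exists>c. (\<forall>b\<in>B. c b \<in> K) \<and> x = (\<Sum>b\<in>B. c b * b))))"

text \<open>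
  The coefficient field of a Laurent series field may be taken inside \<open>'k\<close> (the constants);
  \<open>fls_over F\<close> is then the field \<open>F((X))\<close>, with absolute value \<open>q\<^sup>-\<^sup>o\<^sup>r\<^sup>d\<close> for \<open>q = card F\<close>.
\<close>

definition fls_over :: "'k::field set \<Rightarrow> 'k fls set" where
  "fls_over F = {f. \<forall>n. fls_nth f n \<in> F}"

definition is_laurent_field :: "'k::absval_field itself \<Rightarrow> bool" where
  "is_laurent_field _ \<longleftrightarrow> (\<exists>(F :: 'k set) (\<phi> :: 'k fls \<Rightarrow> 'k). finite F \<and> subfield_set F \<and>
     bij_betw \<phi> (fls_over F) UNIV \<and> ring_hom_on (fls_over F) \<phi> \<and>
     (\<forall>f\<in>fls_over F. f \<noteq> 0 \<longrightarrow> absval (\<phi> f) = real (card F) powi (- fls_subdegree f)))"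

definition local_field :: "'k::absval_field itself \<Rightarrow> bool" where
  "local_field T \<longleftrightarrow> is_real_field T \<or> is_complex_field T \<or> is_padic_extension T \<or> is_laurent_field T"

lemma local_field_real: "local_field TYPE(real)"
  unfolding local_field_def is_real_field_def ring_hom_on_def absval_real_def
  by (intro disjI1 exI[of _ "\<lambda>x. x"]) (auto simp: bij_def)

lemma local_field_complex: "local_field TYPE(complex)"
  unfolding local_field_def is_complex_field_def ring_hom_on_def absval_complex_def
  by (intro disjI2 disjI1 exI[of _ "\<lambda>x. x"]) (auto simp: bij_def)

definition nonarchimedean :: "'k::absval_field itself \<Rightarrow> bool" where
  "nonarchimedean _ \<longleftrightarrow> (\<forall>x y :: 'k. absval (x + y) \<le> max (absval x) (absval y))"

definition canonical_norm :: "'k::absval_field ^ 'd \<Rightarrow> real" where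
  "canonical_norm x = (if nonarchimedean TYPE('k) then (MAX i. absval (x $ i))
     else sqrt (\<Sum>i\<in>UNIV. (absval (x $ i))\<^sup>2))"

definition op_norm :: "'k::absval_field ^ 'd ^ 'd \<Rightarrow> real" where
  "op_norm g = (SUP x\<in>-{0}. canonical_norm (g *v x) / canonical_norm x)"

definition dual_space :: "('k::field ^ 'd \<Rightarrow> 'k) set" where
  "dual_space = {f. Vector_Spaces.linear (*s) (*) f}"

definition dual_norm :: "('k::absval_field ^ 'd \<Rightarrow> 'k) \<Rightarrow> real" where
  "dual_norm f = (SUP x\<in>-{0}. absval (f x) / canonical_norm x)"

definition scale_mat :: "'k::field \<Rightarrow> 'k ^ 'd ^ 'd \<Rightarrow> 'k ^ 'd ^ 'd" where
  "scale_mat r g = (\<chi> i j. r * g $ i $ j)"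

definition line :: "'k::field ^ 'd \<Rightarrow> ('k ^ 'd) set" where
  "line x = vec.span {x}"

definition proj_space :: "('k::field ^ 'd) set set" where
  "proj_space = line ` (- {0})"

text \<open>The Borel sets of the quotient topology on the projective space.\<close>

definition proj_borel :: "('k::absval_field ^ 'd) set measure" where
  "proj_borel = sigma proj_space
     {U. U \<subseteq> proj_space \<and> open {x :: 'k ^ 'd. x \<noteq> 0 \<and> line x \<in> U}}"

definition ker :: "('k::field ^ 'd \<Rightarrow> 'k) \<Rightarrow> ('k ^ 'd) set" where
  "ker f = {x. f x = 0}"

definition hyperplanes :: "('k::field ^ 'd) set set" where
  "hyperplanes = {ker f | f. f \<in> dual_space \<and> f \<noteq> (\<lambda>_. 0)}"

text \<open>
  \<open>\<delta>([x],[H]) = |f(x)| / (\<parallel>f\<parallel> \<parallel>x\<parallel>)\<close> for \<open>H = ker f\<close>, as a function of the line and of the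
  hyperplane; the value does not depend on \<open>x\<close> and \<open>f\<close>, see \<open>delta_hyp_eq\<close> below.
\<close>

definition delta_hyp :: "('k::absval_field ^ 'd) set \<Rightarrow> ('k ^ 'd) set \<Rightarrow> real" where
  "delta_hyp L H = (THE c. \<exists>x f. x \<noteq> 0 \<and> L = line x \<and>
     f \<in> dual_space \<and> f \<noteq> (\<lambda>_. 0) \<and> H = ker f \<and>
     c = absval (f x) / (dual_norm f * canonical_norm x))"

lemma absval_nonneg: "0 \<le> absval (x :: 'k::absval_field)"
proof -
  have "absval x = dist x 0" by (simp add: dist_absval)
  then show ?thesis by simp
qed

lemma absval_zero: "absval (0 :: 'k::absval_field) = 0"
  by (simp add: absval_eq_0_iff)

lemma absval_sum: "absval (sum h A :: 'k::absval_field) \<le> (\<Sum>i\<in>A. absval (h i))"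
proof (induction A rule: infinite_finite_induct)
  case (insert a A)
  then show ?case using absval_triangle[of "h a" "sum h A"] by auto
qed (simp_all add: absval_zero)

lemma canonical_norm_scale:
  "canonical_norm (c *s x) = absval c * canonical_norm (x :: 'k::absval_field ^ 'd)"
proof -
  have "absval c * Max (range (\<lambda>i. absval (x $ i)))
      = Max ((\<lambda>r. absval c * r) ` range (\<lambda>i. absval (x $ i)))"
    by (rule mono_Max_commute) (auto simp: mono_def mult_left_mono absval_nonneg)
  moreover have "sqrt (\<Sum>i\<in>UNIV. (absval c)\<^sup>2 * (absval (x $ i))\<^sup>2)
      = absval c * sqrt (\<Sum>i\<in>UNIV. (absval (x $ i))\<^sup>2)"
    by (simp only: sum_distrib_left[symmetric] real_sqrt_mult real_sqrt_abs
        abs_of_nonneg[OF absval_nonneg])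
  ultimately show ?thesis
    unfolding canonical_norm_def
    by (simp add: absval_mult power_mult_distrib image_image)
qed

lemma absval_le_canonical_norm: "absval (x $ i) \<le> canonical_norm (x :: 'k::absval_field ^ 'd)"
proof (cases "nonarchimedean TYPE('k)")
  case True
  then show ?thesis unfolding canonical_norm_def by (auto intro!: Max_ge)
next
  case False
  have "(absval (x $ i))\<^sup>2 \<le> (\<Sum>i\<in>UNIV. (absval (x $ i))\<^sup>2)"
    by (intro member_le_sum) auto
  then show ?thesis using False unfolding canonical_norm_def
    by (simp add: real_le_rsqrt)
qed

lemma canonical_norm_pos:
  assumes "x \<noteq> 0" shows "0 < canonical_norm (x :: 'k::absval_field ^ 'd)"
proof -
  obtain i where "x $ i \<noteq> 0" using assms by (auto simp: vec_eq_iff)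
  then have "0 < absval (x $ i)" using absval_nonneg absval_eq_0_iff
    by (metis less_eq_real_def)
  then show ?thesis using absval_le_canonical_norm[of x i] by linarith
qed

lemma dual_space_iff:
  "f \<in> dual_space \<longleftrightarrow> (\<forall>x y. f (x + y) = f x + f y) \<and> (\<forall>c x. f (c *s x) = c * f x)"
  by (simp add: dual_space_def Vector_Spaces.linear_iff vec.vector_space_axioms
      vector_space_over_itself.vector_space_axioms)

lemma dual_scale: "f \<in> dual_space \<Longrightarrow> f (c *s x) = c * f x"
  by (simp add: dual_space_iff)

lemma dual_add: "f \<in> dual_space \<Longrightarrow> f (x + y) = f x + f y"
  by (simp add: dual_space_iff)

lemma dual_zero: "f \<in> dual_space \<Longrightarrow> f 0 = 0"
  using dual_scale[of f 0 0] by simp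

lemma dual_sum: "f \<in> dual_space \<Longrightarrow> f (\<Sum>i\<in>A. h i) = (\<Sum>i\<in>A. f (h i))"
  by (induction A rule: infinite_finite_induct) (auto simp: dual_add dual_zero)

lemma dual_bdd:
  fixes f :: "'k::absval_field ^ 'd \<Rightarrow> 'k"
  assumes "f \<in> dual_space"
  shows "bdd_above ((\<lambda>x. absval (f x) / canonical_norm x) ` (-{0}))"
proof (rule bdd_aboveI2)
  fix x :: "'k ^ 'd" assume "x \<in> -{0}"
  then have pos: "0 < canonical_norm x" by (simp add: canonical_norm_pos)
  have "f x = f (\<Sum>i\<in>UNIV. x $ i *s axis i 1)" by (simp add: basis_expansion)
  also have "\<dots> = (\<Sum>i\<in>UNIV. x $ i * f (axis i 1))"
    by (simp add: dual_sum[OF assms] dual_scale[OF assms])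
  finally have "absval (f x) \<le> (\<Sum>i\<in>UNIV. absval (x $ i) * absval (f (axis i 1)))"
    using absval_sum[of "\<lambda>i. x $ i * f (axis i 1)" UNIV] by (simp add: absval_mult)
  also have "\<dots> \<le> (\<Sum>i\<in>UNIV. canonical_norm x * absval (f (axis i 1)))"
    by (intro sum_mono mult_right_mono absval_le_canonical_norm absval_nonneg)
  also have "\<dots> = (\<Sum>i\<in>UNIV. absval (f (axis i 1))) * canonical_norm x"
    by (subst sum_distrib_left[symmetric]) (rule mult.commute)
  finally show "absval (f x) / canonical_norm x \<le> (\<Sum>i\<in>UNIV. absval (f (axis i 1)))"
    by (simp only: pos_divide_le_eq[OF pos])
qed

lemma dual_norm_pos:
  assumes "f \<in> dual_space" "f \<noteq> (\<lambda>_. 0)" shows "0 < dual_norm f"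
proof -
  obtain x where x: "f x \<noteq> 0" using assms(2) by auto
  then have "x \<noteq> 0" using dual_zero[OF assms(1)] by auto
  have "0 < absval (f x)" using absval_nonneg absval_eq_0_iff x by (metis less_eq_real_def)
  then have "0 < absval (f x) / canonical_norm x"
    using canonical_norm_pos[OF \<open>x \<noteq> 0\<close>] by simp
  also have "\<dots> \<le> dual_norm f" unfolding dual_norm_def
    using \<open>x \<noteq> 0\<close> by (intro cSUP_upper dual_bdd assms) auto
  finally show ?thesis .
qed

lemma dual_norm_scale_le:
  fixes f :: "'k::absval_field ^ 'd \<Rightarrow> 'k"
  assumes "f \<in> dual_space"
  shows "dual_norm (\<lambda>x. c * f x) \<le> absval c * dual_norm f"
proof -
  have ne: "-{0} \<noteq> ({} :: ('k ^ 'd) set)"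
  proof -
    have "axis undefined 1 \<noteq> (0 :: 'k ^ 'd)" by simp
    then show ?thesis by blast
  qed
  show ?thesis unfolding dual_norm_def
  proof (rule cSUP_least[OF ne])
    fix x :: "'k ^ 'd" assume "x \<in> -{0}"
    then have "absval (f x) / canonical_norm x \<le> (SUP x\<in>-{0}. absval (f x) / canonical_norm x)"
      by (intro cSUP_upper dual_bdd assms)
    from mult_left_mono[OF this absval_nonneg[of c]]
    show "absval (c * f x) / canonical_norm x
        \<le> absval c * (SUP x\<in>-{0}. absval (f x) / canonical_norm x)"
      by (simp add: absval_mult)
  qed
qed

lemma dual_space_scale: "f \<in> dual_space \<Longrightarrow> (\<lambda>x. c * f x) \<in> dual_space"
  by (simp add: dual_space_iff distrib_left mult.left_commute)

lemma absval_one: "absval (1 :: 'k::absval_field) = 1"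
  using absval_mult[of "1::'k" 1] absval_eq_0_iff[of "1::'k"] by simp

lemma dual_norm_scale:
  assumes "f \<in> dual_space" "c \<noteq> 0"
  shows "dual_norm (\<lambda>x. c * f x) = absval c * dual_norm f"
proof (rule antisym[OF dual_norm_scale_le[OF assms(1)]])
  have "dual_norm (\<lambda>x. inverse c * (c * f x)) \<le> absval (inverse c) * dual_norm (\<lambda>x. c * f x)"
    by (rule dual_norm_scale_le[OF dual_space_scale[OF assms(1)]])
  moreover have "(\<lambda>x. inverse c * (c * f x)) = f"
    using assms(2) by (simp add: field_simps)
  ultimately have "dual_norm f \<le> absval (inverse c) * dual_norm (\<lambda>x. c * f x)" by simp
  from mult_left_mono[OF this absval_nonneg[of c]]
  have "absval c * dual_norm f \<le> (absval c * absval (inverse c)) * dual_norm (\<lambda>x. c * f x)"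
    by (simp only: mult.assoc)
  also have "absval c * absval (inverse c) = 1"
    using assms(2) by (metis absval_mult right_inverse absval_one)
  finally show "absval c * dual_norm f \<le> dual_norm (\<lambda>x. c * f x)" by simp
qed

lemma ker_eq_imp_scale:
  assumes "f \<in> dual_space" "g \<in> dual_space" "g \<noteq> (\<lambda>_. 0)" "ker f = ker g"
  obtains c where "c \<noteq> 0" "g = (\<lambda>x. c * f x)"
proof -
  obtain y where y: "g y \<noteq> 0" using assms(3) by auto
  then have fy: "f y \<noteq> 0" using assms(4) by (auto simp: ker_def)
  have "g x = (g y / f y) * f x" for x
  proof -
    have "f (x + (- (f x / f y)) *s y) = 0"
      using fy by (simp only: dual_add[OF assms(1)] dual_scale[OF assms(1)]) simp
    then have "g (x + (- (f x / f y)) *s y) = 0" using assms(4) by (auto simp: ker_def)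
    then have "g x + (- (f x / f y)) * g y = 0"
      by (simp only: dual_add[OF assms(2)] dual_scale[OF assms(2)])
    then show ?thesis by simp
  qed
  then have "g = (\<lambda>x. (g y / f y) * f x)" by (rule ext)
  with y fy show thesis by (intro that[of "g y / f y"]) simp_all
qed

lemma line_eq_imp_scale:
  assumes "y \<noteq> 0" "line x = line y"
  obtains c where "c \<noteq> 0" "y = c *s x"
proof -
  have "y \<in> line x" using assms(2) vec.span_base[of y "{y}"] by (simp add: line_def)
  then obtain c where "y = c *s x" unfolding line_def vec.span_singleton by auto
  with assms(1) that[of c] show thesis by auto
qed

lemma delta_hyp_eq:
  assumes "x \<noteq> 0" "f \<in> dual_space" "f \<noteq> (\<lambda>_. 0)"
  shows "delta_hyp (line x) (ker f) = absval (f x) / (dual_norm f * canonical_norm x)"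
  unfolding delta_hyp_def
proof (rule the_equality)
  show "\<exists>x' f'. x' \<noteq> 0 \<and> line x = line x' \<and> f' \<in> dual_space \<and> f' \<noteq> (\<lambda>_. 0) \<and> ker f = ker f' \<and>
      absval (f x) / (dual_norm f * canonical_norm x)
        = absval (f' x') / (dual_norm f' * canonical_norm x')"
    using assms by blast
next
  fix c
  assume "\<exists>x' f'. x' \<noteq> 0 \<and> line x = line x' \<and> f' \<in> dual_space \<and> f' \<noteq> (\<lambda>_. 0) \<and> ker f = ker f' \<and>
      c = absval (f' x') / (dual_norm f' * canonical_norm x')"
  then obtain y g where y: "y \<noteq> 0" "line x = line y" and
      g: "g \<in> dual_space" "g \<noteq> (\<lambda>_. 0)" "ker f = ker g" and
      c: "c = absval (g y) / (dual_norm g * canonical_norm y)" by blast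
  obtain a where a: "a \<noteq> 0" "y = a *s x" using line_eq_imp_scale[OF y] .
  obtain b where b: "b \<noteq> 0" "g = (\<lambda>x. b * f x)" using ker_eq_imp_scale[OF assms(2) g] .
  have "absval a \<noteq> 0" "absval b \<noteq> 0" using a b by (simp_all add: absval_eq_0_iff)
  then show "c = absval (f x) / (dual_norm f * canonical_norm x)"
    unfolding c b(2) dual_norm_scale[OF assms(2) b(1)] a(2) canonical_norm_scale
      dual_scale[OF assms(2)] absval_mult
    by simp
qed

definition SL :: "('k::field ^ 'd ^ 'd) set" where
  "SL = {g. det g = 1}"

definition prob_on_SL :: "('k::absval_field ^ 'd ^ 'd) measure \<Rightarrow> bool" where
  "prob_on_SL \<mu> \<longleftrightarrow> prob_space \<mu> \<and> sets \<mu> = sets (restrict_space borel SL)"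

definition supp :: "('k::absval_field ^ 'd ^ 'd) measure \<Rightarrow> ('k ^ 'd ^ 'd) set" where
  "supp \<mu> = {g \<in> SL. \<forall>U. open U \<and> g \<in> U \<longrightarrow> emeasure \<mu> (U \<inter> SL) > 0}"

definition generated_closed_semigroup :: "('k::absval_field ^ 'd ^ 'd) measure \<Rightarrow> ('k ^ 'd ^ 'd) set" where
  "generated_closed_semigroup \<mu> = \<Inter> {S. closedin (top_of_set SL) S \<and> (\<forall>g\<in>S. \<forall>h\<in>S. g ** h \<in> S) \<and> supp \<mu> \<subseteq> S}"

definition exp_local_moment :: "('k::absval_field ^ 'd ^ 'd) measure \<Rightarrow> bool" where
  "exp_local_moment \<mu> \<longleftrightarrow> (\<exists>\<tau>>0. (\<integral>\<^sup>+ g. ennreal (op_norm g powr \<tau>) \<partial>\<mu>) < \<infinity>)"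

text \<open>The family \<open>W\<close> must be non-empty, since the empty union is always preserved.\<close>

definition strongly_irreducible :: "('k::field ^ 'd ^ 'd) set \<Rightarrow> bool" where
  "strongly_irreducible G \<longleftrightarrow> \<not> (\<exists>W :: ('k ^ 'd) set set. finite W \<and> W \<noteq> {} \<and>
     (\<forall>E\<in>W. vec.subspace E \<and> E \<noteq> {0} \<and> E \<noteq> UNIV) \<and>
     (\<forall>g\<in>G. (*v) g ` \<Union>W \<subseteq> \<Union>W))"

definition contracting :: "('k::absval_field ^ 'd ^ 'd) set \<Rightarrow> bool" where
  "contracting G \<longleftrightarrow> (\<exists>\<gamma> r. (\<forall>n::nat. \<gamma> n \<in> G \<and> op_norm (scale_mat (r n) (\<gamma> n)) = 1) \<and>
     (\<exists>\<phi> B. strict_mono (\<phi> :: nat \<Rightarrow> nat) \<and> rank B = 1 \<and>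
        (\<lambda>n. scale_mat (r (\<phi> n)) (\<gamma> (\<phi> n))) \<longlonglongrightarrow> B))"

definition convolution_action ::
  "('k::absval_field ^ 'd ^ 'd) measure \<Rightarrow> ('k ^ 'd) set measure \<Rightarrow> ('k ^ 'd) set measure" where
  "convolution_action \<mu> \<nu> = distr (\<mu> \<Otimes>\<^sub>M \<nu>) proj_borel (\<lambda>(g, L). (*v) g ` L)"

definition invariant_prob ::
  "('k::absval_field ^ 'd ^ 'd) measure \<Rightarrow> ('k ^ 'd) set measure \<Rightarrow> bool" where
  "invariant_prob \<mu> \<nu> \<longleftrightarrow> prob_space \<nu> \<and> sets \<nu> = sets proj_borel \<and> convolution_action \<mu> \<nu> = \<nu>"

end

theory Submission
  imports Defs "HOL-Probability.Infinite_Product_Measure" "HOL-Library.Diagonal_Subsequence"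
    "HOL-Number_Theory.Cong"
begin

text \<open>
  By stationarity the mass that \<open>g\<^sub>*\<nu>\<close> gives to the \<open>\<epsilon>\<close>-neighbourhood of \<open>ker f\<close> is a harmonic
  function of \<open>g\<close>.  Evaluating it along the right random walk replaces \<open>f\<close> by \<open>f g\<close> and \<open>\<epsilon>\<close> by
  \<open>\<epsilon>\<close> times the stretch of \<open>g\<close> at \<open>f\<close>, unless \<open>\<epsilon>\<close> times the distortion of \<open>g\<close> is large.  If the
  stretch is at most \<open>s\<close> outside an event of exponentially small probability, then the supremum
  \<open>\<phi>(\<epsilon>)\<close> over \<open>f\<close> of the masses satisfies \<open>\<phi>(s\<^sup>m) \<le> \<phi>(s\<^sup>m\<^sup>+\<^sup>1) + R q\<^sup>m\<close>, and this telescopes because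
  \<open>\<phi>(\<epsilon>) \<rightarrow> 0\<close>.

  The stretch is controlled by the cocycle \<open>\<sigma>(g, (f, w)) = ln (\<parallel>w g\<parallel> / \<parallel>w\<parallel>) - 2 ln (\<parallel>f g\<parallel> / \<parallel>f\<parallel>)\<close> on
  pairs of a covector and an alternating form.  A maximal inequality for the harmonic functions
  above, in place of martingale convergence, shows that the walk contracts: the cocycle tends to
  \<open>-\<infinity>\<close> in probability and its running maxima are tight, uniformly in \<open>(f, w)\<close>.  The truncated
  maximum of the partial sums then serves as a potential which turns this into a uniformly negative
  drift, and the exponential moment turns the drift into exponential contraction.  Neither Lyapunov
  exponents nor an ergodic theorem are needed.
\<close>

text \<open>The supremum over hyperplanes forces every estimate to be uniform in the covector.
  Almost sure convergence would give each \<open>f\<close> its limit at an uncontrolled speed. The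
  maximal inequality instead bounds the probability that \<open>f\<close> is ever shrunk by the mass
  of a neighbourhood of \<open>ker f\<close> at time zero, and compactness of the set of directions
  makes that mass small for all \<open>f\<close> at once. New factors enter on the right, so a
  covector moves by a Markov chain \<open>f\<close>, \<open>f g\<^sub>0\<close>,
  \<open>f g\<^sub>0 g\<^sub>1\<close>, and so on. The cocycle is additive along it; a bound that is
  uniform in the starting pair therefore passes from one block to the next. The weights 1 and -2 in
  the cocycle cancel any scaling of \<open>g\<close>, so only projective contraction is measured,
  and its exponential is the stretch up to constants. Tightness of the running maxima says nothing
  about their expectations. Truncation makes the potential bounded, and a bounded potential cannot
  pay for a fixed gain per block for ever. At scale \<open>t ^ m\<close> the walk runs for a fixed
  multiple of \<open>m\<close> steps: its distortion grows at most exponentially, and a small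
  \<open>t\<close> outweighs it, while the stretch only has to fall below a fixed constant.\<close>

section \<open>Fields with an absolute value\<close>

lemma absval_minus: "absval (- x :: 'k::absval_field) = absval x"
proof -
  have "(absval (- 1 :: 'k))\<^sup>2 = 1"
    unfolding power2_eq_square absval_mult[symmetric] by (simp add: absval_one)
  then have "absval (- 1 :: 'k) = 1"
    using absval_nonneg[of "- 1 :: 'k"] by (simp add: power2_eq_1_iff)
  then show ?thesis using absval_mult[of "-1" x] by simp
qed

lemma absval_diff_commute: "absval (x - y :: 'k::absval_field) = absval (y - x)"
  using absval_minus[of "x - y"] by simp

lemma absval_inverse: "absval (inverse x :: 'k::absval_field) = inverse (absval x)"
proof (cases "x = 0")
  case False
  then have "absval (inverse x) * absval x = 1"
    by (simp add: absval_mult[symmetric] absval_one)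
  moreover have "absval x \<noteq> 0" using False by (simp add: absval_eq_0_iff)
  ultimately show ?thesis by (simp add: field_simps)
qed (simp add: absval_zero)

lemma absval_diff_le: "absval (x - y :: 'k::absval_field) \<le> absval x + absval y"
  using absval_triangle[of x "- y"] by (simp add: absval_minus)

lemma abs_absval_diff_le: "\<bar>absval x - absval y\<bar> \<le> absval (x - y :: 'k::absval_field)"
  using absval_triangle[of "x - y" y] absval_triangle[of "y - x" x]
  by (simp add: absval_diff_commute)

lemma tendsto_absval_iff:
  "(f \<longlongrightarrow> l) F \<longleftrightarrow> ((\<lambda>n. absval (f n - l :: 'k::absval_field)) \<longlongrightarrow> 0) F"
  unfolding dist_absval[symmetric] by (rule tendsto_dist_iff)

lemma tendsto_absval [tendsto_intros]:
  assumes "(f \<longlongrightarrow> l) F"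
  shows "((\<lambda>n. absval (f n :: 'k::absval_field)) \<longlongrightarrow> absval l) F"
proof (rule LIM_zero_cancel, rule Lim_null_comparison)
  show "\<forall>\<^sub>F n in F. norm (absval (f n) - absval l) \<le> absval (f n - l)"
    by (simp add: abs_absval_diff_le)
  show "((\<lambda>n. absval (f n - l)) \<longlongrightarrow> 0) F"
    by (rule tendsto_absval_iff[of f l F, THEN iffD1, OF assms])
qed

text \<open>With this instance and the next, \<open>tendsto_intros\<close> and
  \<open>continuous_intros\<close> reach sums and products of entries, hence the matrix expressions
  below.\<close>

instance absval_field \<subseteq> topological_ab_group_add
proof
  fix a b :: 'a
  have fs: "(fst \<longlongrightarrow> a) (nhds a \<times>\<^sub>F nhds b)" "(snd \<longlongrightarrow> b) (nhds a \<times>\<^sub>F nhds b)"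
    by (auto simp: filterlim_fst filterlim_snd)
  have "((\<lambda>x. absval (fst x - a) + absval (snd x - b)) \<longlongrightarrow> 0 + 0) (nhds a \<times>\<^sub>F nhds b)"
    by (intro tendsto_add tendsto_absval_iff[THEN iffD1] fs)
  then have lim: "((\<lambda>x. absval (fst x - a) + absval (snd x - b)) \<longlongrightarrow> 0) (nhds a \<times>\<^sub>F nhds b)"
    by simp
  have "absval (fst x + snd x - (a + b)) \<le> absval (fst x - a) + absval (snd x - b)" for x
    using absval_triangle[of "fst x - a" "snd x - b"] by (simp add: algebra_simps)
  then have "\<forall>\<^sub>F x in nhds a \<times>\<^sub>F nhds b. norm (absval (fst x + snd x - (a + b)))
      \<le> absval (fst x - a) + absval (snd x - b)"
    by (simp add: absval_nonneg)
  then show "((\<lambda>x. fst x + snd x) \<longlongrightarrow> a + b) (nhds a \<times>\<^sub>F nhds b)"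
    by (rule tendsto_absval_iff[THEN iffD2, OF Lim_null_comparison[OF _ lim]])
next
  fix a :: 'a
  show "(uminus \<longlongrightarrow> - a) (nhds a)"
    unfolding tendsto_absval_iff[of uminus]
    using tendsto_absval_iff[THEN iffD1, OF filterlim_ident, of a]
    by (simp add: absval_diff_commute[of _ a])
qed

instance absval_field \<subseteq> topological_comm_monoid_mult
proof
  fix a b :: 'a
  have fs: "(fst \<longlongrightarrow> a) (nhds a \<times>\<^sub>F nhds b)" "(snd \<longlongrightarrow> b) (nhds a \<times>\<^sub>F nhds b)"
    by (auto simp: filterlim_fst filterlim_snd)
  have "((\<lambda>x. absval (fst x) * absval (snd x - b) + absval (fst x - a) * absval b)
      \<longlongrightarrow> absval a * 0 + 0 * absval b) (nhds a \<times>\<^sub>F nhds b)"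
    by (intro tendsto_add tendsto_mult tendsto_const tendsto_absval tendsto_absval_iff[THEN iffD1] fs)
  then have lim: "((\<lambda>x. absval (fst x) * absval (snd x - b) + absval (fst x - a) * absval b)
      \<longlongrightarrow> 0) (nhds a \<times>\<^sub>F nhds b)" by simp
  have "absval (fst x * snd x - a * b)
      \<le> absval (fst x) * absval (snd x - b) + absval (fst x - a) * absval b" for x
    using absval_triangle[of "fst x * (snd x - b)" "(fst x - a) * b"]
    by (simp add: algebra_simps absval_mult[symmetric])
  then have "\<forall>\<^sub>F x in nhds a \<times>\<^sub>F nhds b. norm (absval (fst x * snd x - a * b))
      \<le> absval (fst x) * absval (snd x - b) + absval (fst x - a) * absval b"
    by (simp add: absval_nonneg)
  then show "((\<lambda>x. fst x * snd x) \<longlongrightarrow> a * b) (nhds a \<times>\<^sub>F nhds b)"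
    by (rule tendsto_absval_iff[THEN iffD2, OF Lim_null_comparison[OF _ lim]])
qed

lemma tendsto_inverse_absval:
  fixes f :: "'b \<Rightarrow> 'k::absval_field"
  assumes f: "(f \<longlongrightarrow> l) F" and l: "l \<noteq> 0"
  shows "((\<lambda>n. inverse (f n)) \<longlongrightarrow> inverse l) F"
proof -
  have pos: "0 < absval l" using l absval_nonneg absval_eq_0_iff by (metis less_eq_real_def)
  have "((\<lambda>n. absval (f n - l) * (inverse (absval (f n)) * inverse (absval l)))
      \<longlongrightarrow> 0 * (inverse (absval l) * inverse (absval l))) F"
    using pos by (intro tendsto_mult tendsto_const tendsto_inverse tendsto_absval tendsto_absval_iff[THEN iffD1]
        f) auto
  then have lim: "((\<lambda>n. absval (f n - l) * (inverse (absval (f n)) * inverse (absval l))) \<longlongrightarrow> 0) F"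
    by simp
  have "\<forall>\<^sub>F n in F. f n \<noteq> 0"
    using tendsto_absval[OF f] pos order_tendstoD(1)
    by (metis (mono_tags, lifting) absval_zero eventually_mono less_irrefl)
  then have ev: "\<forall>\<^sub>F n in F. absval (inverse (f n) - inverse l)
      = absval (f n - l) * (inverse (absval (f n)) * inverse (absval l))"
  proof eventually_elim
    case (elim n)
    then have "inverse (f n) - inverse l = (l - f n) * (inverse (f n) * inverse l)"
      using l by (simp add: field_simps)
    then show ?case by (simp only: absval_mult absval_inverse absval_diff_commute[of l])
  qed
  show ?thesis
    by (rule tendsto_absval_iff[THEN iffD2, OF tendsto_cong[OF ev, THEN iffD2, OF lim]])
qed

text \<open>The Heine-Borel property in sequential form. The limit may lie outside \<open>K\<close>;
  where it must lie inside, closedness of \<open>K\<close> is supplied separately. Sequences suit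
  the repeated extraction of subsequences over a finite set of coordinates.\<close>

definition bounded_seqs_subconverge :: "'k::absval_field set \<Rightarrow> bool" where
  "bounded_seqs_subconverge K \<longleftrightarrow> (\<forall>R x. (\<forall>n. x n \<in> K \<and> absval (x n) \<le> R) \<longrightarrow>
     (\<exists>l r. strict_mono (r :: nat \<Rightarrow> nat) \<and> (\<lambda>n. x (r n)) \<longlonglongrightarrow> l))"

lemma finite_family_subconverge:
  fixes x :: "nat \<Rightarrow> 'b \<Rightarrow> 'k::absval_field"
  assumes "bounded_seqs_subconverge K" "finite B"
    and "\<And>n b. b \<in> B \<Longrightarrow> x n b \<in> K \<and> absval (x n b) \<le> R"
  shows "\<exists>l r. strict_mono (r :: nat \<Rightarrow> nat) \<and> (\<forall>b\<in>B. (\<lambda>n. x (r n) b) \<longlonglongrightarrow> l b)"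
  using assms(2,3)
proof (induction B)
  case empty
  show ?case using strict_mono_id by blast
next
  case (insert a B)
  obtain l r where r: "strict_mono r" "\<forall>b\<in>B. (\<lambda>n. x (r n) b) \<longlonglongrightarrow> l b"
    using insert.IH insert.prems by blast
  have "\<forall>n. x (r n) a \<in> K \<and> absval (x (r n) a) \<le> R" using insert.prems by auto
  then obtain l' r' where r': "strict_mono (r' :: nat \<Rightarrow> nat)" "(\<lambda>n. x (r (r' n)) a) \<longlonglongrightarrow> l'"
    using assms(1)[unfolded bounded_seqs_subconverge_def, rule_format, of "\<lambda>n. x (r n) a" R] by blast
  have "(\<lambda>n. x (r (r' n)) b) \<longlonglongrightarrow> l b" if "b \<in> B" for b
    using LIMSEQ_subseq_LIMSEQ[OF r(2)[rule_format, OF that] r'(1)] by (simp add: o_def)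
  then have "\<forall>b\<in>insert a B. (\<lambda>n. x ((r \<circ> r') n) b) \<longlonglongrightarrow> (l(a := l')) b"
    using r'(2) insert.hyps by auto
  then show ?case using strict_mono_o[OF r(1) r'(1)] by blast
qed

lemma bounded_seqs_subconverge_isometric:
  fixes \<phi> :: "'b::heine_borel \<Rightarrow> 'k::absval_field"
  assumes surj: "surj \<phi>" and bnd: "\<And>R. bounded {z. absval (\<phi> z) \<le> R}"
    and dist: "\<And>y z. absval (\<phi> y - \<phi> z) = dist y z"
  shows "bounded_seqs_subconverge (UNIV :: 'k set)"
  unfolding bounded_seqs_subconverge_def
proof (intro allI impI)
  fix R and x :: "nat \<Rightarrow> 'k"
  assume x: "\<forall>n. x n \<in> UNIV \<and> absval (x n) \<le> R"
  have inv: "\<phi> (inv \<phi> (x n)) = x n" for n using surj by (simp add: surj_f_inv_f)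
  have "bounded (range (\<lambda>n. inv \<phi> (x n)))"
    using x inv by (intro bounded_subset[OF bnd[of R]]) auto
  then obtain l r where "strict_mono r" and r: "((\<lambda>n. inv \<phi> (x n)) \<circ> r) \<longlonglongrightarrow> l"
    using bounded_imp_convergent_subsequence by blast
  have "(\<lambda>n. dist (inv \<phi> (x (r n))) l) \<longlonglongrightarrow> 0"
    using tendsto_dist_iff[THEN iffD1, OF r] by (simp add: o_def)
  then have "(\<lambda>n. x (r n)) \<longlonglongrightarrow> \<phi> l"
    unfolding tendsto_absval_iff[of "\<lambda>n. x (r n)"] by (simp add: dist[symmetric] inv)
  with \<open>strict_mono r\<close>
  show "\<exists>l r. strict_mono (r :: nat \<Rightarrow> nat) \<and> (\<lambda>n. x (r n)) \<longlonglongrightarrow> l" by blast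
qed

lemma ring_hom_on_diff:
  assumes "ring_hom_on UNIV \<phi>" shows "\<phi> (y - z) = \<phi> y - \<phi> z"
  using assms unfolding ring_hom_on_def by (metis UNIV_I add_diff_cancel diff_add_cancel)

lemma is_real_field_subconverge:
  assumes "is_real_field TYPE('k::absval_field)"
  shows "bounded_seqs_subconverge (UNIV :: 'k set)"
proof -
  obtain \<phi> :: "real \<Rightarrow> 'k" where \<phi>: "bij \<phi>" "ring_hom_on UNIV \<phi>" "\<And>x. absval (\<phi> x) = \<bar>x\<bar>"
    using assms unfolding is_real_field_def by blast
  show ?thesis
  proof (rule bounded_seqs_subconverge_isometric[of \<phi>])
    show "bounded {z. absval (\<phi> z) \<le> R}" for R unfolding \<phi>(3) bounded_iff by auto
  qed (use \<phi> in \<open>auto simp: ring_hom_on_diff[symmetric] dist_real_def bij_def\<close>)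
qed

lemma is_complex_field_subconverge:
  assumes "is_complex_field TYPE('k::absval_field)"
  shows "bounded_seqs_subconverge (UNIV :: 'k set)"
proof -
  obtain \<phi> :: "complex \<Rightarrow> 'k" where \<phi>: "bij \<phi>" "ring_hom_on UNIV \<phi>" "\<And>x. absval (\<phi> x) = cmod x"
    using assms unfolding is_complex_field_def by blast
  show ?thesis
  proof (rule bounded_seqs_subconverge_isometric[of \<phi>])
    show "bounded {z. absval (\<phi> z) \<le> R}" for R unfolding \<phi>(3) bounded_iff by auto
  qed (use \<phi> in \<open>auto simp: ring_hom_on_diff[symmetric] dist_norm bij_def\<close>)
qed

section \<open>Compactness and separability of local fields\<close>

lemma padic_absval_of_int:
  assumes "z \<noteq> 0"
  shows "padic_absval p (of_int z) = real p powi (- int (multiplicity (int p) z))"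
proof -
  have "Fract z 1 = of_int z" by (simp add: Fract_of_int_eq)
  then have "quotient_of (of_int z) = (z, 1)" by (metis quotient_of_int of_int_def)
  then show ?thesis using assms by (simp add: padic_absval_def)
qed

text \<open>The reduced denominator of a \<open>p\<close>-integral rational is prime to
  \<open>p\<close>, hence invertible modulo \<open>p ^ N\<close>, and \<open>c\<close> is the
  residue of the fraction. This makes finite nets of the unit ball explicit. Multiplicativity is a
  hypothesis because the embedding into the field provides it at once.\<close>

lemma padic_approx_nat:
  assumes p: "prime p" and q: "padic_absval p q \<le> 1"
    and mult: "\<And>x y. padic_absval p (x * y) = padic_absval p x * padic_absval p y"
  shows "\<exists>c<p ^ N. padic_absval p (q - of_nat c) \<le> (1 / real p) ^ N"
proof -
  have p1: "1 < real p" using prime_gt_1_nat[OF p] by simp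
  have pi: "prime (int p)" using p by simp
  obtain a b where ab: "quotient_of q = (a, b)" by force
  have b: "b > 0" and cop: "coprime a b" and q_eq: "q = of_int a / of_int b"
    using quotient_of_denom_pos[OF ab] quotient_of_coprime[OF ab] quotient_of_div[OF ab] by auto
  have ndvd: "\<not> int p dvd b"
  proof
    assume dvd: "int p dvd b"
    then have "\<not> int p dvd a" using cop pi by (metis coprime_common_divisor not_prime_unit)
    then have a: "a \<noteq> 0" "multiplicity (int p) a = 0" by (auto simp: not_dvd_imp_multiplicity_0)
    have "1 \<le> multiplicity (int p) b"
      using dvd b pi by (intro multiplicity_geI) auto
    then have "1 < padic_absval p q"
      using ab a b q_eq p1 by (simp add: padic_absval_def power_int_def)
    then show False using q by simp
  qed
  then have copp: "coprime b (int p ^ N)"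
    using pi by (metis coprime_commute coprime_power_left_iff prime_imp_coprime)
  obtain x where x: "[b * x = 1] (mod int p ^ N)" using cong_solve_coprime_int[OF copp] by auto
  define c where "c = nat ((x * a) mod int p ^ N)"
  have pN: "0 < int p ^ N" using p1 by simp
  have c: "int c = (x * a) mod int p ^ N" "c < p ^ N"
    using pN by (auto simp: c_def nat_less_iff)
  have "[b * int c = b * (x * a)] (mod int p ^ N)"
    unfolding c by (simp add: cong_def mod_mult_right_eq)
  also have "[b * (x * a) = a] (mod int p ^ N)"
    using cong_mult[OF x cong_refl[of a]] by (simp add: mult.assoc)
  finally have dvd: "int p ^ N dvd a - b * int c"
    by (metis cong_iff_dvd_diff cong_sym)
  have v_b: "padic_absval p (of_int b) = 1"
    using b ndvd by (simp add: padic_absval_of_int not_dvd_imp_multiplicity_0)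
  have "(q - of_nat c) * of_int b = of_int (a - b * int c)"
    using b by (simp add: q_eq field_simps)
  then have "padic_absval p (q - of_nat c) = padic_absval p (of_int (a - b * int c))"
    using mult[of "q - of_nat c" "of_int b"] v_b by simp
  also have "\<dots> \<le> (1 / real p) ^ N"
  proof (cases "a - b * int c = 0")
    case False
    have "N \<le> multiplicity (int p) (a - b * int c)"
      using dvd False pi by (intro multiplicity_geI) auto
    then have "(1 / real p) ^ multiplicity (int p) (a - b * int c) \<le> (1 / real p) ^ N"
      using p1 by (intro power_decreasing) auto
    then show ?thesis
      using p1 by (simp only: padic_absval_of_int[OF False] power_int_minus power_int_of_nat
          power_one_over inverse_eq_divide)
  next
    case True
    then show ?thesis by (simp only: True) (simp add: padic_absval_def)
  qed
  finally show ?thesis using c(2) by blast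
qed

text \<open>Closed balls of \<open>K\<close> are complete and totally bounded: multiplication by a
  power \<open>p ^ m\<close> moves a ball into the unit ball, where the residues below
  \<open>p ^ N\<close> form a net.\<close>

lemma is_padic_subfield_subconverge:
  fixes K :: "'k::absval_field set"
  assumes p: "prime p" and K: "is_padic_subfield p K"
  shows "bounded_seqs_subconverge K"
proof -
  obtain \<iota> :: "rat \<Rightarrow> 'k" where \<iota>: "ring_hom_on UNIV \<iota>" "\<And>q. absval (\<iota> q) = padic_absval p q"
      "complete K" "K = closure (range \<iota>)"
    using K unfolding is_padic_subfield_def by blast
  have mult: "padic_absval p (x * y) = padic_absval p x * padic_absval p y" for x y
    using \<iota>(1) by (simp add: \<iota>(2)[symmetric] ring_hom_on_def absval_mult)
  have p1: "1 < real p" using prime_gt_1_nat[OF p] by simp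
  have "complete (K \<inter> {x. absval x \<le> R})" for R
  proof (rule complete_Int_closed[OF \<iota>(3)])
    have "closed (cball (0 :: 'k) R)" by simp
    then show "closed {x :: 'k. absval x \<le> R}"
      by (simp add: cball_def dist_absval absval_minus)
  qed
  moreover have "\<exists>T. finite T \<and> K \<inter> {x. absval x \<le> R} \<subseteq> (\<Union>x\<in>T. ball x e)" if e: "e > 0" for R e
  proof -
    obtain m where m: "R + 1 < real p ^ m" using real_arch_pow[OF p1] by blast
    obtain N where "2 * real p ^ m / e < real p ^ N" using real_arch_pow[OF p1] by blast
    then have N: "real p ^ m * (1 / real p) ^ N < e / 2"
      using e p1 by (simp add: field_simps)
    have pp: "padic_absval p (of_nat p ^ k) = (1 / real p) ^ k" for k
    proof -
      have "padic_absval p (of_nat p ^ k) = real p powi (- int (multiplicity (int p) (int p ^ k)))"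
        using padic_absval_of_int[of "int p ^ k" p] p1 by simp
      also have "multiplicity (int p) (int p ^ k) = k"
        using p by (intro multiplicity_same_power) auto
      finally show ?thesis by (simp add: power_int_minus power_one_over inverse_eq_divide)
    qed
    let ?T = "(\<lambda>c. \<iota> (of_nat c / of_nat p ^ m)) ` {..<p ^ N}"
    have "x \<in> (\<Union>t\<in>?T. ball t e)" if x: "x \<in> K" "absval x \<le> R" for x
    proof -
      have "0 < min (e / 2) 1" using e by simp
      then obtain q where q: "dist (\<iota> q) x < min (e / 2) 1"
        using x(1) closure_approachable[of x "range \<iota>"] \<iota>(4) by blast
      have "padic_absval p q \<le> R + 1"
        using q x(2) absval_triangle[of "\<iota> q - x" x] by (simp add: \<iota>(2)[symmetric] dist_absval)
      then have "padic_absval p (q * of_nat p ^ m) \<le> 1"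
        using m p1 by (simp add: mult pp power_one_over field_simps)
      then obtain c where c: "c < p ^ N" "padic_absval p (q * of_nat p ^ m - of_nat c) \<le> (1 / real p) ^ N"
        using padic_approx_nat[OF p _ mult] by blast
      have "(q - of_nat c / of_nat p ^ m) * of_nat p ^ m = q * of_nat p ^ m - of_nat c"
        using p1 by (simp add: field_simps)
      then have "padic_absval p (q - of_nat c / of_nat p ^ m) * (1 / real p) ^ m \<le> (1 / real p) ^ N"
        using c(2) mult[of "q - of_nat c / of_nat p ^ m" "of_nat p ^ m"] by (simp add: pp)
      then have "padic_absval p (q - of_nat c / of_nat p ^ m) \<le> real p ^ m * (1 / real p) ^ N"
        using p1 by (simp add: power_one_over field_simps)
      then have "dist (\<iota> q) (\<iota> (of_nat c / of_nat p ^ m)) < e / 2"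
        using N by (simp add: dist_absval ring_hom_on_diff[OF \<iota>(1), symmetric] \<iota>(2))
      then have "dist (\<iota> (of_nat c / of_nat p ^ m)) x < e"
        using q dist_triangle[of "\<iota> (of_nat c / of_nat p ^ m)" x "\<iota> q"]
        by (simp add: dist_commute)
      then show ?thesis using c(1) by auto
    qed
    then show ?thesis by (intro exI[of _ ?T]) auto
  qed
  ultimately have "seq_compact (K \<inter> {x. absval x \<le> R})" for R
    by (metis compact_eq_totally_bounded compact_eq_seq_compact_metric)
  then show ?thesis
    unfolding bounded_seqs_subconverge_def seq_compact_def o_def by (metis IntI mem_Collect_eq)
qed

lemma is_padic_subfield_closed:
  assumes "is_padic_subfield p K"
  shows "closed K" "subfield_set (K :: 'k::absval_field set)"
proof -
  obtain \<iota> :: "rat \<Rightarrow> 'k" where hom: "ring_hom_on UNIV \<iota>" and K: "K = closure (range \<iota>)"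
    using assms unfolding is_padic_subfield_def by blast
  have \<iota>: "\<iota> 1 = 1" "\<iota> (x + y) = \<iota> x + \<iota> y" "\<iota> (x * y) = \<iota> x * \<iota> y" "\<iota> (x - y) = \<iota> x - \<iota> y" for x y
    using hom ring_hom_on_diff[OF hom] by (auto simp: ring_hom_on_def)
  have \<iota>0: "\<iota> 0 = 0" using \<iota>(4)[of 0 0] by simp
  have \<iota>m: "\<iota> (- x) = - \<iota> x" for x using \<iota>(4)[of 0 x] \<iota>0 by simp
  have \<iota>i: "inverse (\<iota> x) = \<iota> (inverse x)" for x
    using \<iota>(3)[of x "inverse x"] \<iota>0 \<iota>(1) by (cases "x = 0") (auto intro: inverse_unique)
  show "closed K" by (simp add: K)
  have lim: "z \<in> K" if "s \<longlonglongrightarrow> z" "\<And>n. s n \<in> range \<iota>" for s z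
    using that unfolding K closure_sequential by blast
  have ex: "\<exists>s. (\<lambda>n. \<iota> (s n)) \<longlonglongrightarrow> x" if "x \<in> K" for x
  proof -
    have "\<exists>u. (\<forall>n. u n \<in> range \<iota>) \<and> u \<longlonglongrightarrow> x"
      using that by (simp only: K closure_sequential)
    then obtain u where u: "\<forall>n. u n \<in> range \<iota>" "u \<longlonglongrightarrow> x"
      by (elim exE conjE)
    have "\<iota> (inv \<iota> (u n)) = u n" for n using u(1) f_inv_into_f[of "u n" \<iota> UNIV] by blast
    then show ?thesis using u(2) by (intro exI[of _ "\<lambda>n. inv \<iota> (u n)"]) simp
  qed
  show "subfield_set K"
    unfolding subfield_set_def
  proof (intro conjI ballI)
    show "0 \<in> K" "1 \<in> K" using lim[OF tendsto_const, of 0] lim[OF tendsto_const, of 1] \<iota>0 \<iota>(1)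
      by (metis rangeI)+
    fix x assume "x \<in> K"
    then obtain s where s: "(\<lambda>n. \<iota> (s n)) \<longlonglongrightarrow> x" using ex by blast
    show "- x \<in> K" using lim[OF tendsto_minus[OF s]] by (metis \<iota>m rangeI)
    show "inverse x \<in> K"
    proof (cases "x = 0")
      case False
      show ?thesis using lim[OF tendsto_inverse_absval[OF s False]] by (metis \<iota>i rangeI)
    qed (use \<open>0 \<in> K\<close> in simp)
    fix y assume "y \<in> K"
    then obtain s' where s': "(\<lambda>n. \<iota> (s' n)) \<longlonglongrightarrow> y" using ex by blast
    show "x + y \<in> K" using lim[OF tendsto_add[OF s s']] by (metis \<iota>(2) rangeI)
    show "x * y \<in> K" using lim[OF tendsto_mult[OF s s']] by (metis \<iota>(3) rangeI)
  qed
qed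

text \<open>It suffices that coordinates of bounded sequences are bounded. For a spanning set of
  minimal cardinality they are: otherwise division by the largest coordinate gives, in the limit, a
  linear relation in which some \<open>b0\<close> has coefficient 1, and \<open>b0\<close> could be
  dropped from the spanning set.\<close>

lemma finite_extension_subconverge:
  fixes K :: "'k::absval_field set"
  assumes sub: "bounded_seqs_subconverge K" and K: "closed K" "subfield_set K"
    and span: "finite B" "\<And>x. \<exists>c. (\<forall>b\<in>B. c b \<in> K) \<and> x = (\<Sum>b\<in>B. c b * b)"
  shows "bounded_seqs_subconverge (UNIV :: 'k set)"
proof -
  let ?S = "\<lambda>B. finite B \<and> (\<forall>x. \<exists>c. (\<forall>b\<in>B. c b \<in> K) \<and> x = (\<Sum>b\<in>B. c b * b))"
  have K': "0 \<in> K" "1 \<in> K" "\<And>x y. x \<in> K \<Longrightarrow> y \<in> K \<Longrightarrow> x + y \<in> K"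
    "\<And>x y. x \<in> K \<Longrightarrow> y \<in> K \<Longrightarrow> x * y \<in> K" "\<And>x. x \<in> K \<Longrightarrow> - x \<in> K" "\<And>x. x \<in> K \<Longrightarrow> inverse x \<in> K"
    using K(2) by (auto simp: subfield_set_def)
  obtain B where B: "?S B" and min: "\<And>B'. ?S B' \<Longrightarrow> card B \<le> card B'"
    using ex_has_least_nat[of ?S B card] span by blast
  show ?thesis
    unfolding bounded_seqs_subconverge_def
  proof (intro allI impI)
    fix R and x :: "nat \<Rightarrow> 'k"
    assume x: "\<forall>n. x n \<in> UNIV \<and> absval (x n) \<le> R"
    have "\<exists>c. (\<forall>b\<in>B. c b \<in> K) \<and> x n = (\<Sum>b\<in>B. c b * b)" for n using B by blast
    then obtain c where c: "\<And>n b. b \<in> B \<Longrightarrow> c n b \<in> K" "\<And>n. x n = (\<Sum>b\<in>B. c n b * b)" by metis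
    define m where "m n = Max (insert 0 ((\<lambda>b. absval (c n b)) ` B))" for n
    have fin: "finite B" using B by blast
    have m_ge: "absval (c n b) \<le> m n" if "b \<in> B" for n b
      using that fin unfolding m_def by (intro Max_ge) auto
    have "\<exists>C. \<forall>n. m n \<le> C"
    proof (rule ccontr)
      assume "\<not> (\<exists>C. \<forall>n. m n \<le> C)"
      then have "\<exists>n. real j + 1 < m n" for j by (meson not_le)
      then obtain s where s: "\<And>j. real j + 1 < m (s j)" by metis
      have "\<exists>b\<in>B. absval (c (s j) b) = m (s j)" for j
      proof -
        have "m (s j) \<in> insert 0 ((\<lambda>b. absval (c (s j) b)) ` B)"
          unfolding m_def using fin by (intro Max_in) auto
        then show ?thesis using s[of j] by auto
      qed
      then obtain \<beta> where \<beta>: "\<And>j. \<beta> j \<in> B" "\<And>j. absval (c (s j) (\<beta> j)) = m (s j)" by metis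
      have "finite (range \<beta>)" using fin \<beta>(1) by (meson finite_subset image_subsetI)
      then obtain j0 where "infinite {j. \<beta> j = \<beta> j0}"
        using pigeonhole_infinite[of "UNIV :: nat set" \<beta>] by auto
      then obtain b0 where inf: "infinite {j. \<beta> j = b0}" by blast
      define e where "e = enumerate {j. \<beta> j = b0}"
      have e: "\<beta> (e j) = b0" "strict_mono e" for j
        using inf enumerate_in_set[OF inf] by (auto simp: e_def strict_mono_enumerate)
      \<comment> \<open>Along \<open>e\<close> the largest coordinate always sits at the same
        \<open>b0\<close>. After division by \<open>z j\<close> all coordinates have size at most 1,
        the one at \<open>b0\<close> equals 1, and the vector itself tends to 0.\<close>
      define z where "z j = c (s (e j)) b0" for j
      have abz: "absval (z j) = m (s (e j))" for j using \<beta>(2)[of "e j"] e(1) by (simp add: z_def)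
      have zpos: "real j + 1 < absval (z j)" for j
        using s[of "e j"] strict_mono_imp_increasing[OF e(2), of j] by (simp add: abz)
      have z0: "z j \<noteq> 0" for j using zpos[of j] by (auto simp: absval_zero)
      have b0: "b0 \<in> B" using \<beta>(1) e(1) by metis
      define r where "r j b = c (s (e j)) b * inverse (z j)" for j b
      have r: "r j b \<in> K" "absval (r j b) \<le> 1" if "b \<in> B" for j b
      proof -
        show "r j b \<in> K" using that b0 c(1) by (simp add: r_def z_def K')
        have "absval (c (s (e j)) b) \<le> absval (z j)" using m_ge[OF that] abz by simp
        moreover have "absval (r j b) = absval (c (s (e j)) b) / absval (z j)"
          by (simp only: r_def absval_mult absval_inverse divide_inverse)
        ultimately show "absval (r j b) \<le> 1"
          using zpos[of j] by (simp add: divide_le_eq_1)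
      qed
      obtain l \<rho> where \<rho>: "strict_mono (\<rho> :: nat \<Rightarrow> nat)" "\<forall>b\<in>B. (\<lambda>j. r (\<rho> j) b) \<longlonglongrightarrow> l b"
        using finite_family_subconverge[OF sub fin, of r 1] r by blast
      have lK: "l b \<in> K" if "b \<in> B" for b
        using closed_sequentially[OF K(1), of "\<lambda>j. r (\<rho> j) b" "l b"] r(1)[OF that] \<rho>(2) that by blast
      have "r j b0 = 1" for j using z0 by (simp add: r_def z_def)
      then have "(\<lambda>j. 1) \<longlonglongrightarrow> l b0" using \<rho>(2) b0 by fastforce
      then have l0: "l b0 = 1" by (metis LIMSEQ_const_iff)
      have sum_r: "(\<Sum>b\<in>B. r (\<rho> j) b * b) = x (s (e (\<rho> j))) * inverse (z (\<rho> j))" for j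
        by (simp only: c(2) r_def sum_distrib_right) (simp add: mult_ac)
      have "(\<lambda>j. absval (\<Sum>b\<in>B. r (\<rho> j) b * b)) \<longlonglongrightarrow> 0"
      proof (rule Lim_null_comparison)
        have "(\<lambda>n. \<bar>R\<bar> * inverse (real n + 1)) \<longlonglongrightarrow> \<bar>R\<bar> * 0"
          using LIMSEQ_inverse_real_of_nat by (intro tendsto_mult tendsto_const) (simp add: add.commute)
        then show "(\<lambda>n. \<bar>R\<bar> * inverse (real n + 1)) \<longlonglongrightarrow> 0" by simp
        have "absval (x (s (e (\<rho> n)))) * inverse (absval (z (\<rho> n))) \<le> \<bar>R\<bar> * inverse (real n + 1)" for n
        proof (rule mult_mono)
          show "absval (x (s (e (\<rho> n)))) \<le> \<bar>R\<bar>" using x by (meson abs_ge_self order_trans)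
          have "real n + 1 \<le> absval (z (\<rho> n))"
            using zpos[of "\<rho> n"] strict_mono_imp_increasing[OF \<rho>(1), of n] by simp
          then show "inverse (absval (z (\<rho> n))) \<le> inverse (real n + 1)"
            by (intro le_imp_inverse_le) auto
        qed (auto simp: absval_nonneg)
        then show "\<forall>\<^sub>F n in sequentially. norm (absval (\<Sum>b\<in>B. r (\<rho> n) b * b)) \<le> \<bar>R\<bar> * inverse (real n + 1)"
          by (simp add: sum_r absval_mult absval_inverse absval_nonneg)
      qed
      moreover have "(\<lambda>j. absval (\<Sum>b\<in>B. r (\<rho> j) b * b)) \<longlonglongrightarrow> absval (\<Sum>b\<in>B. l b * b)"
        using \<rho>(2) by (intro tendsto_absval tendsto_sum tendsto_mult tendsto_const) auto
      ultimately have "absval (\<Sum>b\<in>B. l b * b) = 0" using LIMSEQ_unique by blast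
      then have "(\<Sum>b\<in>B. l b * b) = 0" by (simp add: absval_eq_0_iff)
      then have rel: "b0 = - (\<Sum>b\<in>B - {b0}. l b * b)"
        using fin b0 l0 by (simp add: sum.remove eq_neg_iff_add_eq_0)
      have "?S (B - {b0})"
      proof (intro conjI allI)
        fix y :: 'k
        obtain d where d: "\<And>b. b \<in> B \<Longrightarrow> d b \<in> K" "y = (\<Sum>b\<in>B. d b * b)" using B by blast
        have "y = d b0 * b0 + (\<Sum>b\<in>B - {b0}. d b * b)" using d(2) fin b0 by (simp add: sum.remove)
        also have "d b0 * b0 = (\<Sum>b\<in>B - {b0}. - d b0 * l b * b)"
          by (subst rel) (simp add: sum_distrib_left sum_negf mult.assoc)
        finally have "y = (\<Sum>b\<in>B - {b0}. (d b + - d b0 * l b) * b)"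
          by (simp add: sum.distrib[symmetric] algebra_simps)
        moreover have "\<forall>b\<in>B - {b0}. d b + - d b0 * l b \<in> K"
          using b0 by (intro ballI K'(3) K'(4) K'(5) d(1) lK) auto
        ultimately show "\<exists>c. (\<forall>b\<in>B - {b0}. c b \<in> K) \<and> y = (\<Sum>b\<in>B - {b0}. c b * b)"
          by (intro exI[of _ "\<lambda>b. d b + - d b0 * l b"]) blast
      qed (use fin in simp)
      from min[OF this] show False using fin b0 by (metis card_Diff1_less not_le)
    qed
    then obtain C where C: "\<And>n. m n \<le> C" by blast
    have "c n b \<in> K \<and> absval (c n b) \<le> C" if "b \<in> B" for n b
      using c(1) m_ge C order_trans that by blast
    then have "\<exists>l r. strict_mono (r :: nat \<Rightarrow> nat) \<and> (\<forall>b\<in>B. (\<lambda>n. c (r n) b) \<longlonglongrightarrow> l b)"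
      by (rule finite_family_subconverge[OF sub fin])
    then obtain l r where r: "strict_mono (r :: nat \<Rightarrow> nat)" "\<forall>b\<in>B. (\<lambda>n. c (r n) b) \<longlonglongrightarrow> l b" by blast
    then have "(\<lambda>n. x (r n)) \<longlonglongrightarrow> (\<Sum>b\<in>B. l b * b)"
      unfolding c(2) by (intro tendsto_sum tendsto_mult tendsto_const) auto
    with r(1) show "\<exists>l r. strict_mono (r :: nat \<Rightarrow> nat) \<and> (\<lambda>n. x (r n)) \<longlonglongrightarrow> l" by blast
  qed
qed

lemma is_padic_extension_subconverge:
  assumes "is_padic_extension TYPE('k::absval_field)"
  shows "bounded_seqs_subconverge (UNIV :: 'k set)"
  using assms finite_extension_subconverge is_padic_subfield_subconverge is_padic_subfield_closed
  unfolding is_padic_extension_def by metis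


text \<open>A bound on the absolute value makes all coefficients of index below some
  \<open>- m\<close> vanish, and each remaining coefficient has finitely many possible values. A
  diagonal sequence freezes them one after the other.\<close>

lemma is_laurent_field_subconverge:
  assumes "is_laurent_field TYPE('k::absval_field)"
  shows "bounded_seqs_subconverge (UNIV :: 'k set)"
proof -
  obtain F :: "'k set" and \<phi> :: "'k fls \<Rightarrow> 'k" where F: "finite F" "subfield_set F"
    and \<phi>: "bij_betw \<phi> (fls_over F) UNIV" "ring_hom_on (fls_over F) \<phi>"
    and av: "\<And>f. f \<in> fls_over F \<Longrightarrow> f \<noteq> 0 \<Longrightarrow> absval (\<phi> f) = real (card F) powi (- fls_subdegree f)"
    using assms unfolding is_laurent_field_def by blast
  have F0: "0 \<in> F" "1 \<in> F" "\<And>x y. x \<in> F \<Longrightarrow> y \<in> F \<Longrightarrow> x + y \<in> F" "\<And>x. x \<in> F \<Longrightarrow> - x \<in> F"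
    using F(2) by (auto simp: subfield_set_def)
  define q where "q = real (card F)"
  have "card {0, 1 :: 'k} \<le> card F" using F(1) F0 by (intro card_mono) auto
  then have q: "1 < q" by (simp add: q_def)
  have diff: "f - g \<in> fls_over F" if "f \<in> fls_over F" "g \<in> fls_over F" for f g
    using that F0(3)[of _ "- _"] F0(4) by (auto simp: fls_over_def)
  have \<phi>_diff: "\<phi> (f - g) = \<phi> f - \<phi> g" if "f \<in> fls_over F" "g \<in> fls_over F" for f g
    using \<phi>(2) that diff[OF that] unfolding ring_hom_on_def
    by (metis add_diff_cancel diff_add_cancel)
  have \<phi>0: "\<phi> 0 = 0" using \<phi>_diff[of 0 0] F0 by (simp add: fls_over_def)
  show ?thesis
    unfolding bounded_seqs_subconverge_def
  proof (intro allI impI)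
    fix R and x :: "nat \<Rightarrow> 'k"
    assume x: "\<forall>n. x n \<in> UNIV \<and> absval (x n) \<le> R"
    define f where "f n = inv_into (fls_over F) \<phi> (x n)" for n
    have f: "f n \<in> fls_over F" "\<phi> (f n) = x n" for n
      using \<phi>(1) unfolding f_def bij_betw_def by (auto intro: inv_into_into f_inv_into_f)
    have fF: "fls_nth (f n) i \<in> F" for n i using f(1) by (simp add: fls_over_def)
    obtain m where m: "R < q ^ m" using real_arch_pow[OF q] by blast
    have low: "fls_nth (f n) i = 0" if "i < - int m" for n i
    proof (rule ccontr)
      assume i: "fls_nth (f n) i \<noteq> 0"
      then have "f n \<noteq> 0" by auto
      have "fls_subdegree (f n) \<le> i" using i by (rule fls_subdegree_leI)
      then have "q powi int m \<le> q powi (- fls_subdegree (f n))"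
        using that q by (intro power_int_increasing) auto
      also have "\<dots> = absval (x n)" using av[OF f(1) \<open>f n \<noteq> 0\<close>] f(2) by (simp add: q_def)
      finally show False using m x by (metis leD order_trans power_int_of_nat)
    qed
    interpret subseqs "\<lambda>k s. \<exists>a. \<forall>j. fls_nth (f (s j)) (int k - int m) = a"
    proof
      fix k and s :: "nat \<Rightarrow> nat" assume "strict_mono s"
      let ?g = "\<lambda>j. fls_nth (f (s j)) (int k - int m)"
      have "finite (range ?g)" using F(1) fF by (meson finite_subset image_subsetI)
      then obtain j0 where inf: "infinite {j. ?g j = ?g j0}"
        using pigeonhole_infinite[of "UNIV :: nat set" ?g] by auto
      show "\<exists>r' :: nat \<Rightarrow> nat. strict_mono r' \<and> (\<exists>a. \<forall>j. fls_nth (f ((s \<circ> r') j)) (int k - int m) = a)"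
      proof -
        define r where "r = enumerate {j. ?g j = ?g j0}"
        have r1: "strict_mono r" unfolding r_def by (rule strict_mono_enumerate[OF inf])
        have "fls_nth (f ((s \<circ> r) j)) (int k - int m) = ?g j0" for j
          using enumerate_in_set[OF inf] by (simp add: r_def)
        with r1 show ?thesis by blast
      qed
    qed
    \<comment> \<open>From the term \<open>Suc k\<close> on, the diagonal sequence runs inside the
      extraction that froze the coefficient of index \<open>k - m\<close>. The term \<open>j\<close>
      thus agrees with the limit at all indices below \<open>j - m\<close>, which gives the rate in
      \<open>bound\<close>.\<close>
    have "\<exists>a. \<forall>j. fls_nth (f ((diagseq \<circ> (+) (Suc k)) j)) (int k - int m) = a" for k
      by (rule diagseq_holds) auto
    then obtain a where a: "\<And>k j. fls_nth (f (diagseq (Suc k + j))) (int k - int m) = a k"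
      unfolding comp_apply by metis
    define g where "g = Abs_fls (\<lambda>i. if i < - int m then 0 else a (nat (i + int m)))"
    have g_nth: "fls_nth g i = (if i < - int m then 0 else a (nat (i + int m)))" for i
      unfolding g_def by (subst nth_Abs_fls_lower_bound[of "- int m"]) auto
    have "a k \<in> F" for k
      using a[of k 0] fF[of "diagseq (Suc k + 0)" "int k - int m"] by simp
    then have g: "g \<in> fls_over F" using F0(1) by (auto simp: fls_over_def g_nth)
    have bound: "absval (x (diagseq j) - \<phi> g) \<le> q ^ m * (1 / q) ^ j" for j
    proof -
      let ?h = "f (diagseq j) - g"
      have "absval (\<phi> ?h) \<le> q ^ m * (1 / q) ^ j"
      proof (cases "?h = 0")
        case False
        have "fls_nth ?h i = 0" if i: "i < int j - int m" for i
        proof (cases "i < - int m")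
          case False
          define k where "k = nat (i + int m)"
          have k: "i = int k - int m" "k < j" using False i by (auto simp: k_def)
          then show ?thesis using a[of k "j - Suc k"] False by (simp add: g_nth)
        qed (use low g_nth in simp)
        then have "int j - int m \<le> fls_subdegree ?h" using False by (intro fls_subdegree_geI) auto
        then have "q powi (- fls_subdegree ?h) \<le> q powi (int m - int j)"
          using q by (intro power_int_increasing) auto
        also have "\<dots> = q ^ m * (1 / q) ^ j"
          using q by (simp add: power_int_diff power_one_over divide_inverse power_inverse)
        finally show ?thesis using av[OF diff[OF f(1) g] False] by (simp add: q_def)
      next
        case True
        then show ?thesis using q by (simp only: True \<phi>0 absval_zero) simp
      qed
      then show ?thesis by (simp add: \<phi>_diff[OF f(1) g] f(2))
    qed
    have "(\<lambda>j. q ^ m * (1 / q) ^ j) \<longlonglongrightarrow> q ^ m * 0"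
      using q by (intro tendsto_mult tendsto_const LIMSEQ_power_zero) auto
    then have "(\<lambda>j. q ^ m * (1 / q) ^ j) \<longlonglongrightarrow> 0" by simp
    then have "(\<lambda>j. absval (x (diagseq j) - \<phi> g)) \<longlonglongrightarrow> 0"
      by (rule Lim_null_comparison[rotated]) (simp add: bound absval_nonneg)
    then have "(\<lambda>j. x (diagseq j)) \<longlonglongrightarrow> \<phi> g"
      by (rule tendsto_absval_iff[THEN iffD2])
    then show "\<exists>l r. strict_mono (r :: nat \<Rightarrow> nat) \<and> (\<lambda>n. x (r n)) \<longlonglongrightarrow> l"
      using subseq_diagseq by blast
  qed
qed

lemma local_field_subconverge:
  "local_field TYPE('k::absval_field) \<Longrightarrow> bounded_seqs_subconverge (UNIV :: 'k set)"
  unfolding local_field_def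
  using is_real_field_subconverge is_complex_field_subconverge is_padic_extension_subconverge
    is_laurent_field_subconverge by blast

lemma local_field_countable_dense:
  assumes "local_field TYPE('k::absval_field)"
  obtains D :: "'k::absval_field set" where "countable D" "\<And>x e. 0 < e \<Longrightarrow> \<exists>d\<in>D. dist d x < e"
proof -
  have "seq_compact {x :: 'k. absval x \<le> R}" for R
    unfolding seq_compact_def
  proof (intro allI impI)
    fix f :: "nat \<Rightarrow> 'k" assume f: "\<forall>n. f n \<in> {x. absval x \<le> R}"
    then have "\<exists>l r. strict_mono (r :: nat \<Rightarrow> nat) \<and> (\<lambda>n. f (r n)) \<longlonglongrightarrow> l"
      using local_field_subconverge[OF assms, unfolded bounded_seqs_subconverge_def, rule_format, of f R]
      by simp
    then obtain l r where r: "strict_mono (r :: nat \<Rightarrow> nat)" "(\<lambda>n. f (r n)) \<longlonglongrightarrow> l"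
      by (elim exE conjE)
    have "absval l \<le> R"
      using f by (intro tendsto_upperbound[OF tendsto_absval[OF r(2)]]) auto
    then show "\<exists>l\<in>{x. absval x \<le> R}. \<exists>r. strict_mono r \<and> (f \<circ> r) \<longlonglongrightarrow> l"
      using r by (auto simp: o_def)
  qed
  then have "compact {x :: 'k. absval x \<le> R}" for R by (simp add: compact_eq_seq_compact_metric)
  then have "\<exists>T. finite T \<and> {x :: 'k. absval x \<le> R} \<subseteq> (\<Union>x\<in>T. ball x e)" if "0 < e" for R e
    using that by (simp add: compact_eq_totally_bounded)
  then have "\<forall>n m. \<exists>T. finite T \<and> {x :: 'k. absval x \<le> real n} \<subseteq> (\<Union>x\<in>T. ball x (inverse (real (Suc m))))"
    by simp
  then obtain T where T: "\<And>n m. finite (T n m)"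
      "\<And>n m. {x :: 'k. absval x \<le> real n} \<subseteq> (\<Union>x\<in>T n m. ball x (inverse (real (Suc m))))" by metis
  show thesis
  proof (rule that[of "\<Union>n m. T n m"])
    show "countable (\<Union>n m. T n m)" using T(1) by (intro countable_UN) (simp_all add: countable_finite)
    fix x :: 'k and e :: real assume "0 < e"
    then obtain m where m: "inverse (real (Suc m)) < e" using reals_Archimedean by blast
    obtain n where "absval x \<le> real n" using real_arch_simple by blast
    then obtain d where "d \<in> T n m" "dist d x < inverse (real (Suc m))"
      using T(2)[of n m] by auto
    then show "\<exists>d\<in>\<Union>n m. T n m. dist d x < e" using m by (intro bexI[of _ d]) auto
  qed
qed

section \<open>Norms and exterior squares\<close>

no_notation fps_nth (infixl "$" 75)

text \<open>
  This norm is equivalent to \<open>canonical_norm\<close> over every local field, so the archimedean and the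
  nonarchimedean case need not be distinguished.
\<close>

definition vnorm :: "'k::absval_field ^ 'd \<Rightarrow> real" where
  "vnorm x = (\<Sum>i\<in>UNIV. absval (x $ i))"

definition mnorm :: "'k::absval_field ^ 'd ^ 'd \<Rightarrow> real" where
  "mnorm g = (\<Sum>i\<in>UNIV. vnorm (g $ i))"

definition pairing :: "'k::field ^ 'd \<Rightarrow> 'k ^ 'd \<Rightarrow> 'k" where
  "pairing f x = (\<Sum>i\<in>UNIV. f $ i * x $ i)"

text \<open>
  Exterior squares are realised as alternating matrices; \<open>pullback g\<close> is the right action of \<open>g\<close> on
  them, and \<open>minors g\<close> is a norm of the exterior square of \<open>g\<close>.
\<close>

definition wedge :: "'k::field ^ 'd \<Rightarrow> 'k ^ 'd \<Rightarrow> 'k ^ 'd ^ 'd" where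
  "wedge a b = (\<chi> p q. a $ p * b $ q - a $ q * b $ p)"

definition alternating :: "'k::field ^ 'd ^ 'd \<Rightarrow> bool" where
  "alternating w \<longleftrightarrow> (\<forall>p. w $ p $ p = 0) \<and> (\<forall>p q. w $ p $ q = - w $ q $ p)"

definition pullback :: "'k::field ^ 'd ^ 'd \<Rightarrow> 'k ^ 'd ^ 'd \<Rightarrow> 'k ^ 'd ^ 'd" where
  "pullback g w = transpose g ** w ** g"

definition minors :: "'k::absval_field ^ 'd ^ 'd \<Rightarrow> real" where
  "minors g = (\<Sum>i\<in>UNIV. \<Sum>j\<in>UNIV. mnorm (wedge (g $ i) (g $ j)))"

lemma vnorm_nonneg: "0 \<le> vnorm x"
  by (simp add: vnorm_def sum_nonneg absval_nonneg)

lemma mnorm_nonneg: "0 \<le> mnorm g"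
  by (simp add: mnorm_def sum_nonneg vnorm_nonneg)

lemma minors_nonneg: "0 \<le> minors g"
  by (simp add: minors_def sum_nonneg mnorm_nonneg)

lemma absval_le_vnorm: "absval (x $ i) \<le> vnorm x"
  unfolding vnorm_def by (rule member_le_sum) (auto simp: absval_nonneg)

lemma vnorm_row_le_mnorm: "vnorm (g $ i) \<le> mnorm g"
  unfolding mnorm_def by (rule member_le_sum) (auto simp: vnorm_nonneg)

lemma absval_le_mnorm: "absval (g $ i $ j) \<le> mnorm g"
  using absval_le_vnorm vnorm_row_le_mnorm order_trans by blast

lemma vnorm_eq_0_iff: "vnorm x = 0 \<longleftrightarrow> x = 0"
  by (simp add: vnorm_def sum_nonneg_eq_0_iff absval_nonneg absval_eq_0_iff vec_eq_iff)

lemma mnorm_eq_0_iff: "mnorm g = 0 \<longleftrightarrow> g = 0"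
  by (simp add: mnorm_def sum_nonneg_eq_0_iff vnorm_nonneg vnorm_eq_0_iff vec_eq_iff)

lemma vnorm_pos: "x \<noteq> 0 \<Longrightarrow> 0 < vnorm x"
  using vnorm_nonneg[of x] vnorm_eq_0_iff[of x] by linarith

lemma mnorm_pos: "g \<noteq> 0 \<Longrightarrow> 0 < mnorm g"
  using mnorm_nonneg[of g] mnorm_eq_0_iff[of g] by linarith

lemma vnorm_scale: "vnorm (c *s x) = absval c * vnorm x"
  by (simp add: vnorm_def absval_mult sum_distrib_left)

lemma vnorm_axis: "vnorm (axis i 1 :: 'k::absval_field ^ 'd) = 1"
proof -
  have "absval (axis i 1 $ j :: 'k) = (if j = i then 1 else 0)" for j
    by (auto simp: axis_def absval_one absval_zero)
  then show ?thesis by (simp add: vnorm_def)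
qed

lemma exists_large_entry: "\<exists>i. vnorm x \<le> real CARD('d) * absval ((x :: 'k::absval_field ^ 'd) $ i)"
proof -
  have "finite (range (\<lambda>i. absval (x $ i)))" by simp
  then have "Max (range (\<lambda>i. absval (x $ i))) \<in> range (\<lambda>i. absval (x $ i))" by (intro Max_in) auto
  then obtain i where i: "Max (range (\<lambda>i. absval (x $ i))) = absval (x $ i)" by (rule rangeE)
  have "vnorm x \<le> (\<Sum>j\<in>(UNIV :: 'd set). absval (x $ i))"
    unfolding vnorm_def i[symmetric] by (intro sum_mono Max_ge) auto
  then show ?thesis by auto
qed

lemma exists_large_row: "\<exists>i. mnorm g \<le> real CARD('d) * vnorm ((g :: 'k::absval_field ^ 'd ^ 'd) $ i)"
proof -
  have "finite (range (\<lambda>i. vnorm (g $ i)))" by simp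
  then have "Max (range (\<lambda>i. vnorm (g $ i))) \<in> range (\<lambda>i. vnorm (g $ i))" by (intro Max_in) auto
  then obtain i where i: "Max (range (\<lambda>i. vnorm (g $ i))) = vnorm (g $ i)" by (rule rangeE)
  have "mnorm g \<le> (\<Sum>j\<in>(UNIV :: 'd set). vnorm (g $ i))"
    unfolding mnorm_def i[symmetric] by (intro sum_mono Max_ge) auto
  then show ?thesis by auto
qed

lemma absval_pairing_le: "absval (pairing f x) \<le> vnorm f * vnorm x"
proof -
  have "absval (pairing f x) \<le> (\<Sum>i\<in>UNIV. absval (f $ i) * absval (x $ i))"
    unfolding pairing_def absval_mult[symmetric] by (rule absval_sum)
  also have "\<dots> \<le> (\<Sum>i\<in>UNIV. absval (f $ i) * vnorm x)"
    by (intro sum_mono mult_left_mono absval_le_vnorm absval_nonneg)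
  finally show ?thesis by (simp add: vnorm_def sum_distrib_right)
qed

lemma pairing_matrix: "pairing f (g *v x) = pairing (f v* g) x"
  unfolding pairing_def matrix_vector_mult_def vector_matrix_mult_def
  by (simp add: sum_distrib_left sum_distrib_right mult.assoc) (rule sum.swap)

lemma pairing_scale: "pairing f (c *s x) = c * pairing f x"
  by (simp add: pairing_def sum_distrib_left mult.left_commute)

lemma pairing_add: "pairing f (x + y) = pairing f x + pairing f y"
  by (simp add: pairing_def distrib_left sum.distrib)

lemma pairing_axis: "pairing f (axis i 1) = f $ i"
  by (simp add: pairing_def axis_def if_distrib cong: if_cong)

lemma matrix_mult_row: "(h ** g) $ i = (h $ i) v* (g :: 'k::field ^ 'd ^ 'd)"
  by (simp add: matrix_matrix_mult_def vector_matrix_mult_def vec_eq_iff)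

lemma matrix_vector_nth: "(g *v x) $ i = pairing (g $ i) x"
  by (simp add: matrix_vector_mult_def pairing_def)

lemma vector_matrix_nth: "(f v* g) $ j = (\<Sum>i\<in>UNIV. f $ i * g $ i $ j)"
  by (simp add: vector_matrix_mult_def)

lemma vnorm_vector_matrix_le: "vnorm (f v* g) \<le> vnorm f * mnorm g"
proof -
  have "vnorm (f v* g) \<le> (\<Sum>j\<in>UNIV. \<Sum>i\<in>UNIV. absval (f $ i) * absval (g $ i $ j))"
    unfolding vnorm_def vector_matrix_nth absval_mult[symmetric] by (intro sum_mono absval_sum)
  also have "\<dots> = (\<Sum>i\<in>UNIV. absval (f $ i) * vnorm (g $ i))"
    by (subst sum.swap) (simp add: vnorm_def sum_distrib_left)
  also have "\<dots> \<le> (\<Sum>i\<in>UNIV. absval (f $ i) * mnorm g)"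
    by (intro sum_mono mult_left_mono vnorm_row_le_mnorm absval_nonneg)
  finally show ?thesis by (simp add: vnorm_def sum_distrib_right)
qed

lemma vnorm_matrix_vector_le: "vnorm (g *v x) \<le> mnorm g * vnorm x"
proof -
  have "vnorm (g *v x) \<le> (\<Sum>i\<in>UNIV. vnorm (g $ i) * vnorm x)"
    unfolding vnorm_def[of "g *v x"] matrix_vector_nth by (intro sum_mono absval_pairing_le)
  then show ?thesis by (simp add: mnorm_def sum_distrib_right)
qed

lemma mnorm_mult_le: "mnorm (h ** g) \<le> mnorm h * mnorm g"
proof -
  have "mnorm (h ** g) \<le> (\<Sum>i\<in>UNIV. vnorm (h $ i) * mnorm g)"
    unfolding mnorm_def[of "h ** g"] matrix_mult_row by (intro sum_mono vnorm_vector_matrix_le)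
  then show ?thesis by (simp add: mnorm_def[of h] sum_distrib_right)
qed

lemma mnorm_transpose: "mnorm (transpose g) = mnorm g"
  unfolding mnorm_def vnorm_def transpose_def by (subst sum.swap) simp

lemma mnorm_wedge_le: "mnorm (wedge a b) \<le> 2 * vnorm a * vnorm b"
proof -
  have "mnorm (wedge a b)
      \<le> (\<Sum>p\<in>UNIV. \<Sum>q\<in>UNIV. absval (a $ p) * absval (b $ q) + absval (a $ q) * absval (b $ p))"
    unfolding mnorm_def vnorm_def wedge_def vec_lambda_beta absval_mult[symmetric]
    by (intro sum_mono absval_diff_le)
  also have "\<dots> = (\<Sum>p\<in>UNIV. \<Sum>q\<in>UNIV. absval (a $ p) * absval (b $ q))
      + (\<Sum>p\<in>UNIV. \<Sum>q\<in>UNIV. absval (a $ q) * absval (b $ p))"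
    by (simp add: sum.distrib)
  also have "(\<Sum>p\<in>UNIV. \<Sum>q\<in>UNIV. absval (a $ q) * absval (b $ p))
      = (\<Sum>p\<in>UNIV. \<Sum>q\<in>UNIV. absval (a $ p) * absval (b $ q))"
    by (rule sum.swap)
  also have "(\<Sum>p\<in>UNIV. \<Sum>q\<in>UNIV. absval (a $ p) * absval (b $ q)) = vnorm a * vnorm b"
    by (simp add: vnorm_def sum_product)
  finally show ?thesis by simp
qed

lemma minors_le: "minors g \<le> 2 * (mnorm g)\<^sup>2"
proof -
  have "minors g \<le> (\<Sum>i\<in>UNIV. \<Sum>j\<in>UNIV. 2 * (vnorm (g $ i) * vnorm (g $ j)))"
    unfolding minors_def using mnorm_wedge_le by (intro sum_mono) (simp add: mult.assoc)
  also have "\<dots> = 2 * (mnorm g)\<^sup>2"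
    by (simp add: sum_distrib_left[symmetric] mnorm_def power2_eq_square sum_product)
  finally show ?thesis .
qed

lemma alternating_wedge: "alternating (wedge a b)"
  by (simp add: alternating_def wedge_def mult.commute)

lemma pullback_nth: "pullback g w $ k $ l = (\<Sum>p\<in>UNIV. \<Sum>q\<in>UNIV. w $ p $ q * (g $ p $ k * g $ q $ l))"
proof -
  have "pullback g w $ k $ l = (\<Sum>q\<in>UNIV. \<Sum>p\<in>UNIV. w $ p $ q * (g $ p $ k * g $ q $ l))"
    unfolding pullback_def matrix_matrix_mult_def transpose_def vec_lambda_beta sum_distrib_right
    by (intro sum.cong refl) (simp only: mult_ac)
  then show ?thesis by (subst sum.swap)
qed

lemma pullback_wedge: "pullback g (wedge a b) = wedge (a v* g) (b v* g)"
proof -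
  have "(\<Sum>p\<in>UNIV. \<Sum>q\<in>UNIV. a $ p * b $ q * (g $ p $ k * g $ q $ l)) = (a v* g) $ k * (b v* g) $ l" for k l
    unfolding vector_matrix_nth sum_product by (intro sum.cong refl) (simp only: mult_ac)
  moreover have "(\<Sum>p\<in>UNIV. \<Sum>q\<in>UNIV. a $ q * b $ p * (g $ p $ k * g $ q $ l)) = (a v* g) $ l * (b v* g) $ k"
    for k l
    unfolding vector_matrix_nth sum_product
    by (subst (2) sum.swap) (intro sum.cong refl, simp only: mult_ac)
  ultimately show ?thesis
    unfolding vec_eq_iff pullback_nth wedge_def vec_lambda_beta left_diff_distrib sum_subtractf by simp
qed

lemma pullback_mult: "pullback (h ** g) w = pullback g (pullback h w)"
  by (simp add: pullback_def matrix_transpose_mul matrix_mul_assoc)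

text \<open>The index type carries no order, so the injection \<open>e\<close> supplies one and each
  pair of rows is counted once. The terms \<open>(p, q)\<close> and \<open>(q, p)\<close> merge into
  a 2 by 2 minor of \<open>g\<close>. The diagonal vanishes by definition of
  \<open>alternating\<close>, also in characteristic two.\<close>

lemma pullback_nth_alternating:
  fixes w :: "'k::field ^ 'd ^ 'd" and e :: "'d \<Rightarrow> nat"
  assumes w: "alternating w" and e: "inj e"
  shows "pullback g w $ k $ l = (\<Sum>(p, q)\<in>{(p, q). e p < e q}. w $ p $ q * wedge (g $ p) (g $ q) $ k $ l)"
proof -
  let ?F = "\<lambda>(p, q). w $ p $ q * (g $ p $ k * g $ q $ l)"
  let ?L = "{(p, q). e p < e q}" and ?L' = "{(p, q). e q < e p}" and ?D = "{(p, q). p = q}"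
  have un: "UNIV = ?L \<union> ?L' \<union> ?D" using injD[OF e] by (auto simp: not_less order_le_less)
  have fin: "finite X" for X :: "('d \<times> 'd) set" by simp
  have disj: "?L \<inter> ?L' = {}" "(?L \<union> ?L') \<inter> ?D = {}" by auto
  have "pullback g w $ k $ l = sum ?F UNIV"
    unfolding pullback_nth by (simp add: sum.cartesian_product)
  also have "\<dots> = sum ?F (?L \<union> ?L' \<union> ?D)" by (rule arg_cong[OF un])
  also have "\<dots> = sum ?F ?L + sum ?F ?L' + sum ?F ?D"
    using sum.union_disjoint[OF fin fin disj(1), of ?F] sum.union_disjoint[OF fin fin disj(2), of ?F]
    by (simp only:)
  also have "sum ?F ?D = 0"
  proof -
    have "w $ p $ p = 0" for p using w unfolding alternating_def by blast
    then show ?thesis by (intro sum.neutral) auto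
  qed
  also have "sum ?F ?L' = (\<Sum>(p, q)\<in>?L. w $ q $ p * (g $ q $ k * g $ p $ l))"
    by (rule sum.reindex_bij_witness[of _ prod.swap prod.swap]) auto
  also have "sum ?F ?L + (\<Sum>(p, q)\<in>?L. w $ q $ p * (g $ q $ k * g $ p $ l)) + 0
      = (\<Sum>(p, q)\<in>?L. w $ p $ q * wedge (g $ p) (g $ q) $ k $ l)"
    unfolding add_0_right sum.distrib[symmetric]
  proof (intro sum.cong refl, clarify)
    fix p q
    have "w $ q $ p = - w $ p $ q" using w unfolding alternating_def by blast
    then show "w $ p $ q * (g $ p $ k * g $ q $ l) + w $ q $ p * (g $ q $ k * g $ p $ l)
        = w $ p $ q * wedge (g $ p) (g $ q) $ k $ l"
      by (simp add: wedge_def algebra_simps)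
  qed
  finally show ?thesis .
qed

lemma exists_inj_nat: "\<exists>e :: 'd::finite \<Rightarrow> nat. inj e"
  using finite_imp_inj_to_nat_seg[of "UNIV :: 'd set"] by auto

lemma alternating_pullback:
  assumes "alternating w" shows "alternating (pullback g w)"
proof -
  obtain e :: "'b \<Rightarrow> nat" where e: "inj e" using exists_inj_nat by blast
  show ?thesis
    unfolding alternating_def pullback_nth_alternating[OF assms e]
  proof (intro conjI allI)
    fix k l
    have "wedge (g $ p) (g $ q) $ k $ l = - wedge (g $ p) (g $ q) $ l $ k" for p q
      by (simp add: wedge_def)
    then show "(\<Sum>(p, q)\<in>{(p, q). e p < e q}. w $ p $ q * wedge (g $ p) (g $ q) $ k $ l)
        = - (\<Sum>(p, q)\<in>{(p, q). e p < e q}. w $ p $ q * wedge (g $ p) (g $ q) $ l $ k)"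
      by (simp add: sum_negf[symmetric] case_prod_unfold)
  qed (simp add: wedge_def)
qed

text \<open>This is the sharp form of \<open>mnorm_pullback_le\<close>: when \<open>g\<close> is
  nearly of rank one, \<open>minors g\<close> is far smaller than the square of
  \<open>mnorm g\<close>, and all contraction comes from that gap.\<close>

lemma mnorm_pullback_le_minors:
  fixes w :: "'k::absval_field ^ 'd ^ 'd"
  assumes "alternating w" shows "mnorm (pullback g w) \<le> mnorm w * minors g"
proof -
  obtain e :: "'d \<Rightarrow> nat" where e: "inj e" using exists_inj_nat by blast
  let ?m = "\<lambda>p q. wedge (g $ p) (g $ q)"
  have entry: "absval (pullback g w $ k $ l) \<le> (\<Sum>(p, q)\<in>UNIV. absval (w $ p $ q) * absval (?m p q $ k $ l))"
    for k l
  proof -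
    have "absval (pullback g w $ k $ l)
        \<le> (\<Sum>(p, q)\<in>{(p, q). e p < e q}. absval (w $ p $ q) * absval (?m p q $ k $ l))"
      unfolding pullback_nth_alternating[OF assms e]
      by (rule order_trans[OF absval_sum]) (simp add: case_prod_unfold absval_mult)
    also have "\<dots> \<le> (\<Sum>(p, q)\<in>UNIV. absval (w $ p $ q) * absval (?m p q $ k $ l))"
      by (intro sum_mono2) (auto simp: absval_nonneg)
    finally show ?thesis .
  qed
  have "mnorm (pullback g w) \<le> (\<Sum>k\<in>UNIV. \<Sum>l\<in>UNIV. \<Sum>(p, q)\<in>UNIV. absval (w $ p $ q) * absval (?m p q $ k $ l))"
    unfolding mnorm_def vnorm_def by (intro sum_mono entry)
  also have "\<dots> = (\<Sum>(p, q)\<in>UNIV. absval (w $ p $ q) * mnorm (?m p q))"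
  proof -
    have "(\<Sum>k\<in>UNIV. \<Sum>l\<in>UNIV. \<Sum>(p, q)\<in>UNIV. absval (w $ p $ q) * absval (?m p q $ k $ l))
        = (\<Sum>k\<in>UNIV. \<Sum>(p, q)\<in>UNIV. \<Sum>l\<in>UNIV. absval (w $ p $ q) * absval (?m p q $ k $ l))"
      unfolding case_prod_unfold by (intro sum.cong refl sum.swap)
    also have "\<dots> = (\<Sum>(p, q)\<in>UNIV. \<Sum>k\<in>UNIV. \<Sum>l\<in>UNIV. absval (w $ p $ q) * absval (?m p q $ k $ l))"
      unfolding case_prod_unfold by (rule sum.swap)
    finally show ?thesis by (simp add: mnorm_def vnorm_def sum_distrib_left)
  qed
  also have "\<dots> \<le> (\<Sum>(p, q)\<in>UNIV. absval (w $ p $ q) * minors g)"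
  proof -
    have "mnorm (?m p q) \<le> minors g" for p q
    proof -
      have "mnorm (?m p q) \<le> (\<Sum>j\<in>UNIV. mnorm (?m p j))"
        by (rule member_le_sum) (auto simp: mnorm_nonneg)
      also have "\<dots> \<le> minors g"
        unfolding minors_def by (rule member_le_sum[of p]) (auto simp: mnorm_nonneg sum_nonneg)
      finally show ?thesis .
    qed
    then show ?thesis by (auto intro!: sum_mono mult_left_mono simp: absval_nonneg)
  qed
  also have "\<dots> = mnorm w * minors g"
    by (simp add: mnorm_def vnorm_def sum.cartesian_product sum_distrib_right case_prod_unfold)
  finally show ?thesis .
qed

lemma mnorm_pullback_le: "mnorm (pullback g w) \<le> (mnorm g)\<^sup>2 * mnorm w"
proof -
  have "mnorm (pullback g w) \<le> mnorm (transpose g ** w) * mnorm g"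
    unfolding pullback_def by (rule mnorm_mult_le)
  also have "\<dots> \<le> (mnorm g * mnorm w) * mnorm g"
    using mnorm_mult_le[of "transpose g" w] by (intro mult_right_mono mnorm_nonneg) (simp add: mnorm_transpose)
  finally show ?thesis by (simp add: power2_eq_square mult_ac)
qed

text \<open>A form of Cauchy-Binet: the rows of \<open>h ** g\<close> are the rows of
  \<open>h\<close> moved by \<open>g\<close>, so their wedges are pullbacks of wedges of rows of
  \<open>h\<close>.\<close>

lemma minors_mult_le: "minors (h ** g) \<le> minors h * minors g"
proof -
  have "minors (h ** g) \<le> (\<Sum>i\<in>UNIV. \<Sum>j\<in>UNIV. mnorm (wedge (h $ i) (h $ j)) * minors g)"
    unfolding minors_def[of "h ** g"] matrix_mult_row pullback_wedge[symmetric]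
    by (intro sum_mono mnorm_pullback_le_minors alternating_wedge)
  then show ?thesis by (simp add: minors_def[of h] sum_distrib_right)
qed

lemma pairing_wedge_row: "pairing (wedge a b $ k) x = a $ k * pairing b x - b $ k * pairing a x"
proof -
  have "pairing (wedge a b $ k) x = (\<Sum>i\<in>UNIV. a $ k * (b $ i * x $ i) - b $ k * (a $ i * x $ i))"
    unfolding pairing_def by (intro sum.cong refl) (simp add: wedge_def algebra_simps)
  then show ?thesis by (simp add: pairing_def sum_subtractf sum_distrib_left)
qed

text \<open>
  The two sides are the values of the alternating form \<open>f \<and> e\<^sub>i\<close> on \<open>(g x, g e\<^sub>k)\<close>.
\<close>

lemma pairing_pullback_axis:
  fixes f x :: "'k::absval_field ^ 'd"
  shows "absval ((f v* g) $ k) * absval ((g *v x) $ i)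
    \<le> absval (pairing f (g *v x)) * mnorm g + mnorm (pullback g (wedge f (axis i 1))) * vnorm x"
proof -
  let ?w = "pullback g (wedge f (axis i 1))"
  have "(\<Sum>p\<in>UNIV. axis i 1 $ p * g $ p $ j) = pairing (\<chi> p. g $ p $ j) (axis i 1)" for j
    by (simp add: pairing_def mult.commute)
  then have ax: "axis i 1 v* g = g $ i" by (simp add: vec_eq_iff vector_matrix_nth pairing_axis)
  have "pairing (?w $ k) x = (f v* g) $ k * (g *v x) $ i - pairing f (g *v x) * g $ i $ k"
    unfolding pullback_wedge ax pairing_matrix matrix_vector_nth pairing_wedge_row by (simp add: mult.commute)
  then have "(f v* g) $ k * (g *v x) $ i = pairing f (g *v x) * g $ i $ k + pairing (?w $ k) x" by simp
  then have "absval ((f v* g) $ k) * absval ((g *v x) $ i)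
      \<le> absval (pairing f (g *v x)) * absval (g $ i $ k) + absval (pairing (?w $ k) x)"
    unfolding absval_mult[symmetric] using absval_triangle by metis
  also have "\<dots> \<le> absval (pairing f (g *v x)) * mnorm g + mnorm ?w * vnorm x"
  proof (intro add_mono mult_left_mono absval_le_mnorm absval_nonneg)
    have "absval (pairing (?w $ k) x) \<le> vnorm (?w $ k) * vnorm x" by (rule absval_pairing_le)
    also have "\<dots> \<le> mnorm ?w * vnorm x" by (intro mult_right_mono vnorm_row_le_mnorm vnorm_nonneg)
    finally show "absval (pairing (?w $ k) x) \<le> mnorm ?w * vnorm x" .
  qed
  finally show ?thesis .
qed

text \<open>Up to constants this is the infinitesimal dilation factor, at the class of
  \<open>f\<close>, of the action of \<open>g\<close> on the dual projective space. It does not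
  change when \<open>f\<close> is rescaled.\<close>

definition stretch :: "'k::absval_field ^ 'd \<Rightarrow> 'k ^ 'd ^ 'd \<Rightarrow> real" where
  "stretch f g = (\<Sum>i\<in>UNIV. mnorm (pullback g (wedge f (axis i 1))) * vnorm f / (vnorm (f v* g))\<^sup>2)"

text \<open>In \<open>pairing_pullback_axis\<close> the term with \<open>pairing f (g *v x)\<close>
  is small by hypothesis. Summed over \<open>i\<close>, it is at most half of the left-hand side by
  the second bound on \<open>\<epsilon>\<close> and can be absorbed. The exterior term then bounds
  \<open>vnorm (g *v x)\<close>, and with it the pairing.\<close>

lemma pairing_contraction:
  fixes f x :: "'k::absval_field ^ 'd"
  assumes small: "absval (pairing f (g *v x)) \<le> \<epsilon> * vnorm f * vnorm (g *v x)"
    and eps: "0 \<le> \<epsilon>" "2 * (real CARD('d))\<^sup>2 * \<epsilon> * vnorm f * mnorm g \<le> vnorm (f v* g)"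
    and fg: "f v* g \<noteq> 0"
  shows "absval (pairing (f v* g) x) \<le> 2 * real CARD('d) * \<epsilon> * stretch f g * vnorm (f v* g) * vnorm x"
proof -
  let ?d = "real CARD('d)" and ?N = "vnorm (f v* g)" and ?W = "\<lambda>i. mnorm (pullback g (wedge f (axis i 1)))"
  \<comment> \<open>Replacing the norm of \<open>f v* g\<close> by its largest entry costs one
    factor \<open>d\<close>; the sum over \<open>i\<close> costs the other one in
    \<open>eps\<close>.\<close>
  obtain k where k: "?N \<le> ?d * absval ((f v* g) $ k)" using exists_large_entry by blast
  have N: "0 < ?N" using fg by (rule vnorm_pos)
  have "?N * vnorm (g *v x) = (\<Sum>i\<in>UNIV. ?N * absval ((g *v x) $ i))"
    by (simp add: vnorm_def[of "g *v x"] sum_distrib_left)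
  also have "\<dots> \<le> (\<Sum>i\<in>UNIV. ?d * (absval (pairing f (g *v x)) * mnorm g + ?W i * vnorm x))"
  proof (rule sum_mono)
    fix i :: 'd
    have "?N * absval ((g *v x) $ i) \<le> (?d * absval ((f v* g) $ k)) * absval ((g *v x) $ i)"
      by (intro mult_right_mono k absval_nonneg)
    also have "\<dots> \<le> ?d * (absval (pairing f (g *v x)) * mnorm g + ?W i * vnorm x)"
      unfolding mult.assoc by (intro mult_left_mono pairing_pullback_axis) auto
    finally show "?N * absval ((g *v x) $ i) \<le> ?d * (absval (pairing f (g *v x)) * mnorm g + ?W i * vnorm x)" .
  qed
  also have "\<dots> = ?d\<^sup>2 * absval (pairing f (g *v x)) * mnorm g + ?d * (\<Sum>i\<in>UNIV. ?W i) * vnorm x"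
    by (simp add: sum_distrib_left[symmetric] sum.distrib sum_distrib_right[symmetric] power2_eq_square
        algebra_simps)
  also have "\<dots> \<le> ?d\<^sup>2 * (\<epsilon> * vnorm f * vnorm (g *v x)) * mnorm g + ?d * (\<Sum>i\<in>UNIV. ?W i) * vnorm x"
    by (intro add_right_mono mult_right_mono mult_left_mono small mnorm_nonneg) auto
  also have "?d\<^sup>2 * (\<epsilon> * vnorm f * vnorm (g *v x)) * mnorm g = (?d\<^sup>2 * \<epsilon> * vnorm f * mnorm g) * vnorm (g *v x)"
    by simp
  also have "\<dots> \<le> (?N / 2) * vnorm (g *v x)"
    using eps(2) by (intro mult_right_mono vnorm_nonneg) simp
  finally have "?N * vnorm (g *v x) \<le> 2 * ?d * (\<Sum>i\<in>UNIV. ?W i) * vnorm x" by simp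
  then have le: "vnorm (g *v x) \<le> 2 * ?d * (\<Sum>i\<in>UNIV. ?W i) * vnorm x / ?N"
    using N by (simp add: field_simps)
  have "absval (pairing (f v* g) x) \<le> \<epsilon> * vnorm f * vnorm (g *v x)" using small by (simp add: pairing_matrix)
  also have "\<dots> \<le> \<epsilon> * vnorm f * (2 * ?d * (\<Sum>i\<in>UNIV. ?W i) * vnorm x / ?N)"
    by (intro mult_left_mono le mult_nonneg_nonneg eps(1) vnorm_nonneg)
  also have "\<dots> = 2 * ?d * \<epsilon> * stretch f g * ?N * vnorm x"
  proof -
    have "stretch f g = (\<Sum>i\<in>UNIV. ?W i) * vnorm f / ?N\<^sup>2"
      unfolding stretch_def sum_distrib_right sum_divide_distrib ..
    then show ?thesis using N by (simp add: power2_eq_square)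
  qed
  finally show ?thesis .
qed

section \<open>Comparison with the canonical, dual and operator norms\<close>

lemma canonical_norm_le_vnorm: "canonical_norm x \<le> vnorm x"
proof (cases "nonarchimedean TYPE('a)")
  case True
  have "Max (range (\<lambda>i. absval (x $ i))) \<in> range (\<lambda>i. absval (x $ i))" by (intro Max_in) auto
  then obtain i where "Max (range (\<lambda>i. absval (x $ i))) = absval (x $ i)" by (rule rangeE)
  then show ?thesis using True absval_le_vnorm[of x i] by (simp add: canonical_norm_def)
next
  case False
  then show ?thesis
    using L2_set_le_sum[of UNIV "\<lambda>i. absval (x $ i)"]
    by (simp add: canonical_norm_def L2_set_def vnorm_def absval_nonneg)
qed

lemma vnorm_le_canonical_norm: "vnorm (x :: 'k::absval_field ^ 'd) \<le> real CARD('d) * canonical_norm x"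
  unfolding vnorm_def using sum_bounded_above[of UNIV "\<lambda>i. absval (x $ i)" "canonical_norm x"]
  by (simp add: absval_le_canonical_norm)

lemma dual_space_pairing:
  assumes "f \<in> dual_space" shows "f x = pairing (\<chi> i. f (axis i 1)) x"
proof -
  have "f x = f (\<Sum>i\<in>UNIV. x $ i *s axis i 1)" by (simp add: basis_expansion)
  then show ?thesis by (simp add: dual_sum[OF assms] dual_scale[OF assms] pairing_def mult.commute)
qed

lemma axis_one_neq_0: "axis i (1 :: 'k::field) \<noteq> (0 :: 'k ^ 'd)"
  by simp

text \<open>Together with \<open>canonical_norm_le_vnorm\<close> this bounds the denominator of
  \<open>delta_hyp\<close> by a product of two \<open>vnorm\<close>s, so the event that
  \<open>delta_hyp\<close> is at most \<open>\<epsilon>\<close> lies in a neighbourhood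
  \<open>near\<close> with the same \<open>\<epsilon>\<close>.\<close>

lemma dual_norm_le_vnorm:
  fixes f :: "'k::absval_field ^ 'd \<Rightarrow> 'k"
  assumes "f \<in> dual_space" shows "dual_norm f \<le> vnorm (\<chi> i. f (axis i 1))"
  unfolding dual_norm_def
proof (rule cSUP_least)
  have "axis undefined 1 \<in> - {0 :: 'k ^ 'd}" by simp
  then show "- {0 :: 'k ^ 'd} \<noteq> {}" by blast
next
  let ?v = "(\<chi> i. f (axis i 1)) :: 'k ^ 'd"
  fix x :: "'k ^ 'd" assume "x \<in> - {0}"
  then have "0 < canonical_norm x" by (simp add: canonical_norm_pos)
  moreover have "absval (f x) \<le> vnorm ?v * canonical_norm x"
  proof -
    have "absval (f x) \<le> (\<Sum>i\<in>UNIV. absval (?v $ i) * absval (x $ i))"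
      unfolding dual_space_pairing[OF assms, of x] pairing_def absval_mult[symmetric] by (rule absval_sum)
    also have "\<dots> \<le> (\<Sum>i\<in>UNIV. absval (?v $ i) * canonical_norm x)"
      by (intro sum_mono mult_left_mono absval_le_canonical_norm absval_nonneg)
    finally show ?thesis by (simp add: vnorm_def sum_distrib_right)
  qed
  ultimately show "absval (f x) / canonical_norm x \<le> vnorm ?v" by (simp add: pos_divide_le_eq)
qed

lemma mnorm_le_op_norm: "mnorm (g :: 'k::absval_field ^ 'd ^ 'd) \<le> (real CARD('d))\<^sup>2 * op_norm g"
proof -
  \<comment> \<open>A supremum of an unbounded set of reals is unspecified; with this bound the
    quotients really lie below \<open>op_norm g\<close>.\<close>
  have bdd: "bdd_above ((\<lambda>x. canonical_norm (g *v x) / canonical_norm x) ` (- {0}))"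
  proof (rule bdd_aboveI2)
    fix x :: "'k ^ 'd" assume "x \<in> - {0}"
    then have "0 < canonical_norm x" by (simp add: canonical_norm_pos)
    moreover have "canonical_norm (g *v x) \<le> mnorm g * (real CARD('d) * canonical_norm x)"
      using canonical_norm_le_vnorm[of "g *v x"] vnorm_matrix_vector_le[of g x]
        mult_left_mono[OF vnorm_le_canonical_norm[of x] mnorm_nonneg[of g]] by linarith
    ultimately show "canonical_norm (g *v x) / canonical_norm x \<le> mnorm g * real CARD('d)"
      by (simp add: pos_divide_le_eq mult_ac)
  qed
  have "absval (g $ i $ j) \<le> op_norm g" for i j
  proof -
    let ?a = "axis j 1 :: 'k ^ 'd"
    have c: "0 < canonical_norm ?a" "canonical_norm ?a \<le> 1"
      using canonical_norm_le_vnorm[of ?a] by (simp_all add: canonical_norm_pos vnorm_axis)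
    have "absval (g $ i $ j) \<le> canonical_norm (g *v ?a)"
      using absval_le_canonical_norm[of "g *v ?a" i] by (simp add: matrix_vector_nth pairing_axis)
    also have "\<dots> \<le> canonical_norm (g *v ?a) / canonical_norm ?a"
    proof -
      have "0 \<le> canonical_norm (g *v ?a)"
        using absval_nonneg absval_le_canonical_norm order_trans by blast
      then show ?thesis using c by (simp add: pos_le_divide_eq mult_left_le)
    qed
    also have "\<dots> \<le> op_norm g"
      unfolding op_norm_def by (intro cSUP_upper bdd) simp
    finally show ?thesis .
  qed
  then have "mnorm g \<le> (\<Sum>i\<in>(UNIV :: 'd set). \<Sum>j\<in>(UNIV :: 'd set). op_norm g)"
    unfolding mnorm_def vnorm_def by (intro sum_mono)
  then show ?thesis by (simp add: power2_eq_square)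
qed

section \<open>Inverses in SL and the size of the action\<close>

lemma absval_prod: "absval (prod h A :: 'k::absval_field) = (\<Prod>i\<in>A. absval (h i))"
  by (induction A rule: infinite_finite_induct) (simp_all add: absval_one absval_mult)

lemma absval_det_le:
  fixes A :: "'k::absval_field ^ 'd ^ 'd"
  assumes "\<And>i j. absval (A $ i $ j) \<le> B"
  shows "absval (det A) \<le> fact CARD('d) * B ^ CARD('d)"
proof -
  let ?P = "{p. p permutes (UNIV :: 'd set)}"
  have "absval (of_int (sign p) :: 'k) = 1" for p :: "'d \<Rightarrow> 'd"
    by (simp add: sign_def absval_one absval_minus)
  then have "absval (det A) \<le> (\<Sum>p\<in>?P. \<Prod>i\<in>UNIV. absval (A $ i $ p i))"
    unfolding det_def by (intro order_trans[OF absval_sum]) (simp add: absval_mult absval_prod)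
  also have "\<dots> \<le> (\<Sum>p\<in>?P. \<Prod>i\<in>(UNIV :: 'd set). B)"
    using assms by (intro sum_mono prod_mono) (auto simp: absval_nonneg)
  also have "\<dots> = fact CARD('d) * B ^ CARD('d)"
    by (simp add: card_permutations[of UNIV "CARD('d)"])
  finally show ?thesis .
qed

text \<open>By Cramer's rule the entries of the inverse of \<open>g\<close> in \<open>SL\<close> are
  determinants of matrices with entries of size at most \<open>1 + mnorm g\<close>; this polynomial
  therefore dominates the norms of \<open>g\<close> and of its inverse and their product. The
  summand 1 and the large prefactor make it submultiplicative and at least 1. Being polynomial in
  \<open>mnorm g\<close>, it inherits the exponential moment.\<close>

definition distortion :: "'k::absval_field ^ 'd ^ 'd \<Rightarrow> real" where
  "distortion g = (real CARD('d))\<^sup>2 * fact CARD('d) * (1 + mnorm g) ^ Suc CARD('d)"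

lemma distortion_ge_1: "1 \<le> distortion (g :: 'k::absval_field ^ 'd ^ 'd)"
proof -
  have "1 \<le> (real CARD('d))\<^sup>2 * fact CARD('d)"
    by (intro mult_ge1_I one_le_power) (simp_all add: Suc_leI)
  moreover have "1 \<le> (1 + mnorm g) ^ Suc CARD('d)"
    by (intro one_le_power) (simp add: mnorm_nonneg)
  ultimately show ?thesis unfolding distortion_def by (rule mult_ge1_I)
qed

lemma distortion_mult_le: "distortion (g ** h) \<le> distortion g * distortion (h :: 'k::absval_field ^ 'd ^ 'd)"
proof -
  let ?c = "(real CARD('d))\<^sup>2 * fact CARD('d)"
  have c: "1 \<le> ?c" by (intro mult_ge1_I one_le_power) (simp_all add: Suc_leI)
  have "1 + mnorm (g ** h) \<le> (1 + mnorm g) * (1 + mnorm h)"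
    using mnorm_mult_le[of g h] mnorm_nonneg[of g] mnorm_nonneg[of h] by (simp add: algebra_simps)
  then have "(1 + mnorm (g ** h)) ^ Suc CARD('d) \<le> (1 + mnorm g) ^ Suc CARD('d) * (1 + mnorm h) ^ Suc CARD('d)"
    unfolding power_mult_distrib[symmetric] by (intro power_mono) (simp_all add: mnorm_nonneg)
  then have "distortion (g ** h) \<le> ?c * ((1 + mnorm g) ^ Suc CARD('d) * (1 + mnorm h) ^ Suc CARD('d))"
    unfolding distortion_def using c by (intro mult_left_mono) auto
  also have "\<dots> \<le> ?c * (?c * ((1 + mnorm g) ^ Suc CARD('d) * (1 + mnorm h) ^ Suc CARD('d)))"
  proof (rule mult_left_mono)
    have "0 \<le> (1 + mnorm g) ^ Suc CARD('d) * (1 + mnorm h) ^ Suc CARD('d)"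
      by (intro mult_nonneg_nonneg zero_le_power) (simp_all add: mnorm_nonneg)
    from mult_right_mono[OF c this]
    show "(1 + mnorm g) ^ Suc CARD('d) * (1 + mnorm h) ^ Suc CARD('d)
        \<le> ?c * ((1 + mnorm g) ^ Suc CARD('d) * (1 + mnorm h) ^ Suc CARD('d))" by (simp only: mult_1)
  qed (use c in simp)
  finally show ?thesis by (simp only: distortion_def mult_ac)
qed

lemma SL_inverse:
  fixes g :: "'k::absval_field ^ 'd ^ 'd"
  assumes "g \<in> SL"
  obtains h where "g ** h = mat 1" "h ** g = mat 1" "mnorm g * mnorm h \<le> distortion g" "mnorm g \<le> distortion g"
    "mnorm h \<le> distortion g"
proof -
  let ?d = "real CARD('d)" and ?B = "1 + mnorm g"
  have det: "det g = 1" using assms by (simp add: SL_def)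
  then have "invertible g" by (simp add: invertible_det_nz)
  then obtain h where inv: "g ** h = mat 1" "h ** g = mat 1" unfolding invertible_def by blast
  have entry: "absval (h $ k $ j) \<le> fact CARD('d) * ?B ^ CARD('d)" for k j
  proof -
    have "g *v (h *v axis j 1) = axis j 1" by (simp add: matrix_vector_mul_assoc inv)
    then have "h *v axis j 1 = (\<chi> k. det (\<chi> a b. if b = k then axis j 1 $ a else g $ a $ b) / det g)"
      using det by (subst cramer[symmetric]) auto
    then have "h $ k $ j = det (\<chi> a b. if b = k then axis j 1 $ a else g $ a $ b)"
      using det by (metis (no_types, lifting) div_by_1 matrix_vector_nth pairing_axis vec_lambda_beta)
    moreover have "absval ((if b = k then axis j 1 $ a else g $ a $ b) :: 'k) \<le> ?B" for a b
      using absval_le_mnorm[of g a b] mnorm_nonneg[of g] by (auto simp: axis_def absval_one absval_zero)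
    ultimately show ?thesis by (simp add: absval_det_le)
  qed
  have "mnorm h \<le> (\<Sum>i\<in>(UNIV :: 'd set). \<Sum>j\<in>(UNIV :: 'd set). fact CARD('d) * ?B ^ CARD('d))"
    unfolding mnorm_def[of h] vnorm_def[of "h $ i" for i] by (intro sum_mono entry)
  then have h: "mnorm h \<le> ?d\<^sup>2 * fact CARD('d) * ?B ^ CARD('d)" by (simp add: power2_eq_square mult_ac)
  have B: "mnorm g \<le> ?B" "1 \<le> ?B" by (simp_all add: mnorm_nonneg)
  have X: "1 \<le> ?d\<^sup>2 * fact CARD('d) * ?B ^ CARD('d)"
    using B(2) by (intro mult_ge1_I one_le_power) (simp_all add: Suc_leI)
  have dist: "distortion g = ?B * (?d\<^sup>2 * fact CARD('d) * ?B ^ CARD('d))"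
    by (simp add: distortion_def mult_ac)
  show thesis
  proof (rule that[OF inv])
    show "mnorm g * mnorm h \<le> distortion g"
      unfolding dist using B X by (intro mult_mono B h) (auto simp: mnorm_nonneg)
    show "mnorm g \<le> distortion g"
      unfolding dist using mult_mono[OF B(1) X] B by (simp add: mnorm_nonneg)
    show "mnorm h \<le> distortion g"
      unfolding dist using mult_mono[OF B(2) h] B by (simp add: mnorm_nonneg)
  qed
qed

lemma SL_mult: "g \<in> SL \<Longrightarrow> h \<in> SL \<Longrightarrow> g ** h \<in> SL"
  by (simp add: SL_def det_mul)

lemma SL_one: "mat 1 \<in> SL"
  by (simp add: SL_def)

lemma SL_matrix_vector_nz: "g \<in> SL \<Longrightarrow> x \<noteq> 0 \<Longrightarrow> g *v x \<noteq> (0 :: 'k::absval_field ^ 'd)"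
  by (metis SL_inverse matrix_vector_mul_assoc matrix_vector_mul_lid matrix_vector_mult_0_right)

lemma SL_vector_matrix_nz: "g \<in> SL \<Longrightarrow> f \<noteq> 0 \<Longrightarrow> f v* g \<noteq> (0 :: 'k::absval_field ^ 'd)"
  by (metis SL_inverse vector_matrix_mul_assoc vector_matrix_mul_rid vector_matrix_mult_0)

lemma pullback_one: "pullback (mat 1) w = w"
  by (simp add: pullback_def transpose_mat)

lemma SL_pullback_nz: "g \<in> SL \<Longrightarrow> w \<noteq> 0 \<Longrightarrow> pullback g w \<noteq> (0 :: 'k::absval_field ^ 'd ^ 'd)"
proof
  assume "g \<in> SL" "w \<noteq> 0" "pullback g w = 0"
  obtain h where "g ** h = mat 1" using SL_inverse[OF \<open>g \<in> SL\<close>] .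
  then have "w = pullback h (pullback g w)" by (simp add: pullback_mult[symmetric] pullback_one)
  then show False using \<open>w \<noteq> 0\<close> \<open>pullback g w = 0\<close> by (simp add: pullback_def)
qed

lemma SL_mnorm_pos: "g \<in> SL \<Longrightarrow> 0 < mnorm (g :: 'k::absval_field ^ 'd ^ 'd)"
  using SL_matrix_vector_nz[of g, OF _ axis_one_neq_0] by (intro mnorm_pos) auto

lemma vnorm_le_distortion:
  assumes "g \<in> SL" shows "vnorm f \<le> distortion g * vnorm (f v* g)" "vnorm (f v* g) \<le> distortion g * vnorm f"
proof -
  obtain h where h: "g ** h = mat 1" "mnorm g \<le> distortion g" "mnorm h \<le> distortion g"
    using SL_inverse[OF assms] by metis
  have "vnorm f \<le> vnorm (f v* g) * mnorm h"
    using vnorm_vector_matrix_le[of "f v* g" h] h(1) by (simp add: vector_matrix_mul_assoc)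
  also have "\<dots> \<le> vnorm (f v* g) * distortion g" by (intro mult_left_mono h vnorm_nonneg)
  finally show "vnorm f \<le> distortion g * vnorm (f v* g)" by (simp add: mult.commute)
  have "vnorm (f v* g) \<le> vnorm f * distortion g"
    by (rule order_trans[OF vnorm_vector_matrix_le]) (intro mult_left_mono h vnorm_nonneg)
  then show "vnorm (f v* g) \<le> distortion g * vnorm f" by (simp add: mult.commute)
qed

lemma mnorm_le_distortion_vnorm:
  fixes g :: "'k::absval_field ^ 'd ^ 'd"
  assumes "g \<in> SL" shows "mnorm g * vnorm f \<le> distortion g * vnorm (f v* g)"
proof -
  obtain h where h: "g ** h = mat 1" "mnorm g * mnorm h \<le> distortion g"
    using SL_inverse[OF assms] by metis
  have "vnorm f \<le> vnorm (f v* g) * mnorm h"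
    using vnorm_vector_matrix_le[of "f v* g" h] h(1) by (simp add: vector_matrix_mul_assoc)
  then have "mnorm g * vnorm f \<le> (mnorm g * mnorm h) * vnorm (f v* g)"
    using mult_left_mono[OF _ mnorm_nonneg, of "vnorm f" "vnorm (f v* g) * mnorm h" g] by (simp add: mult_ac)
  also have "\<dots> \<le> distortion g * vnorm (f v* g)" by (intro mult_right_mono h vnorm_nonneg)
  finally show ?thesis .
qed

lemma mnorm_pullback_le_distortion:
  assumes "g \<in> SL"
  shows "mnorm w \<le> (distortion g)\<^sup>2 * mnorm (pullback g w)" "mnorm (pullback g w) \<le> (distortion g)\<^sup>2 * mnorm w"
proof -
  obtain h where h: "g ** h = mat 1" "mnorm g \<le> distortion g" "mnorm h \<le> distortion g"
    using SL_inverse[OF assms] by metis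
  have "mnorm w \<le> (mnorm h)\<^sup>2 * mnorm (pullback g w)"
    using mnorm_pullback_le[of h "pullback g w"] h(1) by (simp add: pullback_mult[symmetric] pullback_one)
  also have "\<dots> \<le> (distortion g)\<^sup>2 * mnorm (pullback g w)"
    by (intro mult_right_mono power_mono h mnorm_nonneg)
  finally show "mnorm w \<le> (distortion g)\<^sup>2 * mnorm (pullback g w)" .
  show "mnorm (pullback g w) \<le> (distortion g)\<^sup>2 * mnorm w"
    by (rule order_trans[OF mnorm_pullback_le]) (intro mult_right_mono power_mono h mnorm_nonneg)
qed

section \<open>The Borel structure of the projective space\<close>

text \<open>This stands in for second countability, which the class \<open>absval_field\<close> does
  not assume. It makes open sets of products countable unions of rectangles, so that matrix products
  and the action on lines are measurable.\<close>

definition countably_dense :: "'a::metric_space itself \<Rightarrow> bool" where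
  "countably_dense _ \<longleftrightarrow> (\<exists>D :: 'a set. countable D \<and> (\<forall>x e. 0 < e \<longrightarrow> (\<exists>d\<in>D. dist d x < e)))"

lemma local_field_countably_dense: "local_field TYPE('k::absval_field) \<Longrightarrow> countably_dense TYPE('k)"
  unfolding countably_dense_def by (metis local_field_countable_dense)

lemma countably_dense_vec:
  assumes "countably_dense TYPE('a::metric_space)" shows "countably_dense TYPE('a ^ 'n)"
proof -
  obtain D :: "'a set" where D: "countable D" "\<And>x e. 0 < e \<Longrightarrow> \<exists>d\<in>D. dist d x < e"
    using assms unfolding countably_dense_def by blast
  let ?D = "(\<lambda>f. \<chi> i. f i) ` (UNIV \<rightarrow>\<^sub>E D) :: ('a ^ 'n) set"
  have "countable ?D" by (intro countable_image countable_PiE D(1)) auto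
  moreover have "\<exists>d\<in>?D. dist d x < e" if "0 < e" for x e
  proof -
    have "\<forall>i. \<exists>d\<in>D. dist d (x $ i) < e / real CARD('n)"
      using that by (intro allI D(2)) simp
    then obtain f where f: "\<And>i. f i \<in> D" "\<And>i. dist (f i) (x $ i) < e / real CARD('n)" by metis
    have "dist (\<chi> i. f i) x \<le> (\<Sum>i\<in>UNIV. dist (f i) (x $ i))"
      unfolding dist_vec_def by (rule order_trans[OF L2_set_le_sum]) auto
    also have "\<dots> < (\<Sum>i\<in>(UNIV :: 'n set). e / real CARD('n))"
      by (intro sum_strict_mono f) auto
    also have "\<dots> = e" by simp
    finally show ?thesis using f(1) by (intro bexI[of _ "\<chi> i. f i"] image_eqI[of _ _ f]) auto
  qed
  ultimately show ?thesis unfolding countably_dense_def by blast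
qed

lemma countably_dense_rectangles:
  fixes S :: "('a::metric_space \<times> 'b::metric_space) set"
  assumes "countably_dense TYPE('a)" "countably_dense TYPE('b)" "open S"
  obtains I where "countable I" "\<And>a b r. (a, b, r) \<in> I \<Longrightarrow> ball a r \<times> ball b r \<subseteq> S"
    "\<And>x y. (x, y) \<in> S \<Longrightarrow> \<exists>(a, b, r)\<in>I. x \<in> ball a r \<and> y \<in> ball b r"
proof -
  obtain D :: "'a set" where D: "countable D" "\<And>x e. 0 < e \<Longrightarrow> \<exists>d\<in>D. dist d x < e"
    using assms(1) unfolding countably_dense_def by blast
  obtain D' :: "'b set" where D': "countable D'" "\<And>x e. 0 < e \<Longrightarrow> \<exists>d\<in>D'. dist d x < e"
    using assms(2) unfolding countably_dense_def by blast
  let ?R = "range (\<lambda>n. inverse (real (Suc n)))"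
  define I where "I = {(a, b, r) \<in> D \<times> D' \<times> ?R. ball a r \<times> ball b r \<subseteq> S}"
  show thesis
  proof (rule that[of I])
    have "countable (D \<times> D' \<times> ?R)" using D(1) D'(1) by (intro countable_SIGMA) auto
    then show "countable I" by (rule countable_subset[rotated]) (auto simp: I_def)
    show "ball a r \<times> ball b r \<subseteq> S" if "(a, b, r) \<in> I" for a b r using that by (auto simp: I_def)
    fix x y assume "(x, y) \<in> S"
    then obtain A B where AB: "open A" "open B" "(x, y) \<in> A \<times> B" "A \<times> B \<subseteq> S"
      using \<open>open S\<close> open_prod_elim by blast
    obtain e1 where e1: "0 < e1" "ball x e1 \<subseteq> A" using AB openE[of A x] by blast
    obtain e2 where e2: "0 < e2" "ball y e2 \<subseteq> B" using AB openE[of B y] by blast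
    have "0 < min e1 e2 / 2" using e1 e2 by simp
    then obtain n where n: "inverse (real (Suc n)) < min e1 e2 / 2" using reals_Archimedean by blast
    define r where "r = inverse (real (Suc n))"
    have r: "0 < r" "2 * r < e1" "2 * r < e2" using n by (auto simp: r_def)
    obtain a where a: "a \<in> D" "dist a x < r" using D(2) r by blast
    obtain b where b: "b \<in> D'" "dist b y < r" using D'(2) r by blast
    have "ball a r \<subseteq> ball x e1"
    proof
      fix z assume "z \<in> ball a r"
      then show "z \<in> ball x e1" using a(2) r(2) dist_triangle[of x z a] by (simp add: dist_commute)
    qed
    moreover have "ball b r \<subseteq> ball y e2"
    proof
      fix z assume "z \<in> ball b r"
      then show "z \<in> ball y e2" using b(2) r(3) dist_triangle[of y z b] by (simp add: dist_commute)
    qed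
    ultimately have "ball a r \<times> ball b r \<subseteq> S" using e1 e2 AB(4) by blast
    then have "(a, b, r) \<in> I" using a b by (auto simp: I_def r_def)
    moreover have "x \<in> ball a r" "y \<in> ball b r" using a b by auto
    ultimately show "\<exists>(a, b, r)\<in>I. x \<in> ball a r \<and> y \<in> ball b r" by blast
  qed
qed

lemma borel_measurable_Pair_dense:
  fixes X :: "'w \<Rightarrow> 'a::metric_space" and Y :: "'w \<Rightarrow> 'b::metric_space"
  assumes "countably_dense TYPE('a)" "countably_dense TYPE('b)"
    and [measurable]: "X \<in> borel_measurable M" "Y \<in> borel_measurable M"
  shows "(\<lambda>\<omega>. (X \<omega>, Y \<omega>)) \<in> borel_measurable M"
proof (rule borel_measurableI)
  fix S :: "('a \<times> 'b) set" assume "open S"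
  from countably_dense_rectangles[OF assms(1,2) this]
  obtain I where I: "countable I" "\<And>a b r. (a, b, r) \<in> I \<Longrightarrow> ball a r \<times> ball b r \<subseteq> S"
    "\<And>x y. (x, y) \<in> S \<Longrightarrow> \<exists>(a, b, r)\<in>I. x \<in> ball a r \<and> y \<in> ball b r" by blast
  have "(\<lambda>\<omega>. (X \<omega>, Y \<omega>)) -` S \<inter> space M = (\<Union>(a, b, r)\<in>I. (X -` ball a r \<inter> space M) \<inter> (Y -` ball b r \<inter> space M))"
    using I(2,3) by fast
  also have "\<dots> \<in> sets M"
    using I(1) by (intro sets.countable_UN') (auto intro!: sets.Int measurable_sets[OF assms(3)]
        measurable_sets[OF assms(4)])
  finally show "(\<lambda>\<omega>. (X \<omega>, Y \<omega>)) -` S \<inter> space M \<in> sets M" .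
qed

lemma continuous_on_absval [continuous_intros]:
  "continuous_on A f \<Longrightarrow> continuous_on A (\<lambda>x. absval (f x :: 'k::absval_field))"
  unfolding continuous_on_def by (auto intro: tendsto_absval)

lemma continuous_on_vnorm [continuous_intros]:
  "continuous_on A f \<Longrightarrow> continuous_on A (\<lambda>x. vnorm (f x))"
  unfolding vnorm_def by (intro continuous_intros)

lemma continuous_on_mnorm [continuous_intros]:
  "continuous_on A f \<Longrightarrow> continuous_on A (\<lambda>x. mnorm (f x))"
  unfolding mnorm_def by (intro continuous_intros)

lemma continuous_on_matrix_mult [continuous_intros]:
  "continuous_on A f \<Longrightarrow> continuous_on A g \<Longrightarrow> continuous_on A (\<lambda>x. f x ** (g x :: 'k::absval_field ^ 'd ^ 'd))"
  unfolding matrix_matrix_mult_def by (intro continuous_intros)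

lemma continuous_on_matrix_vector [continuous_intros]:
  "continuous_on A f \<Longrightarrow> continuous_on A g \<Longrightarrow> continuous_on A (\<lambda>x. f x *v (g x :: 'k::absval_field ^ 'd))"
  unfolding matrix_vector_mult_def by (intro continuous_intros)

lemma continuous_on_vector_matrix [continuous_intros]:
  "continuous_on A f \<Longrightarrow> continuous_on A g \<Longrightarrow> continuous_on A (\<lambda>x. f x v* (g x :: 'k::absval_field ^ 'd ^ 'd))"
  unfolding vector_matrix_mult_def by (intro continuous_intros)

lemma continuous_on_pairing [continuous_intros]:
  "continuous_on A f \<Longrightarrow> continuous_on A g \<Longrightarrow> continuous_on A (\<lambda>x. pairing (f x) (g x :: 'k::absval_field ^ 'd))"
  unfolding pairing_def by (intro continuous_intros)

lemma continuous_on_pullback [continuous_intros]: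
  "continuous_on A f \<Longrightarrow> continuous_on A (\<lambda>x. pullback (f x :: 'k::absval_field ^ 'd ^ 'd) w)"
  unfolding pullback_def transpose_def by (intro continuous_intros)

lemma continuous_on_minors [continuous_intros]:
  "continuous_on A f \<Longrightarrow> continuous_on A (\<lambda>x. minors (f x))"
  unfolding minors_def wedge_def by (intro continuous_intros)

lemma continuous_on_scale_vec [continuous_intros]:
  "continuous_on A f \<Longrightarrow> continuous_on A (\<lambda>x. c *s (f x :: 'k::absval_field ^ 'd))"
  unfolding vector_scalar_mult_def by (intro continuous_intros)

lemma borel_measurable_matrix_mult:
  fixes X Y :: "'w \<Rightarrow> 'k::absval_field ^ 'd ^ 'd"
  assumes "countably_dense TYPE('k)" "X \<in> borel_measurable M" "Y \<in> borel_measurable M"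
  shows "(\<lambda>\<omega>. X \<omega> ** Y \<omega>) \<in> borel_measurable M"
proof -
  have "(\<lambda>p :: ('k ^ 'd ^ 'd) \<times> ('k ^ 'd ^ 'd). fst p ** snd p) \<in> borel_measurable borel"
    by (intro borel_measurable_continuous_onI continuous_intros)
  from measurable_compose[OF borel_measurable_Pair_dense[OF _ _ assms(2,3)] this]
  show ?thesis using assms(1) by (simp add: countably_dense_vec)
qed

text \<open>An arbitrary choice, with no claim of measurability. It occurs only in conditions that
  are invariant under scaling, and those define measurable sets of lines.\<close>

definition rep :: "('k::field ^ 'd) set \<Rightarrow> 'k ^ 'd" where
  "rep L = (SOME x. x \<noteq> 0 \<and> L = line x)"

lemma line_eq_range: "line x = range (\<lambda>c. c *s x)"
  by (auto simp: line_def vec.span_singleton)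

lemma line_scale: "c \<noteq> 0 \<Longrightarrow> line (c *s x) = line x"
  unfolding line_eq_range
  by (auto simp: image_iff vector_smult_assoc) (metis divide_self_if mult.commute nonzero_eq_divide_eq
      times_divide_eq_right mult_cancel_left2)

lemma rep_neq_0: "L \<in> proj_space \<Longrightarrow> rep L \<noteq> 0"
  and line_rep: "L \<in> proj_space \<Longrightarrow> line (rep L) = L"
proof -
  assume "L \<in> proj_space"
  then have "\<exists>x. x \<noteq> 0 \<and> L = line x" by (auto simp: proj_space_def)
  from someI_ex[OF this] show "rep L \<noteq> 0" "line (rep L) = L" by (auto simp: rep_def)
qed

lemma line_in_proj_space: "x \<noteq> 0 \<Longrightarrow> line x \<in> proj_space"
  by (auto simp: proj_space_def)

lemma rep_line:
  assumes "x \<noteq> 0" obtains c where "c \<noteq> 0" "rep (line x) = c *s x"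
  using line_eq_imp_scale[of "rep (line x)" x] rep_neq_0[of "line x"] line_rep[of "line x"]
    line_in_proj_space[OF assms] by metis

lemma matrix_image_line: "(*v) g ` line x = line (g *v (x :: 'k::field ^ 'd))"
  unfolding line_eq_range by (auto simp: vector_scalar_commute image_iff)

lemma space_proj_borel: "space proj_borel = proj_space"
  unfolding proj_borel_def by (rule space_measure_of) auto

lemma proj_borel_generator:
  assumes "U \<subseteq> proj_space" "open {x :: 'k::absval_field ^ 'd. x \<noteq> 0 \<and> line x \<in> U}"
  shows "U \<in> sets proj_borel"
  unfolding proj_borel_def using assms by (intro in_measure_of) auto

lemma proj_borel_open:
  fixes P :: "'k::absval_field ^ 'd \<Rightarrow> bool"
  assumes "open {x. x \<noteq> 0 \<and> P x}" and "\<And>x c. x \<noteq> 0 \<Longrightarrow> c \<noteq> 0 \<Longrightarrow> P (c *s x) = P x"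
  shows "{L \<in> proj_space. P (rep L)} \<in> sets proj_borel"
proof (rule proj_borel_generator)
  have "P (rep (line x)) = P x" if "x \<noteq> 0" for x
    using rep_line[OF that] assms(2)[OF that] by metis
  then have "{x. x \<noteq> 0 \<and> line x \<in> {L \<in> proj_space. P (rep L)}} = {x. x \<noteq> 0 \<and> P x}"
    using line_in_proj_space by blast
  then show "open {x. x \<noteq> 0 \<and> line x \<in> {L \<in> proj_space. P (rep L)}}" using assms(1) by simp
qed auto

lemma proj_borel_closed:
  fixes P :: "'k::absval_field ^ 'd \<Rightarrow> bool"
  assumes "open {x. x \<noteq> 0 \<and> \<not> P x}" and "\<And>x c. x \<noteq> 0 \<Longrightarrow> c \<noteq> 0 \<Longrightarrow> P (c *s x) = P x"
  shows "{L \<in> proj_space. P (rep L)} \<in> sets proj_borel"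
proof -
  have "{L \<in> proj_space. \<not> P (rep L)} \<in> sets proj_borel"
    by (rule proj_borel_open) (use assms in auto)
  from sets.compl_sets[OF this] show ?thesis
    by (auto simp: space_proj_borel set_diff_eq conj_commute cong: rev_conj_cong elim: back_subst[of
      "\<lambda>A. A \<in> sets proj_borel"])
qed

text \<open>The condition that \<open>g *v x\<close> spans a line in \<open>U\<close> is open in
  \<open>(g, x)\<close> and splits into countably many rectangles. A line has no preferred
  representative, so the second factor is replaced by the set of lines that meet the ball; this does
  no harm because the condition is invariant under scaling of \<open>x\<close>.\<close>

lemma measurable_action:
  fixes G :: "'w \<Rightarrow> 'k::absval_field ^ 'd ^ 'd" and X :: "'w \<Rightarrow> ('k ^ 'd) set"
  assumes cd: "countably_dense TYPE('k)"
    and G: "G \<in> borel_measurable M" "\<And>\<omega>. \<omega> \<in> space M \<Longrightarrow> G \<omega> \<in> SL"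
    and X: "X \<in> measurable M proj_borel"
  shows "(\<lambda>\<omega>. (*v) (G \<omega>) ` X \<omega>) \<in> measurable M proj_borel"
proof -
  have XP: "X \<omega> \<in> proj_space" if "\<omega> \<in> space M" for \<omega>
    using measurable_space[OF X that] by (simp add: space_proj_borel)
  have act: "(*v) (G \<omega>) ` X \<omega> = line (G \<omega> *v rep (X \<omega>))" if "\<omega> \<in> space M" for \<omega>
    using matrix_image_line[of "G \<omega>" "rep (X \<omega>)"] line_rep[OF XP[OF that]] by simp
  have nz: "G \<omega> *v rep (X \<omega>) \<noteq> 0" if "\<omega> \<in> space M" for \<omega>
    using SL_matrix_vector_nz[OF G(2)[OF that] rep_neq_0[OF XP[OF that]]] .
  show ?thesis
    unfolding proj_borel_def
  proof (rule measurable_measure_of)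
    show "(\<lambda>\<omega>. (*v) (G \<omega>) ` X \<omega>) \<in> space M \<rightarrow> proj_space"
      by (auto simp: act intro!: line_in_proj_space nz)
    fix U :: "('k ^ 'd) set set"
    assume U: "U \<in> {U. U \<subseteq> proj_space \<and> open {x :: 'k ^ 'd. x \<noteq> 0 \<and> line x \<in> U}}"
    let ?V = "{x. x \<noteq> 0 \<and> line x \<in> U}"
    have "open ((\<lambda>p :: ('k ^ 'd ^ 'd) \<times> ('k ^ 'd). fst p *v snd p) -` ?V)"
      using U by (intro open_vimage continuous_intros) auto
    then have "open {(g :: 'k ^ 'd ^ 'd, x). g *v x \<in> ?V}" by (simp add: vimage_def case_prod_unfold)
    from countably_dense_rectangles[OF countably_dense_vec[OF countably_dense_vec[OF cd]] countably_dense_vec[OF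
        cd] this]
    obtain I :: "(('k ^ 'd ^ 'd) \<times> ('k ^ 'd) \<times> real) set" where I: "countable I"
      "\<And>a b r. (a, b, r) \<in> I \<Longrightarrow> ball a r \<times> ball b r \<subseteq> {(g :: 'k ^ 'd ^ 'd, x :: 'k ^ 'd). g *v x \<in> ?V}"
      "\<And>x y. (x, y) \<in> {(g :: 'k ^ 'd ^ 'd, x :: 'k ^ 'd). g *v x \<in> ?V} \<Longrightarrow> \<exists>(a, b, r)\<in>I. x \<in> ball a r \<and> y
          \<in> ball b r"
      by blast
    let ?T = "\<lambda>b r. {L \<in> proj_space. \<exists>c. c \<noteq> 0 \<and> c *s rep L \<in> ball b r}"
    have T: "?T b r \<in> sets proj_borel" for b :: "'k ^ 'd" and r
    proof (rule proj_borel_open)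
      have "open (- {0} \<inter> (\<Union>c\<in>-{0}. (\<lambda>x. c *s x) -` ball b r))"
        by (intro open_Int open_UN ballI open_vimage continuous_intros) auto
      also have "- {0} \<inter> (\<Union>c\<in>-{0}. (\<lambda>x. c *s x) -` ball b r) = {x. x \<noteq> 0 \<and> (\<exists>c. c \<noteq> 0 \<and> c *s x \<in> ball b r)}"
        by auto
      finally show "open {x. x \<noteq> 0 \<and> (\<exists>c. c \<noteq> 0 \<and> c *s x \<in> ball b r)}" .
      fix x :: "'k ^ 'd" and c :: 'k assume "c \<noteq> 0"
      have "\<exists>c'. c' \<noteq> 0 \<and> c' *s (c *s x) \<in> ball b r" if "a \<noteq> 0" "a *s x \<in> ball b r" for a
        using that \<open>c \<noteq> 0\<close> by (intro exI[of _ "a / c"]) (simp add: vector_smult_assoc)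
      moreover have "\<exists>c'. c' \<noteq> 0 \<and> c' *s x \<in> ball b r" if "a \<noteq> 0" "a *s (c *s x) \<in> ball b r" for a
        using that \<open>c \<noteq> 0\<close> by (intro exI[of _ "a * c"]) (simp add: vector_smult_assoc)
      ultimately show "(\<exists>c'. c' \<noteq> 0 \<and> c' *s (c *s x) \<in> ball b r) = (\<exists>c. c \<noteq> 0 \<and> c *s x \<in> ball b r)" by blast
    qed
    have "(\<lambda>\<omega>. (*v) (G \<omega>) ` X \<omega>) -` U \<inter> space M
        = (\<Union>(a, b, r)\<in>I. (G -` ball a r \<inter> space M) \<inter> (X -` ?T b r \<inter> space M))" (is "?A = ?B")
    proof (intro equalityI subsetI)
      fix \<omega> assume "\<omega> \<in> ?A"
      then have w: "\<omega> \<in> space M" "line (G \<omega> *v rep (X \<omega>)) \<in> U" using act by auto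
      then have "(G \<omega>, rep (X \<omega>)) \<in> {(g, x). g *v x \<in> ?V}" using nz by auto
      from I(3)[OF this] obtain a b r where "(a, b, r) \<in> I" "G \<omega> \<in> ball a r" "rep (X \<omega>) \<in> ball b r" by blast
      moreover have "\<exists>c. c \<noteq> 0 \<and> c *s rep (X \<omega>) \<in> ball b r"
        using calculation(3) by (intro exI[of _ 1]) simp
      ultimately show "\<omega> \<in> ?B" using w(1) XP[OF w(1)] by blast
    next
      fix \<omega> assume "\<omega> \<in> ?B"
      then obtain a b r c where abr: "(a, b, r) \<in> I" "\<omega> \<in> space M" "G \<omega> \<in> ball a r" "c \<noteq> 0"
        "c *s rep (X \<omega>) \<in> ball b r"
        by blast
      then have "(G \<omega>, c *s rep (X \<omega>)) \<in> {(g, x). g *v x \<in> ?V}" using I(2)[OF abr(1)] by blast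
      then have "line (c *s (G \<omega> *v rep (X \<omega>))) \<in> U" by (simp add: vector_scalar_commute)
      then show "\<omega> \<in> ?A" using act[OF abr(2)] abr(2,4) by (simp add: line_scale)
    qed
    also have "\<dots> \<in> sets M"
    proof (rule sets.countable_UN'[OF I(1)], rule image_subsetI)
      fix p assume "p \<in> I"
      have "(G -` ball a r \<inter> space M) \<inter> (X -` ?T b r \<inter> space M) \<in> sets M" for a b r
        by (intro sets.Int measurable_sets[OF G(1)] measurable_sets[OF X] T) simp
      then show "(case p of (a, b, r) \<Rightarrow> (G -` ball a r \<inter> space M) \<inter> (X -` ?T b r \<inter> space M)) \<in> sets M"
        by (simp only: case_prod_unfold)
    qed
    finally show "(\<lambda>\<omega>. (*v) (G \<omega>) ` X \<omega>) -` U \<inter> space M \<in> sets M" .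
  qed auto
qed

section \<open>Random walks and harmonic functions\<close>

locale stationary_walk =
  fixes \<mu> :: "('k::absval_field ^ 'd ^ 'd) measure" and \<nu> :: "('k ^ 'd) set measure"
  assumes dense: "countably_dense TYPE('k)"
    and prob_on_SL: "prob_on_SL \<mu>"
    and invariant: "invariant_prob \<mu> \<nu>"
begin

lemma sets_\<mu>: "sets \<mu> = sets (restrict_space borel SL)"
  using prob_on_SL by (simp add: prob_on_SL_def)

lemma space_\<mu>: "space \<mu> = SL"
  using sets_eq_imp_space_eq[OF sets_\<mu>] by (simp add: space_restrict_space)

lemma sets_\<nu>: "sets \<nu> = sets proj_borel"
  using invariant by (simp add: invariant_prob_def)

lemma space_\<nu>: "space \<nu> = proj_space"
  using sets_eq_imp_space_eq[OF sets_\<nu>] by (simp add: space_proj_borel)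

sublocale \<mu>: prob_space \<mu>
  using prob_on_SL by (simp add: prob_on_SL_def)

sublocale \<nu>: prob_space \<nu>
  using invariant by (simp add: invariant_prob_def)

sublocale sequence_space \<mu>
  by unfold_locales

sublocale SS: pair_prob_space S S
  by unfold_locales

lemma space_S: "\<omega> \<in> space S \<longleftrightarrow> (\<forall>i. \<omega> i \<in> SL)"
  by (auto simp: space_PiM PiE_iff space_\<mu>)

primrec walk :: "nat \<Rightarrow> (nat \<Rightarrow> 'k ^ 'd ^ 'd) \<Rightarrow> 'k ^ 'd ^ 'd" where
  "walk 0 \<omega> = mat 1"
| "walk (Suc n) \<omega> = walk n \<omega> ** \<omega> n"

lemma walk_comb_seq: "walk (n + k) (comb_seq n \<omega> \<omega>') = walk n \<omega> ** walk k \<omega>'"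
proof (induction k)
  case 0
  have "walk m (comb_seq n \<omega> \<omega>') = walk m \<omega>" if "m \<le> n" for m
    using that by (induction m) (auto simp: comb_seq_less)
  then show ?case by simp
next
  case (Suc k)
  then show ?case by (simp add: comb_seq_def matrix_mul_assoc)
qed

lemma walk_SL: "\<omega> \<in> space S \<Longrightarrow> walk n \<omega> \<in> SL"
  by (induction n) (auto simp: SL_one SL_mult space_S)

lemma comb_seq_space: "\<omega> \<in> space S \<Longrightarrow> \<omega>' \<in> space S \<Longrightarrow> comb_seq n \<omega> \<omega>' \<in> space S"
  by (auto simp: space_S comb_seq_def)

lemma step_borel: "(\<lambda>g. g) \<in> borel_measurable \<mu>"
  using measurable_restrict_space1[of "\<lambda>g. g" borel borel SL] measurable_cong_sets[OF sets_\<mu> refl, of borel]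
    by auto

lemma walk_borel [measurable]: "walk n \<in> borel_measurable S"
proof (induction n)
  case (Suc n)
  have "(\<lambda>\<omega>. \<omega> n) \<in> measurable S \<mu>" by simp
  from measurable_compose[OF this step_borel] show ?case
    using Suc unfolding walk.simps by (intro borel_measurable_matrix_mult dense)
qed simp

lemma continuous_walk_borel:
  assumes "continuous_on UNIV F" shows "(\<lambda>\<omega>. F (walk n \<omega>)) \<in> borel_measurable S"
  using measurable_compose[OF walk_borel borel_measurable_continuous_onI[OF assms]] .

lemma comb_seq_measurable: "(\<lambda>p. comb_seq n (fst p) (snd p)) \<in> measurable (S \<Otimes>\<^sub>M S) S"
  using measurable_comb_seq[of n \<mu>] by (simp add: case_prod_unfold)

text \<open>The Markov property. \<open>comb_seq n\<close> takes \<open>n\<close> entries from the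
  first path and continues with the second, and it sends two independent paths to one with the law
  \<open>S\<close>. Conditioning on the first \<open>n\<close> steps thus becomes an iterated
  integral.\<close>

lemma integral_comb_seq:
  fixes F :: "_ \<Rightarrow> real"
  assumes "integrable S F"
  shows "(\<integral>\<omega>. F \<omega> \<partial>S) = (\<integral>\<omega>. (\<integral>\<omega>'. F (comb_seq n \<omega> \<omega>') \<partial>S) \<partial>S)"
    and "integrable S (\<lambda>\<omega>. \<integral>\<omega>'. F (comb_seq n \<omega> \<omega>') \<partial>S)"
    and "integrable (S \<Otimes>\<^sub>M S) (\<lambda>p. F (comb_seq n (fst p) (snd p)))"
proof -
  have D: "distr (S \<Otimes>\<^sub>M S) S (\<lambda>p. comb_seq n (fst p) (snd p)) = S"
    using PiM_comb_seq[of n] by (simp add: case_prod_unfold)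
  have F: "F \<in> borel_measurable S" using assms by simp
  show *: "integrable (S \<Otimes>\<^sub>M S) (\<lambda>p. F (comb_seq n (fst p) (snd p)))"
    using assms integrable_distr[OF comb_seq_measurable, of n F] by (simp add: D)
  have "(\<integral>\<omega>. F \<omega> \<partial>S) = (\<integral>p. F (comb_seq n (fst p) (snd p)) \<partial>(S \<Otimes>\<^sub>M S))"
    using integral_distr[OF comb_seq_measurable F, of n] by (simp add: D)
  also have "\<dots> = (\<integral>\<omega>. (\<integral>\<omega>'. F (comb_seq n \<omega> \<omega>') \<partial>S) \<partial>S)"
    using SS.integral_fst'[OF *] by simp
  finally show "(\<integral>\<omega>. F \<omega> \<partial>S) = (\<integral>\<omega>. (\<integral>\<omega>'. F (comb_seq n \<omega> \<omega>') \<partial>S) \<partial>S)" .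
  show "integrable S (\<lambda>\<omega>. \<integral>\<omega>'. F (comb_seq n \<omega> \<omega>') \<partial>S)"
    using SS.integrable_fst'[OF *] by simp
qed

lemma prob_comb_seq:
  assumes A: "{\<omega> \<in> space S. Q \<omega>} \<in> sets S"
  shows "prob {\<omega> \<in> space S. Q \<omega>} = (\<integral>\<omega>. prob {\<omega>' \<in> space S. Q (comb_seq n \<omega> \<omega>')} \<partial>S)"
    and "integrable S (\<lambda>\<omega>. prob {\<omega>' \<in> space S. Q (comb_seq n \<omega> \<omega>')})"
    and "\<And>\<omega>. \<omega> \<in> space S \<Longrightarrow> {\<omega>' \<in> space S. Q (comb_seq n \<omega> \<omega>')} \<in> sets S"
proof -
  let ?A = "{\<omega> \<in> space S. Q \<omega>}"
  have int: "integrable S (indicat_real ?A)"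
    using A by (intro integrable_real_indicator) (simp_all add: P.emeasure_eq_measure)
  have sec: "{\<omega>' \<in> space S. Q (comb_seq n \<omega> \<omega>')} \<in> sets S" if w: "\<omega> \<in> space S" for \<omega>
  proof -
    have "(\<lambda>\<omega>'. comb_seq n \<omega> \<omega>') \<in> measurable S S"
      using w by (intro measurable_comb_seq') auto
    from measurable_sets[OF this A] show ?thesis
      by (rule back_subst[of "\<lambda>X. X \<in> sets S"]) (use comb_seq_space[OF w] in auto)
  qed
  then show "\<And>\<omega>. \<omega> \<in> space S \<Longrightarrow> {\<omega>' \<in> space S. Q (comb_seq n \<omega> \<omega>')} \<in> sets S" .
  have eq: "(\<integral>\<omega>'. indicat_real ?A (comb_seq n \<omega> \<omega>') \<partial>S) = prob {\<omega>' \<in> space S. Q (comb_seq n \<omega> \<omega>')}"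
    if w: "\<omega> \<in> space S" for \<omega>
  proof -
    have "(\<integral>\<omega>'. indicat_real ?A (comb_seq n \<omega> \<omega>') \<partial>S)
        = (\<integral>\<omega>'. indicat_real {\<omega>' \<in> space S. Q (comb_seq n \<omega> \<omega>')} \<omega>' \<partial>S)"
      by (intro Bochner_Integration.integral_cong refl) (auto simp: indicator_def comb_seq_space[OF w])
    then show ?thesis using sec[OF w] by simp
  qed
  show "prob ?A = (\<integral>\<omega>. prob {\<omega>' \<in> space S. Q (comb_seq n \<omega> \<omega>')} \<partial>S)"
    using integral_comb_seq(1)[OF int, of n] A by (simp add: eq cong: Bochner_Integration.integral_cong)
  show "integrable S (\<lambda>\<omega>. prob {\<omega>' \<in> space S. Q (comb_seq n \<omega> \<omega>')})"
    using integral_comb_seq(2)[OF int, of n] by (simp add: eq cong: Bochner_Integration.integrable_cong)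
qed

definition mass :: "('k ^ 'd) set set \<Rightarrow> 'k ^ 'd ^ 'd \<Rightarrow> real" where
  "mass A g = \<nu>.prob {L \<in> proj_space. (*v) g ` L \<in> A}"

lemma action_sets:
  assumes "(g :: 'k ^ 'd ^ 'd) \<in> SL" "A \<in> sets proj_borel"
  shows "{L \<in> proj_space. (*v) g ` L \<in> A} \<in> sets proj_borel"
proof -
  have "(\<lambda>L. (*v) g ` L) \<in> measurable proj_borel proj_borel"
    using assms(1) by (intro measurable_action[OF dense, of "\<lambda>_. g"]) auto
  from measurable_sets[OF this assms(2)] show ?thesis
    by (rule back_subst[of "\<lambda>X. X \<in> sets proj_borel"]) (auto simp: space_proj_borel)
qed

lemma mass_Pair_measurable:
  assumes G: "G \<in> borel_measurable M" "\<And>\<omega>. \<omega> \<in> space M \<Longrightarrow> G \<omega> \<in> SL" and A: "A \<in> sets proj_borel"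
  shows "(\<lambda>\<omega>. mass A (G \<omega>)) \<in> borel_measurable M"
proof -
  have "(\<lambda>p. (*v) (G (fst p)) ` (snd p)) \<in> measurable (M \<Otimes>\<^sub>M \<nu>) proj_borel"
  proof (rule measurable_action[OF dense])
    show "(\<lambda>p. G (fst p)) \<in> borel_measurable (M \<Otimes>\<^sub>M \<nu>)"
      using measurable_compose[OF measurable_fst G(1)] .
    show "snd \<in> measurable (M \<Otimes>\<^sub>M \<nu>) proj_borel"
      using measurable_snd[of M \<nu>] measurable_cong_sets[OF refl sets_\<nu>] by blast
  qed (use G(2) in \<open>auto simp: space_pair_measure\<close>)
  from \<nu>.measurable_emeasure_Pair[OF measurable_sets[OF this A]]
  have "(\<lambda>\<omega>. \<nu>.prob (Pair \<omega> -` ((\<lambda>p. (*v) (G (fst p)) ` (snd p)) -` A \<inter> space (M \<Otimes>\<^sub>M \<nu>)))) \<in> borel_measurable M"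
    unfolding measure_def by (rule borel_measurable_enn2real)
  also have "?this \<longleftrightarrow> ?thesis"
    unfolding mass_def
    by (intro measurable_cong arg_cong[of _ _ \<nu>.prob]) (auto simp: space_pair_measure space_\<nu>)
  finally show ?thesis .
qed

lemma mass_nonneg: "0 \<le> mass A g" and mass_le_1: "mass A g \<le> 1"
  by (simp_all add: mass_def)

lemma mass_walk_measurable:
  assumes "A \<in> sets proj_borel" "g \<in> SL"
  shows "(\<lambda>\<omega>. mass A (g ** walk n \<omega>)) \<in> borel_measurable S"
  using assms by (intro mass_Pair_measurable continuous_walk_borel continuous_intros SL_mult walk_SL)

lemma mass_walk_integrable:
  assumes "A \<in> sets proj_borel" "g \<in> SL"
  shows "integrable S (\<lambda>\<omega>. mass A (g ** walk n \<omega>))"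
  by (rule integrable_const_bound[of _ 1]) (auto simp: mass_nonneg mass_le_1 mass_walk_measurable assms)

lemma image_matrix_mult: "(*v) (g ** h) ` L = (*v) g ` (*v) h ` (L :: ('k ^ 'd) set)"
  by (simp add: image_image matrix_vector_mul_assoc)

lemma mass_mult:
  assumes "h \<in> SL"
  shows "mass A (g ** h) = mass {L \<in> proj_space. (*v) g ` L \<in> A} h"
proof -
  have "(*v) h ` L \<in> proj_space" if L: "L \<in> proj_space" for L :: "('k ^ 'd) set"
  proof -
    obtain x where "x \<noteq> 0" "L = line x" using L unfolding proj_space_def by blast
    then show ?thesis
      using line_in_proj_space[OF SL_matrix_vector_nz[OF assms]] by (simp add: matrix_image_line)
  qed
  then show ?thesis unfolding mass_def image_matrix_mult
    by (intro arg_cong[of _ _ \<nu>.prob]) auto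
qed

lemma mass_stationary:
  assumes A: "A \<in> sets proj_borel"
  shows "\<nu>.prob A = (\<integral>g. mass A g \<partial>\<mu>)"
proof -
  interpret P: pair_prob_space \<mu> \<nu> by unfold_locales
  have act: "(\<lambda>p. (*v) (fst p) ` (snd p)) \<in> measurable (\<mu> \<Otimes>\<^sub>M \<nu>) proj_borel"
  proof (rule measurable_action[OF dense])
    show "fst \<in> borel_measurable (\<mu> \<Otimes>\<^sub>M \<nu>)"
      using measurable_compose[OF measurable_fst step_borel] .
    show "snd \<in> measurable (\<mu> \<Otimes>\<^sub>M \<nu>) proj_borel"
      using measurable_snd[of \<mu> \<nu>] measurable_cong_sets[OF refl sets_\<nu>] by blast
  qed (auto simp: space_pair_measure space_\<mu>)
  let ?B = "(\<lambda>p. (*v) (fst p) ` (snd p)) -` A \<inter> space (\<mu> \<Otimes>\<^sub>M \<nu>)"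
  have B: "?B \<in> sets (\<mu> \<Otimes>\<^sub>M \<nu>)" by (rule measurable_sets[OF act A])
  have "\<nu> = distr (\<mu> \<Otimes>\<^sub>M \<nu>) proj_borel (\<lambda>p. (*v) (fst p) ` (snd p))"
    using invariant by (simp add: invariant_prob_def convolution_action_def case_prod_unfold)
  then have "emeasure \<nu> A = emeasure (\<mu> \<Otimes>\<^sub>M \<nu>) ?B"
    using emeasure_distr[OF act A] by simp
  also have "\<dots> = (\<integral>\<^sup>+ g. emeasure \<nu> (Pair g -` ?B) \<partial>\<mu>)"
    by (rule \<nu>.emeasure_pair_measure_alt[OF B])
  also have "\<dots> = (\<integral>\<^sup>+ g. ennreal (mass A g) \<partial>\<mu>)"
  proof (rule nn_integral_cong)
    fix g assume "g \<in> space \<mu>"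
    then have "Pair g -` ?B = {L \<in> proj_space. (*v) g ` L \<in> A}"
      by (auto simp: space_pair_measure space_\<nu>)
    then show "emeasure \<nu> (Pair g -` ?B) = ennreal (mass A g)"
      by (simp add: mass_def \<nu>.emeasure_eq_measure)
  qed
  also have "\<dots> = ennreal (\<integral>g. mass A g \<partial>\<mu>)"
  proof (rule nn_integral_eq_integral)
    show "integrable \<mu> (mass A)"
      using mass_Pair_measurable[OF step_borel _ A]
      by (intro \<mu>.integrable_const_bound[of _ 1]) (auto simp: mass_nonneg mass_le_1 space_\<mu>)
  qed (simp add: mass_nonneg)
  finally show ?thesis
    by (simp add: \<nu>.emeasure_eq_measure integral_nonneg_AE mass_nonneg)
qed

text \<open>Stationarity is applied to the preimage of \<open>A\<close> under \<open>g\<close>,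
  which is what puts the new step to the right of \<open>g\<close>.\<close>

lemma mass_harmonic_step:
  assumes A: "A \<in> sets proj_borel" and g: "g \<in> SL"
  shows "mass A g = (\<integral>\<omega>. mass A (g ** walk 1 \<omega>) \<partial>S)"
proof -
  let ?A = "{L \<in> proj_space. (*v) g ` L \<in> A}"
  have "mass A g = (\<integral>h. mass ?A h \<partial>\<mu>)"
    using mass_stationary[OF action_sets[OF g A]] by (simp add: mass_def)
  also have "\<dots> = (\<integral>h. mass A (g ** h) \<partial>\<mu>)"
    by (intro Bochner_Integration.integral_cong refl) (simp add: mass_mult space_\<mu>)
  also have "\<dots> = (\<integral>h. mass A (g ** h) \<partial>(distr S \<mu> (\<lambda>\<omega>. \<omega> 0)))"
    using PiM_component[of 0] by simp
  also have "\<dots> = (\<integral>\<omega>. mass A (g ** \<omega> 0) \<partial>S)"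
  proof (rule integral_distr)
    have "(\<lambda>h. g ** h) \<in> borel_measurable \<mu>"
      by (intro borel_measurable_matrix_mult dense step_borel) simp
    then show "(\<lambda>h. mass A (g ** h)) \<in> borel_measurable \<mu>"
      using A g by (intro mass_Pair_measurable) (auto simp: space_\<mu> SL_mult)
  qed simp
  finally show ?thesis by simp
qed

lemma mass_harmonic:
  assumes A: "A \<in> sets proj_borel" and g: "g \<in> SL"
  shows "mass A g = (\<integral>\<omega>. mass A (g ** walk n \<omega>) \<partial>S)"
  using g
proof (induction n arbitrary: g)
  case 0
  then show ?case by (simp add: P.prob_space)
next
  case (Suc n)
  have "mass A g = (\<integral>\<omega>. mass A (g ** walk 1 \<omega>) \<partial>S)" by (rule mass_harmonic_step[OF A Suc.prems])
  also have "\<dots> = (\<integral>\<omega>. (\<integral>\<omega>'. mass A (g ** walk 1 \<omega> ** walk n \<omega>') \<partial>S) \<partial>S)"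
    by (intro Bochner_Integration.integral_cong refl Suc.IH SL_mult Suc.prems walk_SL)
  also have "\<dots> = (\<integral>\<omega>. (\<integral>\<omega>'. mass A (g ** walk (1 + n) (comb_seq 1 \<omega> \<omega>')) \<partial>S) \<partial>S)"
    by (simp only: walk_comb_seq matrix_mul_assoc)
  also have "\<dots> = (\<integral>\<omega>. mass A (g ** walk (1 + n) \<omega>) \<partial>S)"
    by (rule integral_comb_seq(1)[symmetric, OF mass_walk_integrable[OF A Suc.prems]])
  finally show ?case by simp
qed

text \<open>Doob's inequality for the nonnegative martingale
  \<open>mass A (g ** walk k \<omega>)\<close>, with the factor 2 coming from the level
  \<open>1 / 2\<close>. Induction over the first step replaces stopping times. The bound does not
  depend on \<open>n\<close>.\<close>

lemma maximal_inequality: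
  assumes A: "A \<in> sets proj_borel" and g: "g \<in> SL"
    and B: "\<And>k h. h \<in> SL \<Longrightarrow> {\<omega> \<in> space S. B (h ** walk k \<omega>)} \<in> sets S"
    and bad: "\<And>h. h \<in> SL \<Longrightarrow> B h \<Longrightarrow> 1 / 2 \<le> mass A h"
  shows "prob {\<omega> \<in> space S. \<exists>k\<le>n. B (g ** walk k \<omega>)} \<le> 2 * mass A g"
  using g
proof (induction n arbitrary: g)
  case 0
  show ?case
  proof (cases "B g")
    case True
    then show ?thesis using bad[OF 0] prob_le_1[of "{\<omega> \<in> space S. \<exists>k\<le>0. B (g ** walk k \<omega>)}"] by linarith
  qed (simp add: mass_nonneg)
next
  case (Suc n)
  let ?E = "\<lambda>n g. {\<omega> \<in> space S. \<exists>k\<le>n. B (g ** walk k \<omega>)}"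
  have E: "?E n h \<in> sets S" if "h \<in> SL" for n h
  proof -
    have "?E n h = (\<Union>k\<in>{..n}. {\<omega> \<in> space S. B (h ** walk k \<omega>)})" by auto
    then show ?thesis using B[OF that] by auto
  qed
  show ?case
  proof (cases "B g")
    case True
    then show ?thesis using bad[OF Suc.prems] prob_le_1[of "?E (Suc n) g"] by linarith
  next
    case False
    \<comment> \<open>As \<open>g\<close> itself is not bad, the index 0 can be discarded and the
      remaining indices shift by the first step.\<close>
    have iff: "(\<exists>k\<le>Suc n. B (g ** walk k (comb_seq 1 \<omega> \<omega>'))) \<longleftrightarrow> (\<exists>k\<le>n. B (g ** walk 1 \<omega> ** walk k \<omega>'))" for \<omega> \<omega>'
    proof -
      have "(\<exists>k\<le>Suc n. X k) \<longleftrightarrow> X 0 \<or> (\<exists>k\<le>n. X (1 + k))" for X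
        by (metis Suc_le_mono le0 not0_implies_Suc plus_1_eq_Suc)
      from this[of "\<lambda>k. B (g ** walk k (comb_seq 1 \<omega> \<omega>'))"] False
      have "(\<exists>k\<le>Suc n. B (g ** walk k (comb_seq 1 \<omega> \<omega>'))) \<longleftrightarrow> (\<exists>k\<le>n. B (g ** walk (1 + k) (comb_seq 1 \<omega> \<omega>')))"
        by (simp only: walk.simps(1) matrix_mul_rid simp_thms)
      then show ?thesis by (simp only: walk_comb_seq matrix_mul_assoc)
    qed
    have "prob (?E (Suc n) g) = (\<integral>\<omega>. prob (?E n (g ** walk 1 \<omega>)) \<partial>S)"
      using prob_comb_seq(1)[OF E[OF Suc.prems, of "Suc n"], of 1] unfolding iff .
    also have "\<dots> \<le> (\<integral>\<omega>. 2 * mass A (g ** walk 1 \<omega>) \<partial>S)"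
    proof (rule integral_mono)
      show "integrable S (\<lambda>\<omega>. prob (?E n (g ** walk 1 \<omega>)))"
        using prob_comb_seq(2)[OF E[OF Suc.prems, of "Suc n"], of 1] unfolding iff .
      show "integrable S (\<lambda>\<omega>. 2 * mass A (g ** walk 1 \<omega>))"
        by (intro integrable_mult_right mass_walk_integrable A Suc.prems)
    qed (intro Suc.IH SL_mult Suc.prems walk_SL)
    also have "\<dots> = 2 * mass A g" using mass_harmonic_step[OF A Suc.prems] by simp
    finally show ?thesis .
  qed
qed

end

section \<open>Null hyperplanes\<close>

text \<open>Every set of this form is a closed subspace and defines a measurable set of lines, and
  the form is preserved by intersections and by preimages under matrices. The subspaces of
  Furstenberg's argument are kept in it for that reason.\<close>

definition annihilator :: "('k::field ^ 'd) set \<Rightarrow> ('k ^ 'd) set" where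
  "annihilator F = {x. \<forall>f\<in>F. pairing f x = 0}"

lemma subspace_annihilator: "vec.subspace (annihilator F)"
  by (auto simp: vec.subspace_def annihilator_def pairing_add pairing_scale) (simp add: pairing_def)

lemma closed_annihilator: "closed (annihilator F :: ('k::absval_field ^ 'd) set)"
proof -
  have "closed {x :: 'k ^ 'd. pairing f x = 0}" for f
    by (intro closed_Collect_eq continuous_intros)
  then have "closed (\<Inter>f\<in>F. {x :: 'k ^ 'd. pairing f x = 0})" by blast
  also have "(\<Inter>f\<in>F. {x :: 'k ^ 'd. pairing f x = 0}) = annihilator F" by (auto simp: annihilator_def)
  finally show ?thesis .
qed

lemma annihilator_Int: "annihilator F \<inter> annihilator F' = annihilator (F \<union> F')"
  by (auto simp: annihilator_def)

lemma annihilator_vimage: "(*v) g -` annihilator F = annihilator ((\<lambda>f. f v* g) ` F)"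
  by (auto simp: annihilator_def pairing_matrix)

lemma annihilator_scale: "c \<noteq> 0 \<Longrightarrow> c *s x \<in> annihilator F \<longleftrightarrow> x \<in> annihilator F"
  by (auto simp: annihilator_def pairing_scale)

lemma SL_surj: "g \<in> SL \<Longrightarrow> surj ((*v) (g :: 'k::absval_field ^ 'd ^ 'd))"
  by (metis SL_inverse matrix_vector_mul_assoc matrix_vector_mul_lid surjI)

lemma SL_inj: "g \<in> SL \<Longrightarrow> inj ((*v) (g :: 'k::absval_field ^ 'd ^ 'd))"
  by (metis SL_inverse matrix_vector_mul_assoc matrix_vector_mul_lid inj_on_inverseI)

lemma SL_dim_vimage:
  assumes "g \<in> SL" shows "vec.dim ((*v) (g :: 'k::absval_field ^ 'd ^ 'd) -` E) = vec.dim E"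
proof -
  have "vec.dim ((*v) g ` ((*v) g -` E)) = vec.dim ((*v) g -` E)"
    by (intro vec.dim_image_eq matrix_vector_mul_linear_gen inj_on_subset[OF SL_inj[OF assms]]) simp
  then show ?thesis using SL_surj[OF assms] by (simp add: surj_image_vimage_eq)
qed

lemma closed_semigroup_subset:
  assumes "closedin (top_of_set SL) C" "\<And>g h. g \<in> C \<Longrightarrow> h \<in> C \<Longrightarrow> g ** h \<in> C" "supp \<mu> \<subseteq> C"
  shows "generated_closed_semigroup \<mu> \<subseteq> C"
  unfolding generated_closed_semigroup_def using assms by (intro Inter_lower) auto

context stationary_walk
begin

definition subspace_mass :: "('k ^ 'd) set \<Rightarrow> real" where
  "subspace_mass E = \<nu>.prob {L \<in> proj_space. rep L \<in> E}"

lemma annihilator_sets: "{L \<in> proj_space. rep L \<in> annihilator F} \<in> sets proj_borel"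
proof (rule proj_borel_closed)
  have "open (- {0} \<inter> - annihilator F)" using closed_annihilator by (intro open_Int) auto
  also have "- {0} \<inter> - annihilator F = {x. x \<noteq> 0 \<and> x \<notin> annihilator F}" by auto
  finally show "open {x. x \<noteq> 0 \<and> x \<notin> annihilator F}" .
qed (simp add: annihilator_scale)

lemma rep_action:
  assumes "(g :: 'k ^ 'd ^ 'd) \<in> SL" "L \<in> proj_space"
  obtains c where "c \<noteq> 0" "rep ((*v) g ` L) = c *s (g *v rep L)"
  using rep_line[OF SL_matrix_vector_nz[OF assms(1) rep_neq_0[OF assms(2)]]]
    matrix_image_line[of g "rep L"] line_rep[OF assms(2)] by metis

lemma action_proj_space:
  "(g :: 'k ^ 'd ^ 'd) \<in> SL \<Longrightarrow> L \<in> proj_space \<Longrightarrow> (*v) g ` L \<in> (proj_space :: ('k ^ 'd) set set)"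
  using line_in_proj_space[OF SL_matrix_vector_nz[OF _ rep_neq_0]] matrix_image_line[of g
    "rep L"] line_rep[of L] by metis

lemma subspace_mass_vimage:
  assumes "g \<in> SL"
  shows "subspace_mass ((*v) g -` annihilator F) = mass {L \<in> proj_space. rep L \<in> annihilator F} g"
proof -
  have "rep ((*v) g ` L) \<in> annihilator F \<longleftrightarrow> g *v rep L \<in> annihilator F" if "L \<in> proj_space" for L
    using rep_action[OF assms that] annihilator_scale by metis
  then have "{L \<in> proj_space. rep L \<in> (*v) g -` annihilator F}
      = {L \<in> proj_space. (*v) g ` L \<in> {L \<in> proj_space. rep L \<in> annihilator F}}"
    using action_proj_space[OF assms] by auto
  then show ?thesis by (simp only: subspace_mass_def mass_def)
qed

text \<open>
  Furstenberg's argument: the subspaces of minimal dimension with positive mass meet in null sets,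
  so finitely many of them have maximal mass, and these are permuted by the walk.
\<close>

lemma hyperplane_null:
  assumes irred: "strongly_irreducible (generated_closed_semigroup \<mu>)" and "f \<noteq> 0"
  shows "subspace_mass (annihilator {f}) = 0"
proof (rule ccontr)
  assume "subspace_mass (annihilator {f}) \<noteq> 0"
  then have pos: "0 < subspace_mass (annihilator {f})"
    by (simp add: subspace_mass_def zero_less_measure_iff)
  let ?P = "\<lambda>r (E :: ('k ^ 'd) set). E \<in> range annihilator \<and> E \<noteq> UNIV \<and> vec.dim E = r"
  have "annihilator {f} \<noteq> UNIV"
  proof
    assume "annihilator {f} = UNIV"
    then have "pairing f (axis i 1) = 0" for i by (auto simp: annihilator_def)
    then have "f $ i = 0" for i by (simp add: pairing_axis)
    then show False using \<open>f \<noteq> 0\<close> by (auto simp: vec_eq_iff)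
  qed
  then have "\<exists>r E. ?P r E \<and> 0 < subspace_mass E" using pos by blast
  then obtain r where r: "\<exists>E. ?P r E \<and> 0 < subspace_mass E"
    and minr: "\<And>r' E. r' < r \<Longrightarrow> ?P r' E \<Longrightarrow> \<not> 0 < subspace_mass E"
    using exists_least_iff[of "\<lambda>r. \<exists>E. ?P r E \<and> 0 < subspace_mass E"] by blast
  let ?A = "\<lambda>E :: ('k ^ 'd) set. {L \<in> proj_space. rep L \<in> E}"
  have A: "?A E \<in> sets \<nu>" if "E \<in> range annihilator" for E
    using that annihilator_sets by (auto simp: sets_\<nu>)
  define W0 where "W0 = Collect (?P r)"
  have null: "subspace_mass (E \<inter> E') = 0" if "E \<in> W0" "E' \<in> W0" "E \<noteq> E'" for E E'
  proof -
    have ann: "E \<in> range annihilator" "E' \<in> range annihilator" "E \<noteq> UNIV" "vec.dim E = r" "vec.dim E' = r"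
      using that by (auto simp: W0_def)
    then have sub: "vec.subspace E" "vec.subspace E'" using subspace_annihilator by auto
    have "E \<inter> E' \<in> range annihilator" using ann(1,2) annihilator_Int by blast
    moreover have "E \<inter> E' \<noteq> UNIV" using ann(3) by blast
    moreover have "vec.dim (E \<inter> E') < r"
    proof (rule ccontr)
      assume "\<not> vec.dim (E \<inter> E') < r"
      then have "E \<inter> E' = E" "E \<inter> E' = E'"
        using vec.subspace_dim_equal[OF vec.subspace_inter[OF sub]] sub ann(4,5) by (simp_all add: not_less)
      then show False using that(3) by blast
    qed
    ultimately have "\<not> 0 < subspace_mass (E \<inter> E')" using minr by blast
    then show ?thesis by (simp add: subspace_mass_def zero_less_measure_iff)
  qed
  have sum_le: "(\<Sum>E\<in>G. subspace_mass E) \<le> 1" if G: "finite G" "G \<subseteq> W0" for G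
  proof -
    have "(\<Sum>E\<in>G. subspace_mass E) = \<nu>.prob (\<Union>E\<in>G. ?A E)"
      unfolding subspace_mass_def
    proof (rule measure_UNION_AE[OF G(1), symmetric])
      show "?A E \<in> fmeasurable \<nu>" if "E \<in> G" for E
        using A[of E] that G(2) by (auto simp: W0_def \<nu>.fmeasurable_eq_sets)
      show "pairwise (\<lambda>E E'. AE L in \<nu>. L \<notin> ?A E \<or> L \<notin> ?A E') G"
      proof (rule pairwiseI)
        fix E E' assume E: "E \<in> G" "E' \<in> G" "E \<noteq> E'"
        have "?A E \<inter> ?A E' \<in> sets \<nu>" using A[of E] A[of E'] E G(2) by (auto simp: W0_def)
        moreover have "?A E \<inter> ?A E' = ?A (E \<inter> E')" by auto
        ultimately have "?A E \<inter> ?A E' \<in> null_sets \<nu>"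
          using null[of E E'] E G(2) by (auto simp: null_sets_def subspace_mass_def \<nu>.emeasure_eq_measure)
        from AE_not_in[OF this] show "AE L in \<nu>. L \<notin> ?A E \<or> L \<notin> ?A E'" by auto
      qed
    qed
    then show ?thesis by simp
  qed
  obtain E1 where E1: "E1 \<in> W0" "0 < subspace_mass E1" using r by (auto simp: W0_def)
  define m1 where "m1 = subspace_mass E1"
  \<comment> \<open>Masses of infinitely many subspaces might approach a supremum. Above the
    positive threshold \<open>m1\<close> only finitely many remain, so the maximum \<open>m0\<close>
    is attained, and it bounds the masses of all of \<open>W0\<close>.\<close>
  define W1 where "W1 = {E \<in> W0. m1 \<le> subspace_mass E}"
  have "finite W1"
  proof (rule ccontr)
    assume inf: "infinite W1"
    obtain n :: nat where n: "1 / m1 < real n" using reals_Archimedean2 by blast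
    obtain G where G: "finite G" "card G = n" "G \<subseteq> W1" using infinite_arbitrarily_large[OF inf] by blast
    have "real n * m1 \<le> (\<Sum>E\<in>G. subspace_mass E)"
      using sum_bounded_below[of G m1 subspace_mass] G by (auto simp: W1_def)
    also have "\<dots> \<le> 1" using G by (intro sum_le) (auto simp: W1_def)
    finally show False using n E1(2) by (simp add: m1_def field_simps)
  qed
  have "E1 \<in> W1" using E1 by (simp add: W1_def m1_def)
  define m0 where "m0 = Max (subspace_mass ` W1)"
  have m0: "m1 \<le> m0" "m0 \<in> subspace_mass ` W1"
    using \<open>finite W1\<close> \<open>E1 \<in> W1\<close> unfolding m0_def by (auto simp: m1_def intro: Max_ge Max_in)
  have le_m0: "subspace_mass E \<le> m0" if "E \<in> W0" for E
  proof (cases "m1 \<le> subspace_mass E")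
    case True
    then show ?thesis using that \<open>finite W1\<close> unfolding m0_def W1_def by (intro Max_ge) auto
  qed (use m0 in simp)
  define W where "W = {E \<in> W0. subspace_mass E = m0}"
  have "W \<subseteq> W1" using m0 by (auto simp: W_def W1_def)
  then have finW: "finite W" using \<open>finite W1\<close> finite_subset by blast
  have neW: "W \<noteq> {}" using m0(2) by (auto simp: W_def W1_def)
  have W0_vimage: "(*v) g -` E \<in> W0" if "g \<in> SL" "E \<in> W0" for g E
  proof -
    have "(*v) g -` E \<noteq> UNIV"
      using that SL_surj[OF that(1)] by (auto simp: W0_def) (metis UNIV_eq_I rangeE vimage_eq UNIV_I)
    then show ?thesis using that annihilator_vimage[of g] by (auto simp: W0_def SL_dim_vimage)
  qed
  have ae: "AE g in \<mu>. (*v) g -` E \<in> W" if "E \<in> W" for E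
  proof -
    obtain F where F: "E = annihilator F" using \<open>E \<in> W\<close> by (auto simp: W_def W0_def)
    have le: "mass (?A E) g \<le> m0" if "g \<in> SL" for g
    proof -
      have "E \<in> W0" using \<open>E \<in> W\<close> by (simp add: W_def)
      from le_m0[OF W0_vimage[OF that this]] show ?thesis
        unfolding F subspace_mass_vimage[OF that] .
    qed
    have int: "integrable \<mu> (mass (?A E))"
      using mass_Pair_measurable[OF step_borel _ annihilator_sets[of F]]
      by (intro \<mu>.integrable_const_bound[of _ 1]) (auto simp: mass_nonneg mass_le_1 space_\<mu> F)
    \<comment> \<open>The integrand is nonnegative by \<open>le\<close>, and by stationarity its
      mean is 0, so it vanishes almost everywhere.\<close>
    have "(\<integral>g. m0 - mass (?A E) g \<partial>\<mu>) = m0 - (\<integral>g. mass (?A E) g \<partial>\<mu>)"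
      using int by (simp add: \<mu>.prob_space)
    also have "\<dots> = 0"
      using mass_stationary[OF annihilator_sets[of F]] \<open>E \<in> W\<close> by (simp add: W_def subspace_mass_def F)
    finally have "AE g in \<mu>. m0 - mass (?A E) g = 0"
      using int le by (subst (asm) integral_nonneg_eq_0_iff_AE) (auto simp: space_\<mu>)
    then show ?thesis
    proof (rule AE_mp, intro AE_I2 impI)
      fix g assume g: "g \<in> space \<mu>" "m0 - mass (?A E) g = 0"
      then show "(*v) g -` E \<in> W"
        using subspace_mass_vimage[of g F] W0_vimage[of g E] \<open>E \<in> W\<close> F by (simp add: W_def space_\<mu>)
    qed
  qed
  let ?C = "{g \<in> SL. (*v) g ` \<Union>W \<subseteq> \<Union>W}"
  have "AE g in \<mu>. \<forall>E\<in>W. (*v) g -` E \<in> W" using ae finW by (intro AE_finite_allI) auto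
  then have aeC: "AE g in \<mu>. g \<in> ?C"
  proof (rule AE_mp, intro AE_I2 impI)
    fix g assume g: "g \<in> space \<mu>" and W: "\<forall>E\<in>W. (*v) g -` E \<in> W"
    \<comment> \<open>Taking preimages under the surjective \<open>g\<close> is injective on sets
      and so permutes the finite family \<open>W\<close>. Each member of \<open>W\<close> is then
      the preimage of another member, which is to say that \<open>g\<close> maps it into that
      member.\<close>
    have "inj_on (\<lambda>E. (*v) g -` E) W"
      using SL_surj[of g] g by (intro inj_onI) (metis space_\<mu> surj_image_vimage_eq)
    then have "(\<lambda>E. (*v) g -` E) ` W = W" using W finW by (intro endo_inj_surj) auto
    then have "(*v) g ` \<Union>W \<subseteq> \<Union>W" by blast
    then show "g \<in> ?C" using g by (simp add: space_\<mu>)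
  qed
  \<comment> \<open>Almost every \<open>g\<close> preserves the union. As \<open>T\<close> is
    closed, a point of the support outside \<open>T\<close> would have a neighbourhood that is a
    null set.\<close>
  define T where "T = {g :: 'k ^ 'd ^ 'd. \<forall>x\<in>\<Union>W. g *v x \<in> \<Union>W}"
  have CT: "?C = SL \<inter> T" by (auto simp: T_def)
  have "closed (\<Union>W)"
    using finW closed_annihilator by (intro closed_Union) (auto simp: W_def W0_def)
  then have "closed ((\<lambda>g :: 'k ^ 'd ^ 'd. g *v x) -` \<Union>W)" for x :: "'k ^ 'd"
    by (rule closed_vimage) (intro continuous_intros)
  then have "closed (\<Inter>x\<in>\<Union>W. (\<lambda>g :: 'k ^ 'd ^ 'd. g *v x) -` \<Union>W)" by (intro closed_INT) auto
  also have "(\<Inter>x\<in>\<Union>W. (\<lambda>g :: 'k ^ 'd ^ 'd. g *v x) -` \<Union>W) = T" by (auto simp: T_def)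
  finally have clT: "closed T" .
  have sub: "generated_closed_semigroup \<mu> \<subseteq> ?C"
  proof (rule closed_semigroup_subset)
    show "closedin (top_of_set SL) ?C" unfolding CT using clT by (simp add: closedin_closed_Int)
    show "g ** h \<in> ?C" if "g \<in> ?C" "h \<in> ?C" for g h
      using that by (auto simp: SL_mult image_matrix_mult) (metis image_subset_iff matrix_vector_mul_assoc
          UnionI UnionE)
    show "supp \<mu> \<subseteq> ?C"
    proof
      fix g assume g: "g \<in> supp \<mu>"
      show "g \<in> ?C"
      proof (rule ccontr)
        assume "g \<notin> ?C"
        then have "0 < emeasure \<mu> (- T \<inter> SL)" using g clT CT by (auto simp: supp_def)
        moreover have "AE h in \<mu>. h \<notin> - T \<inter> SL" using aeC CT by auto
        moreover have "- T \<inter> SL \<in> sets \<mu>"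
          unfolding sets_\<mu> sets_restrict_space using clT by (intro image_eqI[of _ _ "- T"]) auto
        ultimately have "- T \<inter> SL \<in> null_sets \<mu>" using AE_iff_null_sets by blast
        then show False using \<open>0 < emeasure \<mu> (- T \<inter> SL)\<close> by (auto simp: null_sets_def)
      qed
    qed
  qed
  have inv: "(*v) g ` \<Union>W \<subseteq> \<Union>W" if "g \<in> generated_closed_semigroup \<mu>" for g
    using CollectD[OF subsetD[OF sub that]] by (rule conjunct2)
  have "vec.subspace E \<and> E \<noteq> {0} \<and> E \<noteq> UNIV" if "E \<in> W" for E
  proof -
    have "0 < subspace_mass E" using that m0(1) E1(2) by (simp add: W_def m1_def)
    moreover have "{L \<in> proj_space. rep L \<in> {0 :: 'k ^ 'd}} = {}" using rep_neq_0 by auto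
    then have "subspace_mass {0} = 0" by (simp only: subspace_mass_def measure_empty)
    ultimately have "E \<noteq> {0}" by auto
    then show ?thesis using that subspace_annihilator by (auto simp: W_def W0_def)
  qed
  then have conj: "finite W \<and> W \<noteq> {} \<and> (\<forall>E\<in>W. vec.subspace E \<and> E \<noteq> {0} \<and> E \<noteq> UNIV)
      \<and> (\<forall>g\<in>generated_closed_semigroup \<mu>. (*v) g ` \<Union>W \<subseteq> \<Union>W)"
    by (intro conjI finW neW inv ballI) simp_all
  show False by (rule notE[OF irred[unfolded strongly_irreducible_def]], rule exI, rule conj)
qed

end

section \<open>Uniform concentration near hyperplanes\<close>

lemma bounded_vectors_subconverge:
  fixes x :: "nat \<Rightarrow> 'k::absval_field ^ 'd"
  assumes "bounded_seqs_subconverge (UNIV :: 'k set)" "\<And>n i. absval (x n $ i) \<le> R"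
  shows "\<exists>l r. strict_mono (r :: nat \<Rightarrow> nat) \<and> (\<lambda>n. x (r n)) \<longlonglongrightarrow> l"
proof -
  obtain l r where r: "strict_mono (r :: nat \<Rightarrow> nat)" "\<forall>i\<in>UNIV. (\<lambda>n. x (r n) $ i) \<longlonglongrightarrow> l i"
    using finite_family_subconverge[OF assms(1), of UNIV "\<lambda>n i. x n $ i" R] assms(2) by auto
  then have "(\<lambda>n. x (r n)) \<longlonglongrightarrow> (\<chi> i. l i)"
    by (intro vec_tendstoI) simp
  with r(1) show ?thesis by blast
qed

context stationary_walk
begin

definition near :: "'k ^ 'd \<Rightarrow> real \<Rightarrow> ('k ^ 'd) set set" where
  "near f \<epsilon> = {L \<in> proj_space. absval (pairing f (rep L)) \<le> \<epsilon> * vnorm f * vnorm (rep L)}"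

lemma near_iff_scale:
  assumes "c \<noteq> 0"
  shows "absval (pairing f (c *s x)) \<le> \<epsilon> * vnorm f * vnorm (c *s x) \<longleftrightarrow> absval (pairing f x)
      \<le> \<epsilon> * vnorm f * vnorm (x :: 'k ^ 'd)"
proof -
  have "0 < absval c" using assms absval_nonneg[of c] absval_eq_0_iff[of c] by linarith
  moreover have "\<epsilon> * vnorm f * (absval c * vnorm x) = absval c * (\<epsilon> * vnorm f * vnorm x)" by simp
  ultimately show ?thesis
    by (simp only: pairing_scale absval_mult vnorm_scale mult_le_cancel_left_pos)
qed

lemma near_sets: "near f \<epsilon> \<in> sets proj_borel"
  unfolding near_def
proof (rule proj_borel_closed)
  have "open (- {0} \<inter> {x. \<epsilon> * vnorm f * vnorm x < absval (pairing f x)})"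
    by (intro open_Int open_Collect_less continuous_intros) 
  also have "- {0} \<inter> {x. \<epsilon> * vnorm f * vnorm x < absval (pairing f x)}
      = {x. x \<noteq> 0 \<and> \<not> absval (pairing f x) \<le> \<epsilon> * vnorm f * vnorm x}" by auto
  finally show "open {x. x \<noteq> 0 \<and> \<not> absval (pairing f x) \<le> \<epsilon> * vnorm f * vnorm x}" .
qed (rule near_iff_scale)

lemma near_mono: "\<epsilon> \<le> \<epsilon>' \<Longrightarrow> near f \<epsilon> \<subseteq> near f \<epsilon>'"
  unfolding near_def by (blast intro: order_trans mult_right_mono vnorm_nonneg)

lemma prob_near_mono: "\<epsilon> \<le> \<epsilon>' \<Longrightarrow> \<nu>.prob (near f \<epsilon>) \<le> \<nu>.prob (near f \<epsilon>')"
  using near_sets by (intro \<nu>.finite_measure_mono near_mono) (auto simp: sets_\<nu>)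

lemma action_near_iff:
  assumes "g \<in> SL" "L \<in> proj_space"
  shows "(*v) g ` L \<in> near f \<epsilon> \<longleftrightarrow> absval (pairing f (g *v rep L)) \<le> \<epsilon> * vnorm f * vnorm (g *v rep L)"
proof -
  obtain c where c: "c \<noteq> 0" "rep ((*v) g ` L) = c *s (g *v rep L)" using rep_action[OF assms] .
  then show ?thesis
    using action_proj_space[OF assms] near_iff_scale[OF c(1), of f "g *v rep L" \<epsilon>] by (simp add: near_def)
qed

lemma mass_near: "g \<in> SL \<Longrightarrow> mass (near f \<epsilon>) g
    = \<nu>.prob {L \<in> proj_space. absval (pairing f (g *v rep L)) \<le> \<epsilon> * vnorm f * vnorm (g *v rep L)}"
  unfolding mass_def by (intro arg_cong[of _ _ \<nu>.prob]) (auto simp: action_near_iff)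

lemma mass_near_one: "mass (near f \<epsilon>) (mat 1) = \<nu>.prob (near f \<epsilon>)"
  unfolding mass_near[OF SL_one] by (simp add: near_def)

end

locale irreducible_walk = stationary_walk \<mu> \<nu>
  for \<mu> :: "('k::absval_field ^ 'd ^ 'd) measure" and \<nu> :: "('k ^ 'd) set measure" +
  assumes compact: "bounded_seqs_subconverge (UNIV :: 'k set)"
    and irreducible: "strongly_irreducible (generated_closed_semigroup \<mu>)"
begin

text \<open>Dini's argument on the compact set of directions: if normalised covectors with heavy
  neighbourhoods of shrinking radius existed, every neighbourhood of the kernel of a limit point
  \<open>l\<close> would be heavy as well, although these decrease to a hyperplane of mass
  0.\<close>

lemma hyperplane_concentration:
  assumes "0 < \<eta>"
  shows "\<exists>\<epsilon>>0. \<forall>f. f \<noteq> 0 \<longrightarrow> \<nu>.prob (near f \<epsilon>) \<le> \<eta>"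
proof (rule ccontr)
  assume contra: "\<not> (\<exists>\<epsilon>>0. \<forall>f. f \<noteq> 0 \<longrightarrow> \<nu>.prob (near f \<epsilon>) \<le> \<eta>)"
  have "\<exists>f. f \<noteq> 0 \<and> \<eta> < \<nu>.prob (near f (inverse (real (Suc n))))" for n
    using contra by (metis inverse_positive_iff_positive not_le of_nat_0_less_iff zero_less_Suc)
  then obtain f0 where f0: "\<And>n. f0 n \<noteq> 0" "\<And>n. \<eta> < \<nu>.prob (near (f0 n) (inverse (real (Suc n))))" by metis
  have "\<exists>i. vnorm (f0 n) \<le> real CARD('d) * absval (f0 n $ i)" for n by (rule exists_large_entry)
  then obtain i where i: "\<And>n. vnorm (f0 n) \<le> real CARD('d) * absval (f0 n $ i n)" by metis
  have i0: "f0 n $ i n \<noteq> 0" for n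
    using i[of n] vnorm_pos[OF f0(1)[of n]] by (auto simp: absval_zero)
  \<comment> \<open>A norm need not be the absolute value of a scalar, so the normalisation divides
    by a largest entry. The entry 1 that results keeps the limit away from 0.\<close>
  define f where "f n = inverse (f0 n $ i n) *s f0 n" for n
  have fi: "f n $ i n = 1" for n using i0 by (simp add: f_def)
  have vf: "vnorm (f n) \<le> real CARD('d)" for n
  proof -
    have "0 < absval (f0 n $ i n)" using i0[of n] absval_nonneg absval_eq_0_iff by (metis less_eq_real_def)
    moreover have "vnorm (f n) = vnorm (f0 n) / absval (f0 n $ i n)"
      by (simp only: f_def vnorm_scale absval_inverse divide_inverse mult.commute)
    ultimately show ?thesis using i[of n] by (simp add: pos_divide_le_eq)
  qed
  have near_f: "near (f n) \<epsilon> = near (f0 n) \<epsilon>" for n \<epsilon>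
  proof -
    have a: "0 < absval (inverse (f0 n $ i n))"
      using i0[of n] absval_nonneg absval_eq_0_iff by (metis less_eq_real_def nonzero_imp_inverse_nonzero)
    have "pairing (f n) x = inverse (f0 n $ i n) * pairing (f0 n) x" for x
      by (simp add: f_def pairing_def sum_distrib_left mult.assoc)
    then have "absval (pairing (f n) x) \<le> \<epsilon> * vnorm (f n) * vnorm x
        \<longleftrightarrow> absval (inverse (f0 n $ i n)) * absval (pairing (f0 n) x)
        \<le> absval (inverse (f0 n $ i n)) * (\<epsilon> * vnorm (f0 n) * vnorm x)" for x
      by (simp only: f_def vnorm_scale absval_mult mult_ac)
    then have "absval (pairing (f n) x) \<le> \<epsilon> * vnorm (f n) * vnorm x \<longleftrightarrow> absval (pairing (f0 n) x)
        \<le> \<epsilon> * vnorm (f0 n) * vnorm x" for x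
      by (simp only: mult_le_cancel_left_pos[OF a])
    then show ?thesis by (simp only: near_def)
  qed
  have "absval (f n $ j) \<le> real CARD('d)" for n j using absval_le_vnorm vf order_trans by blast
  then obtain l r where r: "strict_mono (r :: nat \<Rightarrow> nat)" "(\<lambda>n. f (r n)) \<longlonglongrightarrow> l"
    using bounded_vectors_subconverge[OF compact, of f] by blast
  have "l \<noteq> 0"
  proof
    assume "l = 0"
    have "(\<lambda>n. vnorm (f (r n))) \<longlonglongrightarrow> vnorm l"
      unfolding vnorm_def by (intro tendsto_intros r(2))
    moreover have "1 \<le> vnorm (f (r n))" for n
      using absval_le_vnorm[of "f (r n)" "i (r n)"] fi by (simp add: absval_one)
    ultimately have "1 \<le> vnorm l" by (meson LIMSEQ_le_const)
    then show False using \<open>l = 0\<close> vnorm_eq_0_iff[of l] by simp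
  qed
  have big: "\<eta> \<le> \<nu>.prob (near l (inverse (real (Suc m))))" for m
  proof -
    let ?e = "inverse (real (Suc m)) * vnorm l"
    have e: "0 < ?e" using vnorm_pos[OF \<open>l \<noteq> 0\<close>] by simp
    have "(\<lambda>n. vnorm (f (r n) - l) + real CARD('d) * inverse (real (Suc (r n)))) \<longlonglongrightarrow> vnorm (l - l) + real CARD('d)
        * 0"
      unfolding vnorm_def vector_minus_component
      by (intro tendsto_intros r(2) LIMSEQ_subseq_LIMSEQ[OF LIMSEQ_inverse_real_of_nat r(1), unfolded o_def])
    then have "(\<lambda>n. vnorm (f (r n) - l) + real CARD('d) * inverse (real (Suc (r n)))) \<longlonglongrightarrow> 0"
      using vnorm_eq_0_iff[of "0 :: 'k ^ 'd"] by simp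
    from order_tendstoD(2)[OF this e]
    obtain n where n: "vnorm (f (r n) - l) + real CARD('d) * inverse (real (Suc (r n))) < ?e"
      by (auto simp: eventually_sequentially)
    have "near (f (r n)) (inverse (real (Suc (r n)))) \<subseteq> near l (inverse (real (Suc m)))"
    proof
      fix L assume "L \<in> near (f (r n)) (inverse (real (Suc (r n))))"
      then have L: "L \<in> proj_space" and
        le: "absval (pairing (f (r n)) (rep L)) \<le> inverse (real (Suc (r n))) * vnorm (f (r n)) * vnorm (rep L)"
        by (auto simp: near_def)
      have "pairing l (rep L) = pairing (f (r n)) (rep L) - pairing (f (r n) - l) (rep L)"
        by (simp add: pairing_def left_diff_distrib sum_subtractf)
      then have "absval (pairing l (rep L))
          \<le> absval (pairing (f (r n)) (rep L)) + absval (pairing (f (r n) - l) (rep L))"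
        by (simp add: absval_diff_le)
      also have "\<dots>
          \<le> inverse (real (Suc (r n))) * real CARD('d) * vnorm (rep L) + vnorm (f (r n) - l) * vnorm (rep L)"
      proof (intro add_mono absval_pairing_le order_trans[OF le])
        show "inverse (real (Suc (r n))) * vnorm (f (r n)) * vnorm (rep L)
            \<le> inverse (real (Suc (r n))) * real CARD('d) * vnorm (rep L)"
          by (intro mult_right_mono mult_left_mono vf vnorm_nonneg) simp
      qed
      also have "\<dots> = (vnorm (f (r n) - l) + real CARD('d) * inverse (real (Suc (r n)))) * vnorm (rep L)"
        by (simp add: algebra_simps)
      also have "\<dots> \<le> ?e * vnorm (rep L)"
        using n by (intro mult_right_mono vnorm_nonneg) simp
      finally show "L \<in> near l (inverse (real (Suc m)))" using L by (simp add: near_def)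
    qed
    then have "\<nu>.prob (near (f (r n)) (inverse (real (Suc (r n))))) \<le> \<nu>.prob (near l (inverse (real (Suc m))))"
      using near_sets by (intro \<nu>.finite_measure_mono) (auto simp: sets_\<nu>)
    then show ?thesis using f0(2)[of "r n"] near_f by simp
  qed
  have "(\<lambda>m. \<nu>.prob (near l (inverse (real (Suc m))))) \<longlonglongrightarrow> \<nu>.prob (\<Inter>m. near l (inverse (real (Suc m))))"
  proof (rule \<nu>.finite_Lim_measure_decseq)
    show "range (\<lambda>m. near l (inverse (real (Suc m)))) \<subseteq> \<nu>.events" using near_sets by (auto simp: sets_\<nu>)
    show "decseq (\<lambda>m. near l (inverse (real (Suc m))))"
      by (intro decseq_SucI near_mono) (simp add: field_simps)
  qed
  moreover have "(\<Inter>m. near l (inverse (real (Suc m)))) = {L \<in> proj_space. rep L \<in> annihilator {l}}"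
  proof (intro equalityI subsetI)
    fix L assume L: "L \<in> (\<Inter>m. near l (inverse (real (Suc m))))"
    then have le: "absval (pairing l (rep L)) \<le> inverse (real (Suc m)) * (vnorm l * vnorm (rep L))" for m
      by (auto simp: near_def mult.assoc)
    have "(\<lambda>m. inverse (real (Suc m)) * (vnorm l * vnorm (rep L))) \<longlonglongrightarrow> 0 * (vnorm l * vnorm (rep L))"
      by (intro tendsto_intros LIMSEQ_inverse_real_of_nat)
    then have "absval (pairing l (rep L)) \<le> 0"
      using le by (intro LIMSEQ_le_const[of _ 0]) auto
    then have "pairing l (rep L) = 0" using absval_nonneg absval_eq_0_iff by (metis order_antisym)
    then show "L \<in> {L \<in> proj_space. rep L \<in> annihilator {l}}" using L by (auto simp: near_def annihilator_def)
  qed (auto simp: near_def annihilator_def absval_zero vnorm_nonneg)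
  ultimately have "(\<lambda>m. \<nu>.prob (near l (inverse (real (Suc m))))) \<longlonglongrightarrow> 0"
    using hyperplane_null[OF irreducible \<open>l \<noteq> 0\<close>] by (simp add: subspace_mass_def)
  then have "\<eta> \<le> 0" by (rule LIMSEQ_le_const) (use big in auto)
  then show False using \<open>0 < \<eta>\<close> by simp
qed

text \<open>
  If \<open>g\<close> shrinks the covector \<open>f\<close> much more than its norm, then it maps a large part of the
  projective space close to \<open>ker f\<close>.
\<close>

lemma mass_near_large:
  obtains c where "0 < c"
    "\<And>f g \<epsilon>. g \<in> SL \<Longrightarrow> 0 \<le> \<epsilon> \<Longrightarrow> vnorm (f v* g) \<le> \<epsilon> * c * vnorm f * mnorm g \<Longrightarrow> 1 / 2 \<le> mass (near f \<epsilon>) g"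
proof -
  obtain \<epsilon>1 where \<epsilon>1: "0 < \<epsilon>1" "\<And>f. f \<noteq> 0 \<Longrightarrow> \<nu>.prob (near f \<epsilon>1) \<le> 1 / 2"
    using hyperplane_concentration[of "1 / 2"] by auto
  let ?d = "real CARD('d)"
  show thesis
  proof (rule that[of "\<epsilon>1 / ?d"])
    show "0 < \<epsilon>1 / ?d" using \<epsilon>1 by simp
    fix f and g :: "'k ^ 'd ^ 'd" and \<epsilon> :: real
    assume g: "g \<in> SL" and \<epsilon>: "0 \<le> \<epsilon>" and le: "vnorm (f v* g) \<le> \<epsilon> * (\<epsilon>1 / ?d) * vnorm f * mnorm g"
    \<comment> \<open>A line that is not near the kernel of the largest row of \<open>g\<close> is
      stretched by at least \<open>\<epsilon>1 / d\<close> times \<open>mnorm g\<close>. Such lines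
      carry at least half of the mass, and for them \<open>f\<close> is small on
      \<open>g *v rep L\<close>.\<close>
    obtain i where i: "mnorm g \<le> ?d * vnorm (g $ i)" using exists_large_row by blast
    have gi: "g $ i \<noteq> 0" using i SL_mnorm_pos[OF g] by (auto simp: vnorm_eq_0_iff[THEN iffD2])
    have "proj_space - near (g $ i) \<epsilon>1
        \<subseteq> {L \<in> proj_space. absval (pairing f (g *v rep L)) \<le> \<epsilon> * vnorm f * vnorm (g *v rep L)}"
    proof safe
      fix L assume L: "L \<in> proj_space" "L \<notin> near (g $ i) \<epsilon>1"
      have "\<epsilon>1 / ?d * mnorm g * vnorm (rep L) \<le> \<epsilon>1 / ?d * (?d * vnorm (g $ i)) * vnorm (rep L)"
        using \<epsilon>1 by (intro mult_right_mono mult_left_mono i vnorm_nonneg) auto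
      also have "\<dots> < absval (pairing (g $ i) (rep L))" using L by (simp add: near_def)
      also have "\<dots> \<le> vnorm (g *v rep L)"
        using absval_le_vnorm[of "g *v rep L" i] by (simp add: matrix_vector_nth)
      finally have *: "\<epsilon>1 / ?d * mnorm g * vnorm (rep L) \<le> vnorm (g *v rep L)" by simp
      have "absval (pairing f (g *v rep L)) \<le> vnorm (f v* g) * vnorm (rep L)"
        unfolding pairing_matrix by (rule absval_pairing_le)
      also have "\<dots> \<le> (\<epsilon> * (\<epsilon>1 / ?d) * vnorm f * mnorm g) * vnorm (rep L)"
        by (intro mult_right_mono le vnorm_nonneg)
      also have "\<dots> = \<epsilon> * vnorm f * (\<epsilon>1 / ?d * mnorm g * vnorm (rep L))" by simp
      also have "\<dots> \<le> \<epsilon> * vnorm f * vnorm (g *v rep L)"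
        using \<epsilon> by (intro mult_left_mono * mult_nonneg_nonneg vnorm_nonneg)
      finally show "absval (pairing f (g *v rep L)) \<le> \<epsilon> * vnorm f * vnorm (g *v rep L)" .
    qed
    moreover have
      "{L \<in> proj_space. absval (pairing f (g *v rep L)) \<le> \<epsilon> * vnorm f * vnorm (g *v rep L)} \<in> sets \<nu>"
      using action_sets[OF g near_sets[of f \<epsilon>]] unfolding sets_\<nu>
      by (rule back_subst[of "\<lambda>A. A \<in> sets proj_borel"]) (auto simp: action_near_iff[OF g])
    ultimately have "\<nu>.prob (proj_space - near (g $ i) \<epsilon>1) \<le> mass (near f \<epsilon>) g"
      unfolding mass_near[OF g] by (rule \<nu>.finite_measure_mono)
    moreover have "\<nu>.prob (proj_space - near (g $ i) \<epsilon>1) = 1 - \<nu>.prob (near (g $ i) \<epsilon>1)"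
      using \<nu>.prob_compl[of "near (g $ i) \<epsilon>1"] near_sets by (simp add: sets_\<nu> space_\<nu>)
    ultimately show "1 / 2 \<le> mass (near f \<epsilon>) g" using \<epsilon>1(2)[OF gi] by simp
  qed
qed

lemma covector_shrinking_measurable:
  "{\<omega> \<in> space S. vnorm (f v* (h ** walk k \<omega>)) \<le> \<theta> * vnorm f * mnorm (h ** walk k \<omega>)} \<in> sets S"
proof -
  have "(\<lambda>\<omega>. vnorm (f v* (h ** walk k \<omega>))) \<in> borel_measurable S"
    "(\<lambda>\<omega>. \<theta> * vnorm f * mnorm (h ** walk k \<omega>)) \<in> borel_measurable S"
    by (intro continuous_walk_borel[of "\<lambda>g. vnorm (f v* (h ** g))"] continuous_intros)
      (intro continuous_walk_borel[of "\<lambda>g. \<theta> * vnorm f * mnorm (h ** g)"] continuous_intros)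
  then show ?thesis by measurable
qed

text \<open>By \<open>mass_near_large\<close>, a shrinking of \<open>f\<close> at any time means
  that the harmonic function \<open>mass (near f \<epsilon>)\<close> has reached
  \<open>1 / 2\<close>, whereas it starts from at most \<open>\<eta> / 2\<close>. The maximal
  inequality makes this unlikely, uniformly in \<open>f\<close> and in the number of steps.\<close>

lemma covector_shrinking:
  assumes "0 < \<eta>"
  obtains \<theta> where "0 < \<theta>" "\<And>f n. f \<noteq> 0 \<Longrightarrow>
    prob {\<omega> \<in> space S. \<exists>k\<le>n. vnorm (f v* walk k \<omega>) \<le> \<theta> * vnorm f * mnorm (walk k \<omega>)} \<le> \<eta>"
proof -
  obtain c where c: "0 < c"
    "\<And>f g \<epsilon>. g \<in> SL \<Longrightarrow> 0 \<le> \<epsilon> \<Longrightarrow> vnorm (f v* g) \<le> \<epsilon> * c * vnorm f * mnorm g \<Longrightarrow> 1 / 2 \<le> mass (near f \<epsilon>) g"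
    using mass_near_large by blast
  obtain \<epsilon> where \<epsilon>: "0 < \<epsilon>" "\<And>f. f \<noteq> 0 \<Longrightarrow> \<nu>.prob (near f \<epsilon>) \<le> \<eta> / 2"
    using hyperplane_concentration[of "\<eta> / 2"] assms by auto
  show thesis
  proof (rule that[of "\<epsilon> * c"])
    show "0 < \<epsilon> * c" using \<epsilon> c by simp
    fix f :: "'k ^ 'd" and n assume "f \<noteq> 0"
    have "prob {\<omega> \<in> space S. \<exists>k\<le>n. vnorm (f v* (mat 1 ** walk k \<omega>))
        \<le> \<epsilon> * c * vnorm f * mnorm (mat 1 ** walk k \<omega>)}
        \<le> 2 * mass (near f \<epsilon>) (mat 1)"
      using \<epsilon>(1) c(2)
      by (intro maximal_inequality[of _ _ "\<lambda>h. vnorm (f v* h) \<le> \<epsilon> * c * vnorm f * mnorm h"]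
          near_sets SL_one covector_shrinking_measurable) auto
    then show "prob {\<omega> \<in> space S. \<exists>k\<le>n. vnorm (f v* walk k \<omega>) \<le> \<epsilon> * c * vnorm f * mnorm (walk k \<omega>)} \<le> \<eta>"
      using \<epsilon>(2)[OF \<open>f \<noteq> 0\<close>] by (simp add: mass_near_one)
  qed
qed

end

section \<open>Contraction in probability\<close>

lemma generated_closed_semigroup_mult:
  "g \<in> generated_closed_semigroup \<mu> \<Longrightarrow> h \<in> generated_closed_semigroup \<mu> \<Longrightarrow> g ** h \<in> generated_closed_semigroup \<mu>"
  unfolding generated_closed_semigroup_def by blast

lemma generated_closed_semigroup_SL: "generated_closed_semigroup \<mu> \<subseteq> SL"
  by (rule closed_semigroup_subset) (auto simp: SL_mult supp_def)

lemma rank_one_decomposition: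
  fixes B :: "'k::field ^ 'd ^ 'd"
  assumes "rank B = 1"
  obtains u v where "u \<noteq> 0" "v \<noteq> 0" "\<And>i. B $ i = u $ i *s v"
proof -
  have "vec.dim (rows B) = 1" using assms by (simp add: row_rank_def_gen)
  then obtain Bs where Bs: "Bs \<subseteq> rows B" "vec.independent Bs" "rows B \<subseteq> vec.span Bs" "card Bs = 1"
    using vec.basis_exists[of "rows B"] by metis
  then obtain v where v: "Bs = {v}" by (auto simp: card_1_singleton_iff)
  have "v \<noteq> 0" using Bs(2) v vec.dependent_zero by auto
  have "\<exists>c. B $ i = c *s v" for i
  proof -
    have "B $ i \<in> rows B" by (auto simp: rows_def row_def vec_eq_iff)
    then show ?thesis using Bs(3) v by (auto simp: vec.span_singleton)
  qed
  then obtain c where c: "\<And>i. B $ i = c i *s v" by metis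
  obtain j where "v = B $ j" using Bs(1) v by (auto simp: rows_def row_def vec_lambda_eta)
  then have "c j \<noteq> 0" using c[of j] \<open>v \<noteq> 0\<close> by auto
  show thesis
  proof (rule that[of "\<chi> i. c i" v])
    show "(\<chi> i. c i) \<noteq> 0" using \<open>c j \<noteq> 0\<close> by (auto simp: vec_eq_iff)
  qed (use \<open>v \<noteq> 0\<close> c in auto)
qed

lemma vector_matrix_rank_one:
  assumes "\<And>i. B $ i = u $ i *s v"
  shows "f v* B = pairing f u *s (v :: 'k::field ^ 'd)"
  by (simp add: vec_eq_iff vector_matrix_nth assms pairing_def sum_distrib_right mult.assoc)

lemma minors_rank_one:
  assumes "\<And>i. B $ i = u $ i *s v" shows "minors (B :: 'k::absval_field ^ 'd ^ 'd) = 0"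
proof -
  have "wedge (B $ i) (B $ j) = 0" for i j by (simp add: wedge_def assms vec_eq_iff)
  then show ?thesis by (simp add: minors_def mnorm_eq_0_iff)
qed

lemma matrix_mult_scale_mat: "h ** scale_mat r g = scale_mat r (h ** (g :: 'k::field ^ 'd ^ 'd))"
  by (simp add: scale_mat_def matrix_matrix_mult_def vec_eq_iff sum_distrib_left mult.left_commute)

lemma mnorm_scale_mat: "mnorm (scale_mat r g) = absval r * mnorm g"
  by (simp add: mnorm_def vnorm_def scale_mat_def absval_mult sum_distrib_left)

lemma minors_scale_mat: "minors (scale_mat r g) = (absval r)\<^sup>2 * minors g"
proof -
  have "wedge (scale_mat r g $ i) (scale_mat r g $ j) = scale_mat (r * r) (wedge (g $ i) (g $ j))" for i j
    by (simp add: wedge_def scale_mat_def vec_eq_iff algebra_simps)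
  then show ?thesis
    by (simp add: minors_def mnorm_scale_mat absval_mult sum_distrib_left power2_eq_square)
qed

lemma continuous_on_scale_mat [continuous_intros]:
  "continuous_on A f \<Longrightarrow> continuous_on A (\<lambda>x. scale_mat r (f x :: 'k::absval_field ^ 'd ^ 'd))"
  unfolding scale_mat_def by (intro continuous_intros)

lemma continuous_on_mnorm_diff [continuous_intros]:
  "continuous_on A f \<Longrightarrow> continuous_on A (\<lambda>x. mnorm (f x - (B :: 'k::absval_field ^ 'd ^ 'd)))"
  unfolding mnorm_def vnorm_def vector_minus_component by (intro continuous_intros)

text \<open>The span is invariant, so as a proper subspace it would violate irreducibility. No
  identity is at hand in \<open>\<Gamma>\<close>; the span is non-zero because elements of
  \<open>SL\<close> do not kill \<open>u\<close>.\<close>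

lemma spanning_orbit:
  fixes \<Gamma> :: "('k::absval_field ^ 'd ^ 'd) set"
  assumes irred: "strongly_irreducible \<Gamma>" and mult: "\<And>g h. g \<in> \<Gamma> \<Longrightarrow> h \<in> \<Gamma> \<Longrightarrow> g ** h \<in> \<Gamma>"
    and sub: "\<Gamma> \<subseteq> SL" "\<Gamma> \<noteq> {}" and "u \<noteq> 0"
  shows "vec.span ((\<lambda>\<gamma>. \<gamma> *v u) ` \<Gamma>) = UNIV"
proof (rule ccontr)
  let ?X = "(\<lambda>\<gamma>. \<gamma> *v u) ` \<Gamma>" let ?E = "vec.span ?X"
  assume "?E \<noteq> UNIV"
  moreover have "?E \<noteq> {0}"
  proof -
    obtain g where g: "g \<in> \<Gamma>" using sub by blast
    then have "g *v u \<in> ?E" by (intro vec.span_base) auto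
    then show ?thesis using SL_matrix_vector_nz[of g u] g sub \<open>u \<noteq> 0\<close> by auto
  qed
  moreover have "(*v) g ` ?E \<subseteq> ?E" if "g \<in> \<Gamma>" for g
  proof -
    have "(*v) g ` ?E = vec.span ((*v) g ` ?X)"
      using vec.linear_span_image[OF matrix_vector_mul_linear_gen, of g ?X] by simp
    also have "(*v) g ` ?X \<subseteq> ?X" using mult[OF that] by (auto simp: matrix_vector_mul_assoc)
    then have "vec.span ((*v) g ` ?X) \<subseteq> ?E" by (rule vec.span_mono)
    finally show ?thesis .
  qed
  ultimately have conj: "finite {?E} \<and> {?E} \<noteq> {} \<and> (\<forall>E\<in>{?E}. vec.subspace E \<and> E \<noteq> {0} \<and> E \<noteq> UNIV)
      \<and> (\<forall>g\<in>\<Gamma>. (*v) g ` \<Union>{?E} \<subseteq> \<Union>{?E})"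
    by simp
  show False by (rule notE[OF irred[unfolded strongly_irreducible_def]], rule exI, rule conj)
qed

text \<open>Each coordinate of \<open>f\<close> is a combination of finitely many values of
  \<open>f\<close> on \<open>X\<close>. The constant is \<open>1 / (1 + R)\<close>, where
  \<open>R\<close> is the total size of the coefficients; the added 1 makes the final contradiction
  strict.\<close>

lemma spanning_set_detects:
  fixes X :: "('k::absval_field ^ 'd) set"
  assumes span: "vec.span X = UNIV"
  obtains F c where "finite F" "F \<subseteq> X" "0 < c" "\<And>f. f \<noteq> 0 \<Longrightarrow> \<exists>a\<in>F. c * vnorm f \<le> absval (pairing f a)"
proof -
  have "\<exists>T r. finite T \<and> T \<subseteq> X \<and> axis j 1 = (\<Sum>a\<in>T. r a *s a)" for j :: 'd
  proof -
    have "axis j 1 \<in> vec.span X" by (simp add: span)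
    then show ?thesis unfolding vec.span_explicit by blast
  qed
  then obtain T r where T: "\<And>j. finite (T j)" "\<And>j. T j \<subseteq> X" "\<And>j :: 'd. axis j 1 = (\<Sum>a\<in>T j. r j a *s a)"
    by metis
  define R where "R = (\<Sum>j\<in>UNIV. \<Sum>a\<in>T j. absval (r j a))"
  have R: "0 \<le> R" unfolding R_def by (intro sum_nonneg absval_nonneg)
  show thesis
  proof (rule that[of "\<Union>j. T j" "1 / (1 + R)"])
    show "finite (\<Union>j. T j)" "(\<Union>j. T j) \<subseteq> X" "0 < 1 / (1 + R)" using T R by auto
    fix f :: "'k ^ 'd" assume "f \<noteq> 0"
    show "\<exists>a\<in>\<Union>j. T j. 1 / (1 + R) * vnorm f \<le> absval (pairing f a)"
    proof (rule ccontr)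
      assume contra: "\<not> ?thesis"
      have "pairing f (\<Sum>a\<in>A. s a *s a) = (\<Sum>a\<in>A. s a * pairing f a)" for A and s :: "'k ^ 'd \<Rightarrow> 'k"
        by (induction A rule: infinite_finite_induct) (simp_all add: pairing_add pairing_scale, simp_all add:
            pairing_def)
      then have "f $ j = (\<Sum>a\<in>T j. r j a * pairing f a)" for j
        using T(3)[of j] pairing_axis[of f j] by simp
      then have "absval (f $ j) \<le> (\<Sum>a\<in>T j. absval (r j a) * absval (pairing f a))" for j
        using absval_sum[of "\<lambda>a. r j a * pairing f a" "T j"] by (simp add: absval_mult)
      also have "(\<Sum>a\<in>T j. absval (r j a) * absval (pairing f a))
          \<le> (\<Sum>a\<in>T j. absval (r j a) * (1 / (1 + R) * vnorm f))" for j
        using contra by (intro sum_mono mult_left_mono absval_nonneg) (auto simp: not_le intro: less_imp_le)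
      finally have "vnorm f \<le> (\<Sum>j\<in>UNIV. \<Sum>a\<in>T j. absval (r j a) * (1 / (1 + R) * vnorm f))"
        unfolding vnorm_def[of f] by (intro sum_mono)
      also have "\<dots> = R * (1 / (1 + R) * vnorm f)" unfolding sum_distrib_right[symmetric] R_def ..
      also have "\<dots> = R / (1 + R) * vnorm f" by simp
      also have "\<dots> < 1 * vnorm f"
        using R vnorm_pos[OF \<open>f \<noteq> 0\<close>] by (intro mult_strict_right_mono) auto
      finally show False by simp
    qed
  qed
qed

context stationary_walk
begin

lemma continuous_walk_event:
  assumes "continuous_on UNIV F" "continuous_on UNIV G"
  shows "{\<omega> \<in> space S. (F (walk n \<omega>) :: real) < G (walk n \<omega>)} \<in> sets S"
    and "{\<omega> \<in> space S. (F (walk n \<omega>) :: real) \<le> G (walk n \<omega>)} \<in> sets S"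
  using continuous_walk_borel[OF assms(1), of n] continuous_walk_borel[OF assms(2), of n] by measurable

text \<open>The set \<open>?T\<close> of matrices approached with positive probability is closed and
  contains the support. It is stable under products, since independent pieces of the walk that come
  near \<open>g\<close> and near \<open>h\<close> combine into a piece near \<open>g ** h\<close>.
  Hence \<open>SL \<inter> ?T\<close> is one of the sets whose intersection is the
  semigroup.\<close>

lemma walk_approaches_semigroup:
  assumes "\<gamma> \<in> generated_closed_semigroup \<mu>" "0 < e"
  shows "\<exists>k. 0 < prob {\<omega> \<in> space S. dist (walk k \<omega>) \<gamma> < e}"
proof -
  have ev: "{\<omega> \<in> space S. dist (walk k \<omega>) g < r} \<in> sets S" for k g r
    by (intro continuous_walk_event continuous_intros)
  let ?T = "{\<gamma>. \<forall>e>0. \<exists>k. 0 < prob {\<omega> \<in> space S. dist (walk k \<omega>) \<gamma> < e}}"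
  have "closed ?T"
    unfolding closed_limpt
  proof (intro allI impI)
    fix g assume lim: "g islimpt ?T"
    show "g \<in> ?T"
    proof (intro CollectI allI impI)
      fix e :: real assume "0 < e"
      then obtain g' where g': "g' \<in> ?T" "dist g' g < e / 2"
        using lim islimpt_approachable[of g ?T] half_gt_zero by blast
      obtain k where k: "0 < prob {\<omega> \<in> space S. dist (walk k \<omega>) g' < e / 2}" using g'(1) \<open>0 < e\<close> half_gt_zero
        by blast
      have "dist (walk k \<omega>) g < e" if "dist (walk k \<omega>) g' < e / 2" for \<omega>
        using dist_triangle[of "walk k \<omega>" g g'] that g'(2) by simp
      then have "prob {\<omega> \<in> space S. dist (walk k \<omega>) g' < e / 2} \<le> prob {\<omega> \<in> space S. dist (walk k \<omega>) g < e}"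
        by (intro P.finite_measure_mono ev) auto
      then show "\<exists>k. 0 < prob {\<omega> \<in> space S. dist (walk k \<omega>) g < e}" using k by (intro exI[of _ k]) linarith
    qed
  qed
  have "generated_closed_semigroup \<mu> \<subseteq> SL \<inter> ?T"
  proof (rule closed_semigroup_subset)
    show "closedin (top_of_set SL) (SL \<inter> ?T)" using \<open>closed ?T\<close> by (simp add: closedin_closed_Int)
    show "g ** h \<in> SL \<inter> ?T" if g: "g \<in> SL \<inter> ?T" and h: "h \<in> SL \<inter> ?T" for g h
    proof (intro IntI CollectI allI impI)
      show "g ** h \<in> SL" using g h by (auto intro: SL_mult)
      fix e :: real assume "0 < e"
      have "open ((\<lambda>p :: ('k ^ 'd ^ 'd) \<times> ('k ^ 'd ^ 'd). fst p ** snd p) -` ball (g ** h) e)"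
        by (rule open_vimage) (intro open_ball continuous_intros)+
      moreover have "(g, h) \<in> (\<lambda>p. fst p ** snd p) -` ball (g ** h) e" using \<open>0 < e\<close> by simp
      ultimately obtain A B where "open A" "open B" and gh: "(g, h) \<in> A \<times> B"
          and AB: "A \<times> B \<subseteq> (\<lambda>p. fst p ** snd p) -` ball (g ** h) e"
        by (rule open_prod_elim)
      obtain d1 where d1: "0 < d1" "ball g d1 \<subseteq> A" using \<open>open A\<close> gh openE[of A g] by auto
      obtain d2 where d2: "0 < d2" "ball h d2 \<subseteq> B" using \<open>open B\<close> gh openE[of B h] by auto
      obtain k where k: "0 < prob {\<omega> \<in> space S. dist (walk k \<omega>) g < d1}" using g d1(1) by blast
      obtain l where l: "0 < prob {\<omega> \<in> space S. dist (walk l \<omega>) h < d2}" using h d2(1) by blast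
      let ?G = "{\<omega> \<in> space S. dist (walk k \<omega>) g < d1}" and ?H = "{\<omega> \<in> space S. dist (walk l \<omega>) h < d2}"
      have incl: "dist (walk k \<omega> ** walk l \<omega>') (g ** h) < e" if "\<omega> \<in> ?G" "\<omega>' \<in> ?H" for \<omega> \<omega>'
      proof -
        have "(walk k \<omega>, walk l \<omega>') \<in> A \<times> B" using that d1 d2 by (auto simp: dist_commute)
        then have "(walk k \<omega>, walk l \<omega>') \<in> (\<lambda>p. fst p ** snd p) -` ball (g ** h) e" using AB by blast
        then show ?thesis by (simp add: dist_commute)
      qed
      have "0 < prob ?G * prob ?H" using k l by simp
      also have "\<dots> = (\<integral>\<omega>. indicat_real ?G \<omega> * prob ?H \<partial>S)" using ev by simp
      also have "\<dots> \<le> (\<integral>\<omega>. prob {\<omega>' \<in> space S. dist (walk (k + l) (comb_seq k \<omega> \<omega>')) (g ** h) < e} \<partial>S)"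
      proof (rule integral_mono)
        show "integrable S (\<lambda>\<omega>. indicat_real ?G \<omega> * prob ?H)"
          using ev by (intro integrable_mult_left integrable_real_indicator) (simp_all add:
              P.emeasure_eq_measure)
        show "integrable S (\<lambda>\<omega>. prob {\<omega>' \<in> space S. dist (walk (k + l) (comb_seq k \<omega> \<omega>')) (g ** h) < e})"
          by (rule prob_comb_seq(2)[OF ev])
        fix \<omega> assume w: "\<omega> \<in> space S"
        show "indicat_real ?G \<omega> * prob ?H \<le> prob {\<omega>' \<in> space S. dist (walk (k + l) (comb_seq k \<omega> \<omega>')) (g ** h)
            < e}"
        proof (cases "\<omega> \<in> ?G")
          case True
          have "prob ?H \<le> prob {\<omega>' \<in> space S. dist (walk (k + l) (comb_seq k \<omega> \<omega>')) (g ** h) < e}"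
            using incl[OF True] prob_comb_seq(3)[OF ev[of "k + l" "g ** h" e] w, of k]
            by (intro P.finite_measure_mono) (auto simp: walk_comb_seq)
          then show ?thesis using True by simp
        qed simp
      qed
      also have "\<dots> = prob {\<omega> \<in> space S. dist (walk (k + l) \<omega>) (g ** h) < e}"
        by (rule prob_comb_seq(1)[OF ev, symmetric])
      finally show "\<exists>k. 0 < prob {\<omega> \<in> space S. dist (walk k \<omega>) (g ** h) < e}" by blast
    qed
    show "supp \<mu> \<subseteq> SL \<inter> ?T"
    proof (intro subsetI IntI CollectI allI impI)
      fix g assume g: "g \<in> supp \<mu>"
      then show "g \<in> SL" by (simp add: supp_def)
      fix e :: real assume "0 < e"
      then have "0 < emeasure \<mu> (ball g e \<inter> SL)" using g by (auto simp: supp_def)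
      also have "\<dots> = emeasure (distr S \<mu> (\<lambda>\<omega>. \<omega> 0)) (ball g e \<inter> SL)" using PiM_component[of 0] by simp
      also have "\<dots> = emeasure S ((\<lambda>\<omega>. \<omega> 0) -` (ball g e \<inter> SL) \<inter> space S)"
        by (rule emeasure_distr) (auto simp: sets_\<mu> sets_restrict_space)
      also have "(\<lambda>\<omega>. \<omega> 0) -` (ball g e \<inter> SL) \<inter> space S = {\<omega> \<in> space S. dist (walk 1 \<omega>) g < e}"
        using walk_SL[of _ 1] by (auto simp: dist_commute space_S)
      finally show "\<exists>k. 0 < prob {\<omega> \<in> space S. dist (walk k \<omega>) g < e}"
        by (intro exI[of _ 1]) (simp add: P.emeasure_eq_measure)
    qed
  qed
  then show ?thesis using assms by blast
qed

end

locale contracting_walk = irreducible_walk \<mu> \<nu>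
  for \<mu> :: "('k::absval_field ^ 'd ^ 'd) measure" and \<nu> :: "('k ^ 'd) set measure" +
  assumes contracting: "contracting (generated_closed_semigroup \<mu>)"
begin

text \<open>A rank one limit \<open>B\<close> of rescaled elements may be killed by
  \<open>h\<close>, but its image line has an orbit that spans. So for each \<open>h\<close> one of
  finitely many semigroup elements \<open>a\<close> keeps \<open>h ** a ** B\<close> large, and the
  walk comes near elements that are close to \<open>a ** B\<close> up to scaling. Finiteness of
  \<open>F\<close> makes the times and the probability independent of \<open>h\<close>.\<close>

lemma contraction_positive_prob:
  assumes "0 < \<eta>"
  shows "\<exists>K p. finite K \<and> 0 < p \<and> (\<forall>h\<in>SL. \<exists>k\<in>K. p \<le> prob {\<omega> \<in> space S.
    minors (h ** walk k \<omega>) \<le> \<eta> * (mnorm (h ** walk k \<omega>))\<^sup>2})"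
proof -
  let ?\<Gamma> = "generated_closed_semigroup \<mu>" and ?d = "real CARD('d)"
  obtain \<gamma> r \<phi> B where \<gamma>: "\<And>n :: nat. \<gamma> n \<in> ?\<Gamma>" and B: "rank B = 1"
    and lim: "(\<lambda>n. scale_mat (r (\<phi> n)) (\<gamma> (\<phi> n))) \<longlonglongrightarrow> B"
    using contracting unfolding contracting_def by blast
  obtain u v where uv: "u \<noteq> 0" "v \<noteq> 0" "\<And>i. B $ i = u $ i *s v" using rank_one_decomposition[OF B] by blast
  have "vec.span ((\<lambda>\<gamma>. \<gamma> *v u) ` ?\<Gamma>) = UNIV"
    using \<gamma> by (intro spanning_orbit irreducible generated_closed_semigroup_mult generated_closed_semigroup_SL
        uv) auto
  then obtain F0 c where F0: "finite F0" "F0 \<subseteq> (\<lambda>\<gamma>. \<gamma> *v u) ` ?\<Gamma>" "0 < c"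
      "\<And>f. f \<noteq> 0 \<Longrightarrow> \<exists>a\<in>F0. c * vnorm f \<le> absval (pairing f a)"
    using spanning_set_detects by blast
  obtain F where F: "finite F" "F \<subseteq> ?\<Gamma>" "F0 = (\<lambda>\<gamma>. \<gamma> *v u) ` F"
    using finite_subset_image[OF F0(1,2)] by blast
  \<comment> \<open>Half of the lower bound for the row through \<open>a ** B\<close> pays for the
    distance to \<open>a ** B\<close>. The constant \<open>\<eta>1\<close> is chosen so that
    \<open>2 * (mnorm h)\<^sup>2 * \<eta>1\<close> equals
    \<open>\<eta> * (c1 / ?d * mnorm h)\<^sup>2\<close>.\<close>
  define c1 where "c1 = c * vnorm v / 2"
  define \<eta>1 where "\<eta>1 = \<eta> * c1\<^sup>2 / (2 * ?d\<^sup>2)"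
  have c1: "0 < c1" using F0(3) vnorm_pos[OF uv(2)] by (simp add: c1_def)
  have \<eta>1: "0 < \<eta>1" using c1 assms by (simp add: \<eta>1_def)
  have near_rank_one: "minors (h ** g) \<le> \<eta> * (mnorm (h ** g))\<^sup>2"
    if h: "h \<in> SL" and i: "mnorm h \<le> ?d * vnorm (h $ i)" and a: "a \<in> F"
      "c * vnorm (h $ i) \<le> absval (pairing (h $ i) (a *v u))"
      and g: "mnorm (scale_mat \<rho> g - a ** B) < c1" "minors (scale_mat \<rho> g) < \<eta>1" for h g a \<rho> i
  proof -
    let ?g = "scale_mat \<rho> g"
    have "(h $ i) v* (a ** B) = pairing (h $ i) (a *v u) *s v"
      by (simp add: vector_matrix_mul_assoc[symmetric] vector_matrix_rank_one[OF uv(3)] pairing_matrix)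
    then have "c * vnorm (h $ i) * vnorm v \<le> vnorm ((h $ i) v* (a ** B))"
      using a(2) by (simp add: vnorm_scale mult_right_mono vnorm_nonneg)
    also have "(h $ i) v* (a ** B) = (h $ i) v* ?g - (h $ i) v* (?g - a ** B)"
      by (simp add: vector_matrix_mult_diff_rdistrib)
    also have "vnorm \<dots> \<le> vnorm ((h $ i) v* ?g) + vnorm ((h $ i) v* (?g - a ** B))"
      unfolding vnorm_def sum.distrib[symmetric] by (intro sum_mono) (simp add: absval_diff_le)
    also have "\<dots> \<le> vnorm ((h $ i) v* ?g) + vnorm (h $ i) * c1"
      using g(1) by (intro add_left_mono order_trans[OF vnorm_vector_matrix_le] mult_left_mono vnorm_nonneg)
          simp
    finally have "c1 * vnorm (h $ i) \<le> vnorm ((h $ i) v* ?g)" by (simp add: c1_def field_simps)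
    also have "\<dots> \<le> mnorm (h ** ?g)" using vnorm_row_le_mnorm[of "h ** ?g" i] by (simp add: matrix_mult_row)
    finally have "c1 * vnorm (h $ i) \<le> mnorm (h ** ?g)" .
    moreover have "c1 / ?d * mnorm h \<le> c1 * vnorm (h $ i)"
      using mult_left_mono[OF i, of "c1 / ?d"] c1 by simp
    ultimately have low: "c1 / ?d * mnorm h \<le> mnorm (h ** ?g)" by linarith
    have hpos: "0 < c1 / ?d * mnorm h" using c1 SL_mnorm_pos[OF h] by simp
    have "minors (h ** ?g) \<le> minors h * minors ?g" by (rule minors_mult_le)
    also have "\<dots> \<le> (2 * (mnorm h)\<^sup>2) * \<eta>1"
      using g(2) by (intro mult_mono minors_le) (auto simp: minors_nonneg)
    also have "\<dots> = \<eta> * (c1 / ?d * mnorm h)\<^sup>2"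
      by (simp add: \<eta>1_def power_mult_distrib power_divide)
    also have "\<dots> \<le> \<eta> * (mnorm (h ** ?g))\<^sup>2"
      using low hpos assms by (intro mult_left_mono power_mono) auto
    finally have "(absval \<rho>)\<^sup>2 * minors (h ** g) \<le> (absval \<rho>)\<^sup>2 * (\<eta> * (mnorm (h ** g))\<^sup>2)"
      by (simp add: matrix_mult_scale_mat minors_scale_mat mnorm_scale_mat power_mult_distrib mult_ac)
    moreover have "absval \<rho> \<noteq> 0"
      using low hpos by (auto simp: matrix_mult_scale_mat mnorm_scale_mat)
    ultimately show ?thesis by (simp add: mult_le_cancel_left_pos)
  qed
  define good where "good a k \<rho> p \<longleftrightarrow> 0 < p \<and> p \<le> prob {\<omega> \<in> space S.
      mnorm (scale_mat \<rho> (walk k \<omega>) - a ** B) < c1 \<and> minors (scale_mat \<rho> (walk k \<omega>)) < \<eta>1}" for a k \<rho> p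
  have "\<exists>k \<rho> p. good a k \<rho> p" if a: "a \<in> F" for a
  proof -
    let ?O = "{g. mnorm (g - a ** B) < c1} \<inter> {g. minors g < \<eta>1}"
    have O: "open ?O" by (intro open_Int open_Collect_less continuous_intros)
    have "minors (a ** B) = 0"
      using minors_mult_le[of a B] minors_rank_one[OF uv(3)] minors_nonneg[of "a ** B"] by simp
    then have "a ** B \<in> ?O" using c1 \<eta>1 mnorm_eq_0_iff[of "0 :: 'k ^ 'd ^ 'd"] by simp
    moreover have "(\<lambda>n. a ** scale_mat (r (\<phi> n)) (\<gamma> (\<phi> n))) \<longlonglongrightarrow> a ** B"
      using continuous_on_tendsto_compose[of UNIV "\<lambda>g. a ** g", OF _ lim] by (simp add: continuous_intros)
    ultimately have "\<forall>\<^sub>F n in sequentially. a ** scale_mat (r (\<phi> n)) (\<gamma> (\<phi> n)) \<in> ?O"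
      using O by (intro topological_tendstoD)
    then obtain n where n: "a ** scale_mat (r (\<phi> n)) (\<gamma> (\<phi> n)) \<in> ?O" by (auto simp: eventually_sequentially)
    let ?\<rho> = "r (\<phi> n)" and ?g = "a ** \<gamma> (\<phi> n)"
    have "open (scale_mat ?\<rho> -` ?O)" using O by (intro open_vimage continuous_intros)
    moreover have "?g \<in> scale_mat ?\<rho> -` ?O" using n by (simp add: matrix_mult_scale_mat)
    ultimately obtain e where e: "0 < e" "ball ?g e \<subseteq> scale_mat ?\<rho> -` ?O" using openE by blast
    have "?g \<in> ?\<Gamma>" using a F(2) \<gamma> by (intro generated_closed_semigroup_mult) auto
    from walk_approaches_semigroup[OF this e(1)]
    obtain k where k: "0 < prob {\<omega> \<in> space S. dist (walk k \<omega>) ?g < e}" by blast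
    have "prob {\<omega> \<in> space S. dist (walk k \<omega>) ?g < e}
        \<le> prob {\<omega> \<in> space S. mnorm (scale_mat ?\<rho> (walk k \<omega>) - a ** B) < c1 \<and> minors (scale_mat ?\<rho> (walk k \<omega>))
            < \<eta>1}"
    proof (rule P.finite_measure_mono)
      have "{\<omega> \<in> space S. mnorm (scale_mat ?\<rho> (walk k \<omega>) - a ** B) < c1} \<in> sets S"
        "{\<omega> \<in> space S. minors (scale_mat ?\<rho> (walk k \<omega>)) < \<eta>1} \<in> sets S"
        by (intro continuous_walk_event continuous_intros)+
      then show "{\<omega> \<in> space S. mnorm (scale_mat ?\<rho> (walk k \<omega>) - a ** B) < c1 \<and> minors (scale_mat ?\<rho> (walk k \<omega>))
          < \<eta>1} \<in> sets S"
        by (rule sets.sets_Collect_conj[rotated])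
      show "{\<omega> \<in> space S. dist (walk k \<omega>) ?g < e}
        \<subseteq> {\<omega> \<in> space S. mnorm (scale_mat ?\<rho> (walk k \<omega>) - a ** B) < c1 \<and> minors (scale_mat ?\<rho> (walk k \<omega>)) < \<eta>1}"
        using e(2) by (auto simp: dist_commute)
    qed
    with k show ?thesis unfolding good_def by blast
  qed
  then obtain k \<rho> p where "\<And>a. a \<in> F \<Longrightarrow> good a (k a) (\<rho> a) (p a)" by metis
  then have kp: "\<And>a. a \<in> F \<Longrightarrow> 0 < p a" "\<And>a. a \<in> F \<Longrightarrow> p a \<le> prob {\<omega> \<in> space S.
      mnorm (scale_mat (\<rho> a) (walk (k a) \<omega>) - a ** B) < c1 \<and> minors (scale_mat (\<rho> a) (walk (k a) \<omega>)) < \<eta>1}"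
    unfolding good_def by blast+
  define q where "q = Min (insert 1 (p ` F))"
  have q: "0 < q" "\<And>a. a \<in> F \<Longrightarrow> q \<le> p a" using F(1) kp(1) unfolding q_def by (auto simp: Min_gr_iff)
  have "\<exists>k'\<in>k ` F. q \<le> prob {\<omega> \<in> space S. minors (h ** walk k' \<omega>) \<le> \<eta> * (mnorm (h ** walk k' \<omega>))\<^sup>2}" if h:
    "h \<in> SL" for h
  proof -
    obtain i where i: "mnorm h \<le> ?d * vnorm (h $ i)" using exists_large_row by blast
    have "h $ i \<noteq> 0" using i SL_mnorm_pos[OF h] by (auto simp: vnorm_eq_0_iff[THEN iffD2])
    then obtain a where a: "a \<in> F" "c * vnorm (h $ i) \<le> absval (pairing (h $ i) (a *v u))"
      using F0(4)[of "h $ i"] F(3) by blast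
    have "p a \<le> prob {\<omega> \<in> space S. minors (h ** walk (k a) \<omega>) \<le> \<eta> * (mnorm (h ** walk (k a) \<omega>))\<^sup>2}"
    proof (rule order_trans[OF kp(2)[OF a(1)]], rule P.finite_measure_mono)
      show "{\<omega> \<in> space S. minors (h ** walk (k a) \<omega>) \<le> \<eta> * (mnorm (h ** walk (k a) \<omega>))\<^sup>2} \<in> sets S"
        by (intro continuous_walk_event(2)[of "\<lambda>g. minors (h ** g)"
          "\<lambda>g. \<eta> * (mnorm (h ** g))\<^sup>2"] continuous_intros)
    qed (use near_rank_one[OF h i a] in blast)
    then show ?thesis using q(2)[OF a(1)] a(1) by (intro bexI[of _ "k a"]) auto
  qed
  then show ?thesis using F(1) q(1) by (intro exI[of _ "k ` F"] exI[of _ q]) auto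
qed

text \<open>Positive probability becomes probability near 1 because contraction persists: once the
  product is nearly of rank one, later factors multiply \<open>minors\<close> at most quadratically
  in their norm, while a large row of the product is rarely shrunk. Before that, every stretch of at
  most \<open>m\<close> steps brings a new chance of at least \<open>p\<close>.\<close>

lemma contraction_in_probability:
  assumes "0 < \<eta>" "0 < \<delta>"
  shows "\<exists>n. prob {\<omega> \<in> space S. \<eta> * (mnorm (walk n \<omega>))\<^sup>2 < minors (walk n \<omega>)} \<le> \<delta>"
proof -
  let ?d = "real CARD('d)"
  have "0 < \<delta> / 2" using assms by simp
  from covector_shrinking[OF this] obtain \<theta> where \<theta>: "0 < \<theta>" "\<And>f n. f \<noteq> 0 \<Longrightarrow>
    prob {\<omega> \<in> space S. \<exists>k\<le>n. vnorm (f v* walk k \<omega>) \<le> \<theta> * vnorm f * mnorm (walk k \<omega>)} \<le> \<delta> / 2" by blast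
  define bad where "bad n h = {\<omega> \<in> space S. \<eta> * (mnorm (h ** walk n \<omega>))\<^sup>2 < minors (h ** walk n \<omega>)}" for n h
  have bad_sets: "bad n h \<in> sets S" for n h
    unfolding bad_def by (intro continuous_walk_event(1)[of "\<lambda>g. \<eta> * (mnorm (h ** g))\<^sup>2"
      "\<lambda>g. minors (h ** g)"] continuous_intros)
  \<comment> \<open>Solves \<open>2 * \<eta>0 = \<eta> * (\<theta> / ?d)\<^sup>2\<close>: the 2
    comes from \<open>minors_le\<close>, and \<open>\<theta> / ?d\<close> from a row of
    \<open>h\<close> that is largest and not shrunk.\<close>
  define \<eta>0 where "\<eta>0 = \<eta> * (\<theta> / ?d)\<^sup>2 / 2"
  have \<eta>0: "0 < \<eta>0" using assms \<theta> by (simp add: \<eta>0_def)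
  have stay: "prob (bad n h) \<le> \<delta> / 2" if h: "h \<in> SL" "minors h \<le> \<eta>0 * (mnorm h)\<^sup>2" for n h
  proof -
    obtain i where i: "mnorm h \<le> ?d * vnorm (h $ i)" using exists_large_row by blast
    have hi: "h $ i \<noteq> 0" using i SL_mnorm_pos[OF h(1)] by (auto simp: vnorm_eq_0_iff[THEN iffD2])
    let ?E = "{\<omega> \<in> space S. \<exists>k\<le>n. vnorm ((h $ i) v* walk k \<omega>) \<le> \<theta> * vnorm (h $ i) * mnorm (walk k \<omega>)}"
    have "?E = (\<Union>k\<in>{..n}. {\<omega> \<in> space S. vnorm ((h $ i) v* walk k \<omega>) \<le> \<theta> * vnorm (h $ i) * mnorm (walk k \<omega>)})"
      by auto
    also have "\<dots> \<in> sets S"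
      by (intro sets.finite_UN continuous_walk_event(2)[of "\<lambda>g. vnorm ((h $ i) v* g)"
        "\<lambda>g. \<theta> * vnorm (h $ i) * mnorm g"] continuous_intros) auto
    finally have E: "?E \<in> sets S" .
    have "bad n h \<subseteq> ?E"
    proof
      fix \<omega> assume w: "\<omega> \<in> bad n h"
      let ?P = "walk n \<omega>"
      have "\<eta> * (mnorm (h ** ?P))\<^sup>2 < minors (h ** ?P)" using w by (simp add: bad_def)
      also have "\<dots> \<le> minors h * minors ?P" by (rule minors_mult_le)
      also have "\<dots> \<le> (\<eta>0 * (mnorm h)\<^sup>2) * (2 * (mnorm ?P)\<^sup>2)"
        using \<eta>0 by (intro mult_mono h minors_le) (auto simp: minors_nonneg)
      also have "\<dots> = \<eta> * (\<theta> / ?d * mnorm h * mnorm ?P)\<^sup>2"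
        by (simp add: \<eta>0_def power_mult_distrib power_divide)
      finally have "(mnorm (h ** ?P))\<^sup>2 < (\<theta> / ?d * mnorm h * mnorm ?P)\<^sup>2" using assms by simp
      then have "mnorm (h ** ?P) < \<theta> / ?d * mnorm h * mnorm ?P"
        by (rule power2_less_imp_less) (use \<theta> in \<open>simp add: mnorm_nonneg\<close>)
      also have "\<dots> \<le> \<theta> / ?d * (?d * vnorm (h $ i)) * mnorm ?P"
        using \<theta> by (intro mult_right_mono mult_left_mono i mnorm_nonneg) auto
      also have "\<dots> = \<theta> * vnorm (h $ i) * mnorm ?P" by simp
      finally have "vnorm ((h $ i) v* ?P) \<le> \<theta> * vnorm (h $ i) * mnorm ?P"
        using vnorm_row_le_mnorm[of "h ** ?P" i] by (simp add: matrix_mult_row)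
      then show "\<omega> \<in> ?E" using w by (auto simp: bad_def)
    qed
    then show ?thesis using P.finite_measure_mono[OF _ E] \<theta>(2)[OF hi, of n] by (meson order_trans)
  qed
  obtain K p where K: "finite K" "0 < p" and Kp: "\<And>h. h \<in> SL \<Longrightarrow> \<exists>k\<in>K. p \<le> prob {\<omega> \<in> space S.
    minors (h ** walk k \<omega>) \<le> \<eta>0 * (mnorm (h ** walk k \<omega>))\<^sup>2}"
    using contraction_positive_prob[OF \<eta>0] by blast
  have p1: "p \<le> 1" using Kp[OF SL_one] P.prob_le_1 order_trans by blast
  define m where "m = Max (insert 0 K)"
  have m: "k \<le> m" if "k \<in> K" for k using that K(1) by (simp add: m_def)
  have decay: "prob (bad n h) \<le> \<delta> / 2 + (1 - p) ^ j" if "h \<in> SL" "j * m \<le> n" for n h j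
    using that
  proof (induction j arbitrary: n h)
    case 0
    have "prob (bad n h) \<le> 1" by (rule P.prob_le_1)
    then show ?case using assms(2) unfolding power_0 by linarith
  next
    case (Suc j)
    obtain k where k: "k \<in> K" "p \<le> prob {\<omega> \<in> space S. minors (h ** walk k \<omega>) \<le> \<eta>0 * (mnorm (h ** walk k \<omega>))\<^sup>2}"
      using Kp[OF Suc.prems(1)] by blast
    let ?G = "{\<omega> \<in> space S. minors (h ** walk k \<omega>) \<le> \<eta>0 * (mnorm (h ** walk k \<omega>))\<^sup>2}"
    have G: "?G \<in> sets S"
      by (intro continuous_walk_event(2)[of "\<lambda>g. minors (h ** g)"
        "\<lambda>g. \<eta>0 * (mnorm (h ** g))\<^sup>2"] continuous_intros)
    have kn: "k \<le> n" "j * m \<le> n - k" using m[OF k(1)] Suc.prems(2) by simp_all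
    have sec: "{\<omega>' \<in> space S. \<eta> * (mnorm (h ** walk n (comb_seq k \<omega> \<omega>')))\<^sup>2
        < minors (h ** walk n (comb_seq k \<omega> \<omega>'))}
        = bad (n - k) (h ** walk k \<omega>)" for \<omega>
      using walk_comb_seq[of k "n - k" \<omega>] kn(1) by (simp add: bad_def matrix_mul_assoc)
    have "prob (bad n h) = (\<integral>\<omega>. prob (bad (n - k) (h ** walk k \<omega>)) \<partial>S)"
      using prob_comb_seq(1)[OF bad_sets[of n h, unfolded bad_def], of k] unfolding sec by (simp only: bad_def)
    \<comment> \<open>On the event \<open>?G\<close> the product has become nearly of rank one and
      \<open>stay\<close> applies; elsewhere the induction hypothesis does.\<close>
    also have "\<dots> \<le> (\<integral>\<omega>. (\<delta> / 2 + (1 - p) ^ j) - (1 - p) ^ j * indicat_real ?G \<omega> \<partial>S)"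
    proof (rule integral_mono)
      show "integrable S (\<lambda>\<omega>. prob (bad (n - k) (h ** walk k \<omega>)))"
        using prob_comb_seq(2)[OF bad_sets[of n h, unfolded bad_def], of k] unfolding sec .
      show "integrable S (\<lambda>\<omega>. (\<delta> / 2 + (1 - p) ^ j) - (1 - p) ^ j * indicat_real ?G \<omega>)"
        using G by (intro Bochner_Integration.integrable_diff integrable_mult_right integrable_real_indicator)
          (simp_all add: P.emeasure_eq_measure)
      fix \<omega> assume w: "\<omega> \<in> space S"
      then have SL: "h ** walk k \<omega> \<in> SL" by (intro SL_mult Suc.prems walk_SL)
      show "prob (bad (n - k) (h ** walk k \<omega>)) \<le> (\<delta> / 2 + (1 - p) ^ j) - (1 - p) ^ j * indicat_real ?G \<omega>"
        using stay[OF SL] Suc.IH[OF SL kn(2)] w by (auto simp: indicator_def)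
    qed
    also have "\<dots> = (\<delta> / 2 + (1 - p) ^ j) - (1 - p) ^ j * prob ?G"
      using G by (subst Bochner_Integration.integral_diff) (simp_all add: P.prob_space P.emeasure_eq_measure)
    also have "\<dots> \<le> (\<delta> / 2 + (1 - p) ^ j) - (1 - p) ^ j * p"
      using k(2) p1 by (intro diff_left_mono mult_left_mono) auto
    also have "\<dots> = \<delta> / 2 + (1 - p) ^ Suc j" by (simp add: algebra_simps)
    finally show ?case .
  qed
  have "0 \<le> 1 - p" "1 - p < 1" using K(2) p1 by auto
  then have "(\<lambda>j. (1 - p) ^ j) \<longlonglongrightarrow> 0" by (intro LIMSEQ_power_zero) auto
  from order_tendstoD(2)[OF this \<open>0 < \<delta> / 2\<close>] obtain j where j: "(1 - p) ^ j < \<delta> / 2"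
    by (auto simp: eventually_sequentially)
  have "prob (bad (j * m) (mat 1)) \<le> \<delta>" using decay[OF SL_one order_refl, of j] j by linarith
  then show ?thesis by (intro exI[of _ "j * m"]) (simp add: bad_def)
qed

end

section \<open>The expansion cocycle\<close>

definition cocycle :: "'k::absval_field ^ 'd \<Rightarrow> 'k ^ 'd ^ 'd \<Rightarrow> 'k ^ 'd ^ 'd \<Rightarrow> real" where
  "cocycle f w g = ln (mnorm (pullback g w) / mnorm w) - 2 * ln (vnorm (f v* g) / vnorm f)"

text \<open>Non-vanishing makes the logarithms in \<open>cocycle\<close> genuine. The form is not
  tied to the covector: \<open>minors\<close> bounds the growth of every alternating form, and this
  set of pairs is stable under the walk.\<close>

definition admissible :: "'k::absval_field ^ 'd \<Rightarrow> 'k ^ 'd ^ 'd \<Rightarrow> bool" where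
  "admissible f w \<longleftrightarrow> f \<noteq> 0 \<and> w \<noteq> 0 \<and> alternating w"

lemma admissible_action:
  "admissible f w \<Longrightarrow> g \<in> SL \<Longrightarrow> admissible (f v* g) (pullback g w)"
  by (simp add: admissible_def SL_vector_matrix_nz SL_pullback_nz alternating_pullback)

lemma cocycle_mult:
  assumes "admissible f w" "g \<in> SL" "h \<in> SL"
  shows "cocycle f w (g ** h) = cocycle f w g + cocycle (f v* g) (pullback g w) h"
proof -
  have "0 < vnorm f" "0 < mnorm w" "0 < vnorm (f v* g)" "0 < mnorm (pullback g w)"
    "0 < vnorm (f v* g v* h)" "0 < mnorm (pullback h (pullback g w))"
    using assms admissible_action[OF assms(1,2)] admissible_action[OF admissible_action[OF assms(1,2)] assms(3)]
    by (auto simp: admissible_def intro: vnorm_pos mnorm_pos)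
  then show ?thesis
    by (simp add: cocycle_def pullback_mult vector_matrix_mul_assoc[symmetric] ln_div)
qed

lemma cocycle_one: "admissible f w \<Longrightarrow> cocycle f w (mat 1) = 0"
  by (auto simp: cocycle_def pullback_one vector_matrix_mul_rid admissible_def vnorm_eq_0_iff mnorm_eq_0_iff)

lemma abs_ln_div_le:
  fixes a b c :: real
  assumes "0 < a" "0 < b" "a \<le> c * b" "b \<le> c * a" shows "\<bar>ln (a / b)\<bar> \<le> ln c"
proof -
  have c: "0 < c" using assms by (metis less_le_trans zero_less_mult_pos2)
  have "ln (a / b) \<le> ln c" using assms c by (subst ln_le_cancel_iff) (auto simp: field_simps)
  moreover have "- ln (a / b) = ln (b / a)" using assms by (simp add: ln_div)
  moreover have "ln (b / a) \<le> ln c" using assms c by (subst ln_le_cancel_iff) (auto simp: field_simps)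
  ultimately show ?thesis by linarith
qed

text \<open>The exterior square distorts norms by at most the square of \<open>distortion g\<close>,
  and the covector enters with weight 2; hence the 4.\<close>

lemma abs_cocycle_le:
  assumes "admissible f w" "g \<in> SL" shows "\<bar>cocycle f w g\<bar> \<le> 4 * ln (distortion g)"
proof -
  have pos: "0 < vnorm f" "0 < mnorm w" "0 < vnorm (f v* g)" "0 < mnorm (pullback g w)"
    using assms admissible_action[OF assms] by (auto simp: admissible_def intro: vnorm_pos mnorm_pos)
  have "\<bar>ln (mnorm (pullback g w) / mnorm w)\<bar> \<le> ln ((distortion g)\<^sup>2)"
    using pos mnorm_pullback_le_distortion[OF assms(2), of w] by (intro abs_ln_div_le) auto
  moreover have "ln ((distortion g)\<^sup>2) = 2 * ln (distortion g)"
    using distortion_ge_1[of g] by (simp add: ln_realpow)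
  moreover have "\<bar>ln (vnorm (f v* g) / vnorm f)\<bar> \<le> ln (distortion g)"
    using pos vnorm_le_distortion[OF assms(2), of f] by (intro abs_ln_div_le) auto
  ultimately show ?thesis unfolding cocycle_def by linarith
qed

text \<open>The form grows by at most \<open>\<eta> * (mnorm g)\<^sup>2\<close> and the covector by
  at least \<open>\<theta> * mnorm g\<close>; in the cocycle the norm of \<open>g\<close>
  cancels.\<close>

lemma cocycle_le:
  assumes adm: "admissible f w" and g: "g \<in> SL" and \<eta>: "0 < \<eta>" "minors g \<le> \<eta> * (mnorm g)\<^sup>2"
    and \<theta>: "0 < \<theta>" "\<theta> * vnorm f * mnorm g < vnorm (f v* g)"
  shows "cocycle f w g \<le> ln \<eta> - 2 * ln \<theta>"
proof -
  have pos: "0 < vnorm f" "0 < mnorm w" "0 < vnorm (f v* g)" "0 < mnorm (pullback g w)" "0 < mnorm g"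
    using adm admissible_action[OF adm g] SL_mnorm_pos[OF g]
      by (auto simp: admissible_def intro: vnorm_pos mnorm_pos)
  have "mnorm (pullback g w) \<le> mnorm w * minors g"
    using adm by (intro mnorm_pullback_le_minors) (simp add: admissible_def)
  also have "\<dots> \<le> mnorm w * (\<eta> * (mnorm g)\<^sup>2)" using pos by (intro mult_left_mono \<eta>) auto
  finally have "mnorm (pullback g w) / mnorm w \<le> \<eta> * (mnorm g)\<^sup>2" using pos by (simp add: field_simps)
  then have "ln (mnorm (pullback g w) / mnorm w) \<le> ln (\<eta> * (mnorm g)\<^sup>2)"
    using pos \<eta> by (subst ln_le_cancel_iff) auto
  also have "\<dots> = ln \<eta> + 2 * ln (mnorm g)" using pos \<eta> by (simp add: ln_mult ln_realpow)
  finally have 1: "ln (mnorm (pullback g w) / mnorm w) \<le> ln \<eta> + 2 * ln (mnorm g)" .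
  have "\<theta> * mnorm g \<le> vnorm (f v* g) / vnorm f" using pos \<theta> by (simp add: field_simps)
  then have "ln (\<theta> * mnorm g) \<le> ln (vnorm (f v* g) / vnorm f)"
    using pos \<theta> by (subst ln_le_cancel_iff) auto
  moreover have "ln (\<theta> * mnorm g) = ln \<theta> + ln (mnorm g)" using pos \<theta> by (simp add: ln_mult)
  ultimately show ?thesis using 1 unfolding cocycle_def by linarith
qed

text \<open>
  The pointwise inequality behind the drift estimate: \<open>Y\<close> is the increment over a block, \<open>m'\<close> the
  maximum of the later partial sums and \<open>m\<close> the maximum of all partial sums.
\<close>

lemma truncated_maximum_increment:
  fixes Y m m' \<kappa> s A K :: real
  assumes "\<bar>Y\<bar> \<le> \<kappa>" "0 \<le> m'" "0 \<le> m" "Y + m' \<le> m" "0 \<le> A" "A \<le> s / 2" "A \<le> K" "0 < s"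
  shows "Y + (K - A) * (1 - of_bool (- K < Y) - of_bool (A < m')) - 2 * \<kappa> * of_bool (s / 2 < m') - 4 * \<kappa>\<^sup>2 / s
    \<le> min m s - min m' s"
proof -
  define E where "E = 4 * \<kappa>\<^sup>2 / s"
  have \<kappa>: "0 \<le> \<kappa>" using assms by linarith
  have err: "0 \<le> E" using assms by (simp add: E_def)
  \<comment> \<open>For increments above \<open>s / 2\<close> truncation can spoil everything, but
    then the quadratic error term already exceeds \<open>2 * \<kappa>\<close>.\<close>
  have kbig: "2 * \<kappa> \<le> E" if "\<not> \<kappa> \<le> s / 2"
  proof -
    have "2 * \<kappa> * s \<le> 2 * \<kappa> * (2 * \<kappa>)" using that \<kappa> by (intro mult_left_mono) auto
    then show ?thesis using assms by (simp add: E_def pos_le_divide_eq power2_eq_square)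
  qed
  show ?thesis
    unfolding E_def[symmetric]
  proof (cases "Y \<le> - K \<and> m' \<le> A")
    \<comment> \<open>Here the gain appears: the block falls by at least \<open>K\<close> and the
      later maximum is at most \<open>A\<close>, so \<open>Y + K - A\<close> is at most
      \<open>- m'\<close>, while the new maximum is still nonnegative. In the other case the bracket
      is not positive, and for \<open>m'\<close> and \<open>\<kappa>\<close> up to
      \<open>s / 2\<close> the sum \<open>Y + m'\<close> is at most \<open>s\<close>, so truncation
      has no effect.\<close>
    case True
    then have "of_bool (- K < Y) = (0 :: real)" "of_bool (A < m') = (0 :: real)"
      "of_bool (s / 2 < m') = (0 :: real)"
      using assms by auto
    moreover have "min m' s = m'" "0 \<le> min m s" using True assms by auto
    ultimately show "Y + (K - A) * (1 - of_bool (- K < Y) - of_bool (A < m')) - 2 * \<kappa> * of_bool (s / 2 < m') - E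
        \<le> min m s - min m' s" using True err by (auto simp: min_def split: if_splits)
  next
    case False
    then have "(K - A) * (1 - of_bool (- K < Y) - of_bool (A < m')) \<le> 0"
      using assms by (intro mult_nonneg_nonpos) auto
    moreover have "Y - 2 * \<kappa> * of_bool (s / 2 < m') - E \<le> min m s - min m' s"
      using assms err \<kappa> kbig by (cases "s / 2 < m'"; cases "\<kappa> \<le> s / 2") (auto simp: min_def)
    ultimately show "Y + (K - A) * (1 - of_bool (- K < Y) - of_bool (A < m')) - 2 * \<kappa> * of_bool (s / 2 < m') - E
        \<le> min m s - min m' s" by linarith
  qed
qed

lemma exp_le_quadratic: "exp x \<le> 1 + x + x\<^sup>2 * exp \<bar>x\<bar>" for x :: real
proof -
  obtain t where t: "\<bar>t\<bar> \<le> \<bar>x\<bar>" "exp x = (\<Sum>m<2. x ^ m / fact m) + exp t / fact 2 * x ^ 2"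
    using Maclaurin_exp_le[of x 2] by blast
  have "exp t / 2 * x\<^sup>2 \<le> exp \<bar>x\<bar> * x\<^sup>2"
  proof (rule mult_right_mono)
    have "exp t \<le> exp \<bar>x\<bar>" using t(1) by simp
    then show "exp t / 2 \<le> exp \<bar>x\<bar>" using exp_gt_zero[of t] by linarith
  qed simp
  then show ?thesis using t(2) by (simp add: numeral_2_eq_2 mult.commute)
qed

section \<open>Moments of the distortion\<close>

context stationary_walk
begin

lemma nn_integral_comb_seq:
  assumes F: "F \<in> borel_measurable S"
  shows "(\<integral>\<^sup>+\<omega>. F \<omega> \<partial>S) = (\<integral>\<^sup>+\<omega>. (\<integral>\<^sup>+\<omega>'. F (comb_seq n \<omega> \<omega>') \<partial>S) \<partial>S)"
proof -
  have "distr (S \<Otimes>\<^sub>M S) S (\<lambda>p. comb_seq n (fst p) (snd p)) = S"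
    using PiM_comb_seq[of n] by (simp add: case_prod_unfold)
  then have "(\<integral>\<^sup>+\<omega>. F \<omega> \<partial>S) = (\<integral>\<^sup>+p. F (comb_seq n (fst p) (snd p)) \<partial>(S \<Otimes>\<^sub>M S))"
    using nn_integral_distr[OF comb_seq_measurable, of F n] F by simp
  also have "\<dots> = (\<integral>\<^sup>+\<omega>. (\<integral>\<^sup>+\<omega>'. F (comb_seq n \<omega> \<omega>') \<partial>S) \<partial>S)"
    using P.nn_integral_fst[OF measurable_compose[OF comb_seq_measurable F], of n] by simp
  finally show ?thesis .
qed

lemma continuous_on_distortion: "continuous_on UNIV (distortion :: 'k ^ 'd ^ 'd \<Rightarrow> real)"
  unfolding distortion_def by (intro continuous_intros)

lemma distortion_powr_walk_measurable: "(\<lambda>\<omega>. distortion (walk n \<omega>) powr \<beta>) \<in> borel_measurable S"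
  using continuous_walk_borel[OF continuous_on_distortion] by measurable

text \<open>Submultiplicativity and independence of the steps give growth at most geometric in
  \<open>n\<close>. The exponent is \<open>Suc n\<close> because the distortion of the identity is
  not 1, and \<open>C\<close> has to cover it too.\<close>

lemma distortion_moment:
  assumes "exp_local_moment \<mu>"
  obtains \<beta> C where "0 < \<beta>" "1 \<le> C"
    "\<And>n. (\<integral>\<^sup>+\<omega>. ennreal (distortion (walk n \<omega>) powr \<beta>) \<partial>S) \<le> ennreal (C ^ Suc n)"
proof -
  obtain \<tau> where \<tau>: "0 < \<tau>" "(\<integral>\<^sup>+ g. ennreal (op_norm g powr \<tau>) \<partial>\<mu>) < \<infinity>"
    using assms unfolding exp_local_moment_def by blast
  let ?d = "real CARD('d)" and ?D = "Suc CARD('d)"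
  let ?c = "?d\<^sup>2 * fact CARD('d)"
  \<comment> \<open>\<open>distortion\<close> is a polynomial of degree \<open>Suc CARD('d)\<close>
    in \<open>mnorm\<close>, so its power \<open>\<beta>\<close> grows like the power
    \<open>\<tau>\<close> of the norm.\<close>
  define \<beta> where "\<beta> = \<tau> / real ?D"
  have \<beta>: "0 < \<beta>" using \<tau> by (simp add: \<beta>_def)
  have m[measurable]: "(mnorm :: 'k ^ 'd ^ 'd \<Rightarrow> real) \<in> borel_measurable \<mu>"
    using measurable_compose[OF step_borel borel_measurable_continuous_onI[OF continuous_on_mnorm[OF
        continuous_on_id]]] .
  have bound: "distortion g powr \<beta> \<le> ?c powr \<beta> * 2 powr \<tau> * (1 + (?d\<^sup>2) powr \<tau> * (mnorm g / ?d\<^sup>2) powr \<tau>)"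
    for g :: "'k ^ 'd ^ 'd"
  proof -
    have n: "0 \<le> mnorm g" by (rule mnorm_nonneg)
    have "distortion g powr \<beta> = ?c powr \<beta> * ((1 + mnorm g) ^ ?D) powr \<beta>"
      unfolding distortion_def using n by (intro powr_mult)
    also have "((1 + mnorm g) ^ ?D) powr \<beta> = (1 + mnorm g) powr \<tau>"
      using n by (subst powr_realpow[symmetric]) (auto simp: powr_powr \<beta>_def simp del: of_nat_Suc)
    also have "\<dots> \<le> (2 * max 1 (mnorm g)) powr \<tau>" using n \<tau> by (intro powr_mono2) auto
    also have "\<dots> = 2 powr \<tau> * (max 1 (mnorm g)) powr \<tau>" by (intro powr_mult)
    also have "\<dots> \<le> 2 powr \<tau> * (1 + mnorm g powr \<tau>)"
      by (intro mult_left_mono) (auto simp: max_def)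
    also have "mnorm g powr \<tau> = (?d\<^sup>2 * (mnorm g / ?d\<^sup>2)) powr \<tau>" by simp
    also have "\<dots> = (?d\<^sup>2) powr \<tau> * (mnorm g / ?d\<^sup>2) powr \<tau>" by (intro powr_mult)
    finally show ?thesis by (simp add: mult.assoc mult_left_mono)
  qed
  have "(\<integral>\<^sup>+ g. ennreal ((mnorm g / ?d\<^sup>2) powr \<tau>) \<partial>\<mu>) \<le> (\<integral>\<^sup>+ g. ennreal (op_norm g powr \<tau>) \<partial>\<mu>)"
  proof (intro nn_integral_mono ennreal_leI powr_mono2)
    show "mnorm g / ?d\<^sup>2 \<le> op_norm g" for g :: "'k ^ 'd ^ 'd"
      using mnorm_le_op_norm[of g] by (simp add: pos_divide_le_eq mult.commute)
  qed (use \<tau> in \<open>auto simp: mnorm_nonneg\<close>)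
  then have "(\<integral>\<^sup>+ g. ennreal ((mnorm g / ?d\<^sup>2) powr \<tau>) \<partial>\<mu>) < \<infinity>" using \<tau>(2) by (rule le_less_trans)
  then have "integrable \<mu> (\<lambda>g. (mnorm g / ?d\<^sup>2) powr \<tau>)"
    by (intro integrableI_nonneg) auto
  then have int: "integrable \<mu> (\<lambda>g. ?c powr \<beta> * 2 powr \<tau> * (1 + (?d\<^sup>2) powr \<tau> * (mnorm g / ?d\<^sup>2) powr \<tau>))"
    by (intro integrable_mult_right Bochner_Integration.integrable_add) simp_all
  define I where "I = (\<integral>g. ?c powr \<beta> * 2 powr \<tau> * (1 + (?d\<^sup>2) powr \<tau> * (mnorm g / ?d\<^sup>2) powr \<tau>) \<partial>\<mu>)"
  have one: "(\<integral>\<^sup>+\<omega>. ennreal (distortion (walk 1 \<omega>) powr \<beta>) \<partial>S) \<le> ennreal I"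
  proof -
    have "(\<integral>\<^sup>+\<omega>. ennreal (distortion (walk 1 \<omega>) powr \<beta>) \<partial>S) = (\<integral>\<^sup>+\<omega>. ennreal (distortion (\<omega> 0) powr \<beta>) \<partial>S)"
      by simp
    also have "\<dots>
        \<le> (\<integral>\<^sup>+\<omega>. ennreal (?c powr \<beta> * 2 powr \<tau> * (1 + (?d\<^sup>2) powr \<tau> * (mnorm (\<omega> 0) / ?d\<^sup>2) powr \<tau>)) \<partial>S)"
      by (intro nn_integral_mono ennreal_leI bound)
    also have "\<dots> = (\<integral>\<^sup>+g. ennreal (?c powr \<beta> * 2 powr \<tau> * (1 + (?d\<^sup>2) powr \<tau>
        * (mnorm g / ?d\<^sup>2) powr \<tau>)) \<partial>distr S \<mu> (\<lambda>\<omega>. \<omega> 0))"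
      by (subst nn_integral_distr) auto
    also have "distr S \<mu> (\<lambda>\<omega>. \<omega> 0) = \<mu>" using PiM_component[of 0] by simp
    finally show ?thesis
      unfolding I_def by (subst (asm) nn_integral_eq_integral[OF int]) (auto simp: mult_nonneg_nonneg)
  qed
  define C where "C = max 1 (max I (distortion (mat 1 :: 'k ^ 'd ^ 'd) powr \<beta>))"
  have C: "1 \<le> C" "I \<le> C" "distortion (mat 1 :: 'k ^ 'd ^ 'd) powr \<beta> \<le> C" by (auto simp: C_def)
  have "(\<integral>\<^sup>+\<omega>. ennreal (distortion (walk n \<omega>) powr \<beta>) \<partial>S) \<le> ennreal (C ^ Suc n)" for n
  proof (induction n)
    case 0
    show ?case using C by (simp add: P.emeasure_space_1 ennreal_leI)
  next
    case (Suc n)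
    have "(\<integral>\<^sup>+\<omega>. ennreal (distortion (walk (1 + n) \<omega>) powr \<beta>) \<partial>S)
        = (\<integral>\<^sup>+\<omega>. (\<integral>\<^sup>+\<omega>'. ennreal (distortion (walk 1 \<omega> ** walk n \<omega>') powr \<beta>) \<partial>S) \<partial>S)"
      using nn_integral_comb_seq[of "\<lambda>\<omega>. ennreal (distortion (walk (1 + n) \<omega>) powr \<beta>)" 1]
        distortion_powr_walk_measurable[of "1 + n" \<beta>] unfolding walk_comb_seq by simp
    also have "\<dots>
        \<le> (\<integral>\<^sup>+\<omega>. (\<integral>\<^sup>+\<omega>'. ennreal (distortion (walk 1 \<omega>) powr \<beta>)
            * ennreal (distortion (walk n \<omega>') powr \<beta>) \<partial>S) \<partial>S)"
    proof (intro nn_integral_mono)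
      fix \<omega> \<omega>' :: "nat \<Rightarrow> 'k ^ 'd ^ 'd"
      let ?g = "walk 1 \<omega>" and ?h = "walk n \<omega>'"
      have "distortion (?g ** ?h) powr \<beta> \<le> (distortion ?g * distortion ?h) powr \<beta>"
        using distortion_ge_1[of "?g ** ?h"] \<beta> by (intro powr_mono2 distortion_mult_le) auto
      also have "\<dots> = distortion ?g powr \<beta> * distortion ?h powr \<beta>"
        by (intro powr_mult)
      finally show "ennreal (distortion (?g ** ?h) powr \<beta>)
          \<le> ennreal (distortion ?g powr \<beta>) * ennreal (distortion ?h powr \<beta>)"
        by (simp add: ennreal_mult[symmetric] ennreal_leI)
    qed
    also have "\<dots>
        = (\<integral>\<^sup>+\<omega>. ennreal (distortion (walk 1 \<omega>) powr \<beta>) \<partial>S)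
            * (\<integral>\<^sup>+\<omega>'. ennreal (distortion (walk n \<omega>') powr \<beta>) \<partial>S)"
      using distortion_powr_walk_measurable[of n \<beta>] distortion_powr_walk_measurable[of 1 \<beta>]
      by (subst nn_integral_cmult, simp, subst nn_integral_multc) auto
    also have "\<dots> \<le> ennreal C * ennreal (C ^ Suc n)"
      using one C by (intro mult_mono Suc.IH order_trans[OF one] ennreal_leI) auto
    also have "\<dots> = ennreal (C ^ Suc (Suc n))" using C by (simp add: ennreal_mult[symmetric])
    finally show ?case by simp
  qed
  then show thesis using that[OF \<beta> C(1)] by blast
qed

end

locale exponential_walk = contracting_walk \<mu> \<nu>
  for \<mu> :: "('k::absval_field ^ 'd ^ 'd) measure" and \<nu> :: "('k ^ 'd) set measure" +
  fixes \<beta> C :: real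
  assumes \<beta>: "0 < \<beta>" and C: "1 \<le> C"
    and moment: "\<And>n. (\<integral>\<^sup>+\<omega>. ennreal (distortion (walk n \<omega>) powr \<beta>) \<partial>S) \<le> ennreal (C ^ Suc n)"
begin

lemma distortion_integrable: "integrable S (\<lambda>\<omega>. distortion (walk n \<omega>) powr \<beta>)"
proof (rule integrableI_nonneg[OF distortion_powr_walk_measurable])
  show "(\<integral>\<^sup>+\<omega>. ennreal (distortion (walk n \<omega>) powr \<beta>) \<partial>S) < \<infinity>"
    using le_less_trans[OF moment] by simp
qed simp

lemma distortion_expectation: "expectation (\<lambda>\<omega>. distortion (walk n \<omega>) powr \<beta>) \<le> C ^ Suc n"
proof -
  have "ennreal (expectation (\<lambda>\<omega>. distortion (walk n \<omega>) powr \<beta>)) \<le> ennreal (C ^ Suc n)"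
    using moment[of n] nn_integral_eq_integral[OF distortion_integrable, of n] by simp
  then show ?thesis using C by (subst (asm) ennreal_le_iff) auto
qed

lemma ln_distortion_le: "0 < a \<Longrightarrow> ln (distortion (g :: 'k ^ 'd ^ 'd)) \<le> distortion g powr a / a"
  using distortion_ge_1 by (intro ln_powr_bound)

lemma ln_distortion_nonneg: "0 \<le> ln (distortion (g :: 'k ^ 'd ^ 'd))"
  using distortion_ge_1[of g] by simp

lemma cocycle_walk_measurable: "(\<lambda>\<omega>. cocycle f w (walk n \<omega>)) \<in> borel_measurable S"
proof -
  have [measurable]: "(\<lambda>\<omega>. mnorm (pullback (walk n \<omega>) w)) \<in> borel_measurable S"
    by (intro continuous_walk_borel[of "\<lambda>g. mnorm (pullback g w)"] continuous_intros)
  have [measurable]: "(\<lambda>\<omega>. vnorm (f v* walk n \<omega>)) \<in> borel_measurable S"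
    by (intro continuous_walk_borel[of "\<lambda>g. vnorm (f v* g)"] continuous_intros)
  show ?thesis unfolding cocycle_def by measurable
qed

lemma ln_distortion_measurable: "(\<lambda>\<omega>. ln (distortion (walk n \<omega>))) \<in> borel_measurable S"
  using continuous_walk_borel[OF continuous_on_distortion] by measurable

lemma ln_distortion_square_integrable: "integrable S (\<lambda>\<omega>. (4 * ln (distortion (walk n \<omega>)))\<^sup>2)"
proof (rule Bochner_Integration.integrable_bound)
  show "integrable S (\<lambda>\<omega>. 64 / \<beta>\<^sup>2 * distortion (walk n \<omega>) powr \<beta>)"
    by (intro integrable_mult_right distortion_integrable)
  show "(\<lambda>\<omega>. (4 * ln (distortion (walk n \<omega>)))\<^sup>2) \<in> borel_measurable S"
    using ln_distortion_measurable by measurable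
  show "AE \<omega> in S. norm ((4 * ln (distortion (walk n \<omega>)))\<^sup>2) \<le> norm (64 / \<beta>\<^sup>2 * distortion (walk n \<omega>) powr \<beta>)"
  proof (rule AE_I2)
    fix \<omega>
    let ?D = "distortion (walk n \<omega>)"
    \<comment> \<open>The exponent \<open>\<beta> / 2\<close> is used for the logarithm so that its
      square is controlled by the power \<open>\<beta>\<close>.\<close>
    have "4 * ln ?D \<le> 8 / \<beta> * ?D powr (\<beta> / 2)"
      using ln_distortion_le[of "\<beta> / 2" "walk n \<omega>"] \<beta> by simp
    then have "(4 * ln ?D)\<^sup>2 \<le> (8 / \<beta> * ?D powr (\<beta> / 2))\<^sup>2"
      by (rule power_mono) (simp add: ln_distortion_nonneg)
    also have "\<dots> = 64 / \<beta>\<^sup>2 * ?D powr \<beta>"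
      using distortion_ge_1[of "walk n \<omega>"]
      by (simp add: power_mult_distrib power_divide powr_power)
    finally show "norm ((4 * ln ?D)\<^sup>2) \<le> norm (64 / \<beta>\<^sup>2 * ?D powr \<beta>)" by simp
  qed
qed

lemma ln_distortion_integrable: "integrable S (\<lambda>\<omega>. 4 * ln (distortion (walk n \<omega>)))"
proof (rule Bochner_Integration.integrable_bound)
  show "integrable S (\<lambda>\<omega>. 1 + (4 * ln (distortion (walk n \<omega>)))\<^sup>2)"
    by (intro Bochner_Integration.integrable_add ln_distortion_square_integrable) simp
  show "(\<lambda>\<omega>. 4 * ln (distortion (walk n \<omega>))) \<in> borel_measurable S"
    using ln_distortion_measurable by measurable
  have le: "norm x \<le> norm (1 + x\<^sup>2)" if "0 \<le> x" for x :: real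
  proof -
    have "(x - 1 / 2)\<^sup>2 = x\<^sup>2 - x + 1 / 4" by (simp add: power2_eq_square algebra_simps)
    then have "x \<le> 1 + x\<^sup>2" using zero_le_power2[of "x - 1 / 2"] by linarith
    then show ?thesis using that by simp
  qed
  show "AE \<omega> in S. norm (4 * ln (distortion (walk n \<omega>))) \<le> norm (1 + (4 * ln (distortion (walk n \<omega>)))\<^sup>2)"
    by (rule AE_I2, rule le) (simp add: ln_distortion_nonneg)
qed

lemma cocycle_integrable:
  assumes "admissible f w" shows "integrable S (\<lambda>\<omega>. cocycle f w (walk n \<omega>))"
proof (rule Bochner_Integration.integrable_bound[OF ln_distortion_integrable cocycle_walk_measurable])
  show "AE \<omega> in S. norm (cocycle f w (walk n \<omega>)) \<le> norm (4 * ln (distortion (walk n \<omega>)))"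
    using abs_cocycle_le[OF assms walk_SL] by (intro AE_I2) (fastforce simp: ln_distortion_nonneg abs_of_nonneg)
qed

section \<open>Tails and drift of the cocycle\<close>

lemma shrinking_event_measurable:
  "{\<omega> \<in> space S. \<exists>k\<le>n. vnorm (f v* walk k \<omega>) \<le> \<theta> * vnorm f * mnorm (walk k \<omega>)} \<in> sets S"
proof -
  have "{\<omega> \<in> space S. \<exists>k\<le>n. vnorm (f v* walk k \<omega>) \<le> \<theta> * vnorm f * mnorm (walk k \<omega>)}
      = (\<Union>k\<in>{..n}. {\<omega> \<in> space S. vnorm (f v* walk k \<omega>) \<le> \<theta> * vnorm f * mnorm (walk k \<omega>)})" by auto
  also have "\<dots> \<in> sets S"
    by (intro sets.finite_UN continuous_walk_event(2)[of "\<lambda>g. vnorm (f v* g)"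
      "\<lambda>g. \<theta> * vnorm f * mnorm g"] continuous_intros) auto
  finally show ?thesis .
qed

text \<open>The general bound \<open>minors_le\<close> is \<open>cocycle_le\<close> with
  \<open>\<eta> = 2\<close>: even without contraction, a large value of the cocycle means that
  \<open>f\<close> has been shrunk. Hence the threshold
  \<open>ln 2 - 2 * ln \<theta>\<close>.\<close>

lemma cocycle_upper_tail:
  assumes "0 < \<eta>"
  obtains a where "0 < a" "\<And>f w n. admissible f w \<Longrightarrow> prob {\<omega> \<in> space S. \<exists>k\<le>n. a < cocycle f w (walk k \<omega>)} \<le> \<eta>"
proof -
  obtain \<theta> where \<theta>: "0 < \<theta>" "\<And>f n. f \<noteq> 0 \<Longrightarrow>
    prob {\<omega> \<in> space S. \<exists>k\<le>n. vnorm (f v* walk k \<omega>) \<le> \<theta> * vnorm f * mnorm (walk k \<omega>)} \<le> \<eta>"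
    using covector_shrinking[OF assms] by blast
  show thesis
  proof (rule that[of "max 1 (ln 2 - 2 * ln \<theta>)"])
    fix f :: "'k ^ 'd" and w :: "'k ^ 'd ^ 'd" and n assume adm: "admissible f w"
    have "{\<omega> \<in> space S. \<exists>k\<le>n. max 1 (ln 2 - 2 * ln \<theta>) < cocycle f w (walk k \<omega>)}
        \<subseteq> {\<omega> \<in> space S. \<exists>k\<le>n. vnorm (f v* walk k \<omega>) \<le> \<theta> * vnorm f * mnorm (walk k \<omega>)}"
    proof (rule subsetI)
      fix \<omega> assume "\<omega> \<in> {\<omega> \<in> space S. \<exists>k\<le>n. max 1 (ln 2 - 2 * ln \<theta>) < cocycle f w (walk k \<omega>)}"
      then obtain k where k: "\<omega> \<in> space S" "k \<le> n" "ln 2 - 2 * ln \<theta> < cocycle f w (walk k \<omega>)" by auto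
      have "\<not> \<theta> * vnorm f * mnorm (walk k \<omega>) < vnorm (f v* walk k \<omega>)"
        using cocycle_le[OF adm walk_SL[OF k(1)] _ minors_le \<theta>(1)] k(3) by fastforce
      then show "\<omega> \<in> {\<omega> \<in> space S. \<exists>k\<le>n. vnorm (f v* walk k \<omega>) \<le> \<theta> * vnorm f * mnorm (walk k \<omega>)}"
        using k by (auto simp: not_less)
    qed
    then have "prob {\<omega> \<in> space S. \<exists>k\<le>n. max 1 (ln 2 - 2 * ln \<theta>) < cocycle f w (walk k \<omega>)}
        \<le> prob {\<omega> \<in> space S. \<exists>k\<le>n. vnorm (f v* walk k \<omega>) \<le> \<theta> * vnorm f * mnorm (walk k \<omega>)}"
      by (intro P.finite_measure_mono shrinking_event_measurable)
    also have "\<dots> \<le> \<eta>" using adm by (intro \<theta>(2)) (simp add: admissible_def)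
    finally show "prob {\<omega> \<in> space S. \<exists>k\<le>n. max 1 (ln 2 - 2 * ln \<theta>) < cocycle f w (walk k \<omega>)} \<le> \<eta>" .
  qed simp
qed

lemma cocycle_to_minus_infinity:
  assumes "0 < \<delta>"
  obtains n where "\<And>f w. admissible f w \<Longrightarrow> prob {\<omega> \<in> space S. - K < cocycle f w (walk n \<omega>)} \<le> \<delta>"
proof -
  have \<delta>: "0 < \<delta> / 2" using assms by simp
  obtain \<theta> where \<theta>: "0 < \<theta>" "\<And>f n. f \<noteq> 0 \<Longrightarrow>
    prob {\<omega> \<in> space S. \<exists>k\<le>n. vnorm (f v* walk k \<omega>) \<le> \<theta> * vnorm f * mnorm (walk k \<omega>)} \<le> \<delta> / 2"
    using covector_shrinking[OF \<delta>] by blast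
  \<comment> \<open>The value for which the bound \<open>ln \<eta> - 2 * ln \<theta>\<close> of
    \<open>cocycle_le\<close> is exactly \<open>- K\<close>.\<close>
  define \<eta> where "\<eta> = \<theta>\<^sup>2 * exp (- K)"
  have \<eta>: "0 < \<eta>" "ln \<eta> - 2 * ln \<theta> = - K" using \<theta>(1) by (simp_all add: \<eta>_def ln_mult ln_realpow)
  obtain n where n: "prob {\<omega> \<in> space S. \<eta> * (mnorm (walk n \<omega>))\<^sup>2 < minors (walk n \<omega>)} \<le> \<delta> / 2"
    using contraction_in_probability[OF \<eta>(1) \<delta>] by blast
  show thesis
  proof (rule that[of n])
    fix f :: "'k ^ 'd" and w :: "'k ^ 'd ^ 'd" assume adm: "admissible f w"
    let ?A = "{\<omega> \<in> space S. \<eta> * (mnorm (walk n \<omega>))\<^sup>2 < minors (walk n \<omega>)}"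
    let ?B = "{\<omega> \<in> space S. \<exists>k\<le>n. vnorm (f v* walk k \<omega>) \<le> \<theta> * vnorm f * mnorm (walk k \<omega>)}"
    have A: "?A \<in> sets S" by (intro continuous_walk_event(1) continuous_intros)
    have sub: "{\<omega> \<in> space S. - K < cocycle f w (walk n \<omega>)} \<subseteq> ?A \<union> ?B"
    proof (rule subsetI)
      fix \<omega> assume "\<omega> \<in> {\<omega> \<in> space S. - K < cocycle f w (walk n \<omega>)}"
      then have k: "\<omega> \<in> space S" "- K < cocycle f w (walk n \<omega>)" by auto
      have "\<not> (minors (walk n \<omega>) \<le> \<eta> * (mnorm (walk n \<omega>))\<^sup>2 \<and> \<theta> * vnorm f * mnorm (walk n \<omega>)
          < vnorm (f v* walk n \<omega>))"
        using cocycle_le[OF adm walk_SL[OF k(1)] \<eta>(1) _ \<theta>(1)] k(2) unfolding \<eta>(2) by fastforce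
      then show "\<omega> \<in> ?A \<union> ?B" using k(1) by (auto simp: not_less not_le)
    qed
    have "prob {\<omega> \<in> space S. - K < cocycle f w (walk n \<omega>)} \<le> prob (?A \<union> ?B)"
      by (rule P.finite_measure_mono[OF sub sets.Un[OF A shrinking_event_measurable]])
    also have "\<dots> \<le> prob ?A + prob ?B"
      by (rule measure_Un_le[OF A shrinking_event_measurable])
    also have "\<dots> \<le> \<delta> / 2 + \<delta> / 2" using adm by (intro add_mono n \<theta>(2)) (simp add: admissible_def)
    finally show "prob {\<omega> \<in> space S. - K < cocycle f w (walk n \<omega>)} \<le> \<delta>" by simp
  qed
qed

text \<open>Sampling only at multiples of \<open>n\<close> suits the drift estimate, because
  \<open>n\<close> steps are what it takes for an increment to be very negative with high
  probability. The initial value 0 keeps the potential nonnegative.\<close>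

primrec peak :: "nat \<Rightarrow> nat \<Rightarrow> 'k ^ 'd \<Rightarrow> 'k ^ 'd ^ 'd \<Rightarrow> (nat \<Rightarrow> 'k ^ 'd ^ 'd) \<Rightarrow> real" where
  "peak n 0 f w \<omega> = 0"
| "peak n (Suc j) f w \<omega> = max (peak n j f w \<omega>) (cocycle f w (walk (Suc j * n) \<omega>))"

lemma peak_nonneg: "0 \<le> peak n j f w \<omega>"
  by (induction j) auto

lemma peak_measurable: "(\<lambda>\<omega>. peak n j f w \<omega>) \<in> borel_measurable S"
  by (induction j) (simp_all only: peak.simps borel_measurable_const borel_measurable_max
      cocycle_walk_measurable)

text \<open>A level \<open>a\<close> that is nonnegative can only be exceeded at a genuine partial
  sum, not at the initial value 0.\<close>

lemma peak_greater: "0 \<le> a \<Longrightarrow> a < peak n j f w \<omega> \<Longrightarrow> \<exists>k\<le>j * n. a < cocycle f w (walk k \<omega>)"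
proof (induction j)
  case (Suc j)
  show ?case
  proof (cases "a < peak n j f w \<omega>")
    case True
    then obtain k where "k \<le> j * n" "a < cocycle f w (walk k \<omega>)" using Suc by blast
    then show ?thesis by (intro exI[of _ k]) auto
  next
    case False
    then have "a < cocycle f w (walk (Suc j * n) \<omega>)" using Suc.prems(2) by (auto simp: less_max_iff_disj)
    then show ?thesis by blast
  qed
qed simp

lemma peak_event_measurable: "{\<omega> \<in> space S. a < peak n j f w \<omega>} \<in> sets S"
  using peak_measurable by measurable

lemma peak_tail:
  assumes "admissible f w" "0 \<le> a" "\<And>n. prob {\<omega> \<in> space S. \<exists>k\<le>n. a < cocycle f w (walk k \<omega>)} \<le> \<eta>"
  shows "prob {\<omega> \<in> space S. a < peak n j f w \<omega>} \<le> \<eta>"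
proof -
  have "{\<omega> \<in> space S. \<exists>k\<le>j * n. a < cocycle f w (walk k \<omega>)} = (\<Union>k\<in>{..j * n}. {\<omega> \<in> space S. a
      < cocycle f w (walk k \<omega>)})" by auto
  also have "\<dots> \<in> sets S" using cocycle_walk_measurable by measurable
  finally have meas: "{\<omega> \<in> space S. \<exists>k\<le>j * n. a < cocycle f w (walk k \<omega>)} \<in> sets S" .
  have "prob {\<omega> \<in> space S. a < peak n j f w \<omega>} \<le> prob {\<omega> \<in> space S. \<exists>k\<le>j * n. a < cocycle f w (walk k \<omega>)}"
    by (rule P.finite_measure_mono[OF _ meas], rule Collect_mono, rule impI)
      (erule conjE, rule conjI, assumption, rule peak_greater[OF assms(2)])
  then show ?thesis using assms(3)[of "j * n"] by linarith
qed

lemma cocycle_walk_comb_seq: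
  assumes "admissible f w" "\<omega> \<in> space S" "\<omega>' \<in> space S"
  shows "cocycle f w (walk (n + k) (comb_seq n \<omega> \<omega>'))
    = cocycle f w (walk n \<omega>) + cocycle (f v* walk n \<omega>) (pullback (walk n \<omega>) w) (walk k \<omega>')"
  unfolding walk_comb_seq using assms by (intro cocycle_mult walk_SL)

text \<open>The increment of the first block shifts all later partial sums; the value 0 in the later
  maximum stands for time \<open>n\<close> itself.\<close>

lemma peak_comb_seq:
  assumes "admissible f w" "\<omega> \<in> space S" "\<omega>' \<in> space S"
  shows "cocycle f w (walk n \<omega>) + peak n j (f v* walk n \<omega>) (pullback (walk n \<omega>) w) \<omega>'
    \<le> peak n (Suc j) f w (comb_seq n \<omega> \<omega>')"
proof (induction j)
  case 0
  show ?case using walk_comb_seq[of n 0 \<omega> \<omega>'] by simp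
next
  case (Suc j)
  have "cocycle f w (walk (n + Suc j * n) (comb_seq n \<omega> \<omega>')) \<le> peak n (Suc (Suc j)) f w (comb_seq n \<omega> \<omega>')"
    by simp
  then have "cocycle f w (walk n \<omega>) + cocycle (f v* walk n \<omega>) (pullback (walk n \<omega>) w) (walk (Suc j * n) \<omega>')
      \<le> peak n (Suc (Suc j)) f w (comb_seq n \<omega> \<omega>')"
    unfolding cocycle_walk_comb_seq[OF assms] .
  moreover have "peak n (Suc j) f w (comb_seq n \<omega> \<omega>') \<le> peak n (Suc (Suc j)) f w (comb_seq n \<omega> \<omega>')" by simp
  ultimately show ?case
    using Suc unfolding peak.simps(2)[of n j "f v* walk n \<omega>"] by linarith
qed

text \<open>
  Kesten's argument in a quantitative form: the truncated maximum of the partial sums is a potential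
  that dominates the increments with a strict gain, because the partial sums tend to \<open>-\<infinity>\<close>
  in probability.
\<close>

lemma cocycle_drift:
  "\<exists>n. \<forall>f w. admissible f w \<longrightarrow> expectation (\<lambda>\<omega>. cocycle f w (walk n \<omega>)) \<le> - 1"
proof -
  have "0 < (1 / 8 :: real)" by simp
  from cocycle_upper_tail[OF this] obtain A where A: "0 < A"
    "\<And>f w n. admissible f w \<Longrightarrow> prob {\<omega> \<in> space S. \<exists>k\<le>n. A < cocycle f w (walk k \<omega>)} \<le> 1 / 8" by blast
  \<comment> \<open>The gain \<open>K - A = 4\<close> must exceed the losses by 1. The two bad
    events have probability at most \<open>1 / 8\<close> and cost \<open>1 / 2\<close> each;
    truncation costs at most 1 through \<open>\<eta>\<close> and at most 1 through
    \<open>s\<close>.\<close>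
  define K where "K = A + 4"
  obtain n where n: "\<And>f w. admissible f w \<Longrightarrow> prob {\<omega> \<in> space S. - K < cocycle f w (walk n \<omega>)} \<le> 1 / 8"
    using cocycle_to_minus_infinity[of "1 / 8" K] by auto
  define \<kappa> where "\<kappa> \<omega> = 4 * ln (distortion (walk n \<omega>))" for \<omega>
  have \<kappa>0: "0 \<le> \<kappa> \<omega>" for \<omega> by (simp add: \<kappa>_def ln_distortion_nonneg)
  have \<kappa>_int: "integrable S \<kappa>" "integrable S (\<lambda>\<omega>. (\<kappa> \<omega>)\<^sup>2)"
    unfolding \<kappa>_def by (rule ln_distortion_integrable ln_distortion_square_integrable)+
  \<comment> \<open>Chosen so that \<open>2 * \<kappa>\<close> times a tail of probability
    \<open>\<eta>\<close> costs at most 1 on average; the added 1 avoids a division by zero.\<close>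
  define \<eta> where "\<eta> = 1 / (2 * expectation \<kappa> + 1)"
  have E0: "0 \<le> expectation \<kappa>" "0 \<le> expectation (\<lambda>\<omega>. (\<kappa> \<omega>)\<^sup>2)" using \<kappa>0 by (auto intro: integral_nonneg_AE)
  then have \<eta>: "0 < \<eta>" "2 * expectation \<kappa> * \<eta> \<le> 1" by (auto simp: \<eta>_def)
  obtain a where a: "0 < a" "\<And>f w n. admissible f w \<Longrightarrow> prob {\<omega> \<in> space S. \<exists>k\<le>n. a < cocycle f w (walk k \<omega>)} \<le> \<eta>"
    using cocycle_upper_tail[OF \<eta>(1)] by blast
  \<comment> \<open>Twice \<open>A\<close> is required by
    \<open>truncated_maximum_increment\<close>, twice \<open>a\<close> makes it unlikely that a
    maximum exceeds \<open>s / 2\<close>, and the last term keeps the quadratic error at most 1 on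
    average.\<close>
  define s where "s = max (2 * A) (max (2 * a) (4 * expectation (\<lambda>\<omega>. (\<kappa> \<omega>)\<^sup>2) + 1))"
  have s: "A \<le> s / 2" "a \<le> s / 2" "4 * expectation (\<lambda>\<omega>. (\<kappa> \<omega>)\<^sup>2) \<le> s" "0 < s" using A(1) by (auto simp: s_def)
  define b where "b = s / 2"
  have b: "a \<le> b" using s by (simp add: b_def)
  have s1: "4 * expectation (\<lambda>\<omega>. (\<kappa> \<omega>)\<^sup>2) / s \<le> 1" using s by (simp add: pos_divide_le_eq)
  have min_int: "integrable S (\<lambda>\<omega>. min (peak n j f w \<omega>) s)" for j f w
    using peak_measurable[of n j f w] s(4) peak_nonneg[of n j f w]
    by (intro P.integrable_const_bound[of _ s]) (auto simp: min_def)
  \<comment> \<open>Every block gains 1 against the potential, which never exceeds \<open>s\<close>.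
    Once the number of blocks is at least \<open>s + 1\<close>, the expectation is at most
    -1.\<close>
  have main: "expectation (\<lambda>\<omega>. cocycle f w (walk (j * n) \<omega>))
      \<le> expectation (\<lambda>\<omega>. min (peak n j f w \<omega>) s) - real j"
    if "admissible f w" for j f w
    using that
  proof (induction j arbitrary: f w)
    case 0
    then show ?case using s(4) by (simp add: cocycle_one)
  next
    case (Suc j)
    note adm = Suc.prems
    let ?X = "\<lambda>\<omega>. \<integral>\<omega>'. cocycle f w (walk (Suc j * n) (comb_seq n \<omega> \<omega>')) \<partial>S"
    let ?Z = "\<lambda>\<omega>. \<integral>\<omega>'. min (peak n (Suc j) f w (comb_seq n \<omega> \<omega>')) s \<partial>S"
    let ?Y = "\<lambda>\<omega>. cocycle f w (walk n \<omega>)"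
    let ?R = "\<lambda>\<omega>. 4 * indicat_real {\<omega> \<in> space S. - K < ?Y \<omega>} \<omega> + 2 * \<eta> * \<kappa> \<omega> + 4 / s * (\<kappa> \<omega>)\<^sup>2"
    have Yset: "{\<omega> \<in> space S. - K < ?Y \<omega>} \<in> sets S" using cocycle_walk_measurable by measurable
    have R_int: "integrable S ?R"
      using Yset by (intro Bochner_Integration.integrable_add integrable_mult_right integrable_real_indicator
          \<kappa>_int)
        (simp_all add: P.emeasure_eq_measure)
    \<comment> \<open>With the first block frozen, \<open>?Y \<omega>\<close> and
      \<open>\<kappa> \<omega>\<close> are constants and only the later maximum is random. Its tail
      bounds hold for the moved pair as well, so \<open>\<kappa> \<omega>\<close> simply multiplies
      a small probability.\<close>
    have pt: "?X \<omega> \<le> ?Z \<omega> - real j - 7 / 2 + ?R \<omega>" if w: "\<omega> \<in> space S" for \<omega>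
    proof -
      let ?f = "f v* walk n \<omega>" and ?w = "pullback (walk n \<omega>) w"
      have adm': "admissible ?f ?w" using adm w by (intro admissible_action walk_SL)
      let ?m = "\<lambda>\<omega>'. peak n j ?f ?w \<omega>'"
      have "?X \<omega> = (\<integral>\<omega>'. ?Y \<omega> + cocycle ?f ?w (walk (j * n) \<omega>') \<partial>S)"
        using cocycle_walk_comb_seq[OF adm w, of _ n "j * n"] by (intro Bochner_Integration.integral_cong) auto
      also have "\<dots> = ?Y \<omega> + expectation (\<lambda>\<omega>'. cocycle ?f ?w (walk (j * n) \<omega>'))"
        using cocycle_integrable[OF adm'] by (simp add: P.prob_space)
      also have "\<dots> \<le> ?Y \<omega> + (expectation (\<lambda>\<omega>'. min (?m \<omega>') s) - real j)"
        using Suc.IH[OF adm'] by simp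
      finally have X: "?X \<omega> \<le> ?Y \<omega> + (expectation (\<lambda>\<omega>'. min (?m \<omega>') s) - real j)" .
      let ?IA = "indicat_real {\<omega>' \<in> space S. A < ?m \<omega>'}" and ?Is = "indicat_real {\<omega>' \<in> space S. b < ?m \<omega>'}"
      have ind_int: "integrable S ?IA" "integrable S ?Is"
        using peak_event_measurable by (auto intro!: integrable_real_indicator simp: P.emeasure_eq_measure)
      let ?L = "\<lambda>\<omega>'. min (?m \<omega>') s + (?Y \<omega> + 4 * (1 - of_bool (- K
          < ?Y \<omega>)) - 4 * (\<kappa> \<omega>)\<^sup>2 / s) - 4 * ?IA \<omega>' - 2 * \<kappa> \<omega> * ?Is \<omega>'"
      have "expectation ?L = expectation (\<lambda>\<omega>'. min (?m \<omega>') s) + (?Y \<omega> + 4 * (1 - of_bool (- K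
          < ?Y \<omega>)) - 4 * (\<kappa> \<omega>)\<^sup>2 / s)
          - 4 * prob {\<omega>' \<in> space S. A < ?m \<omega>'} - 2 * \<kappa> \<omega> * prob {\<omega>' \<in> space S. b < ?m \<omega>'}"
        using min_int ind_int peak_event_measurable by (simp add: P.prob_space)
      moreover have "expectation ?L \<le> ?Z \<omega>"
      proof (rule integral_mono)
        show "integrable S ?L"
          using min_int ind_int by (intro Bochner_Integration.integrable_diff Bochner_Integration.integrable_add
              integrable_mult_right) auto
        have meas: "(\<lambda>\<omega>'. comb_seq n \<omega> \<omega>') \<in> measurable S S" using w by (intro measurable_comb_seq') auto
        show "integrable S (\<lambda>\<omega>'. min (peak n (Suc j) f w (comb_seq n \<omega> \<omega>')) s)"
          using measurable_compose[OF meas peak_measurable[of n "Suc j" f w]] s(4) peak_nonneg[of n "Suc j" f w]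
          by (intro P.integrable_const_bound[of _ s]) (auto simp: min_def simp del: peak.simps)
        fix \<omega>' assume w': "\<omega>' \<in> space S"
        have "?Y \<omega> + (K - A) * (1 - of_bool (- K < ?Y \<omega>) - of_bool (A < ?m \<omega>')) - 2 * \<kappa> \<omega> * of_bool (b
            < ?m \<omega>') - 4 * (\<kappa> \<omega>)\<^sup>2 / s
            \<le> min (peak n (Suc j) f w (comb_seq n \<omega> \<omega>')) s - min (?m \<omega>') s"
          using abs_cocycle_le[OF adm walk_SL[OF w]] peak_comb_seq[OF adm w w'] peak_nonneg A(1) s
          unfolding b_def by (intro truncated_maximum_increment) (auto simp: \<kappa>_def K_def simp del: peak.simps)
        then show "?L \<omega>' \<le> min (peak n (Suc j) f w (comb_seq n \<omega> \<omega>')) s"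
          using w' by (simp add: K_def indicator_def of_bool_def algebra_simps split: if_splits del: peak.simps)
      qed
      moreover have "prob {\<omega>' \<in> space S. A < ?m \<omega>'} \<le> 1 / 8"
        using A by (intro peak_tail[OF adm']) (auto intro: adm')
      moreover have "prob {\<omega>' \<in> space S. b < ?m \<omega>'} \<le> \<eta>"
      proof -
        have "prob {\<omega>' \<in> space S. b < ?m \<omega>'} \<le> prob {\<omega>' \<in> space S. a < ?m \<omega>'}"
          using b peak_event_measurable by (intro P.finite_measure_mono) auto
        also have "\<dots> \<le> \<eta>" using a by (intro peak_tail[OF adm']) (auto intro: adm')
        finally show ?thesis .
      qed
      then have "2 * \<kappa> \<omega> * prob {\<omega>' \<in> space S. b < ?m \<omega>'} \<le> 2 * \<kappa> \<omega> * \<eta>"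
        using \<kappa>0[of \<omega>] by (intro mult_left_mono) auto
      moreover have "(of_bool (- K < ?Y \<omega>) :: real) = indicat_real {\<omega> \<in> space S. - K < ?Y \<omega>} \<omega>"
        using w by (simp add: indicator_def of_bool_def)
      ultimately show ?thesis using X by (simp add: algebra_simps)
    qed
    have int_c: "integrable S (\<lambda>\<omega>. cocycle f w (walk (Suc j * n) \<omega>))" by (rule cocycle_integrable[OF adm])
    have "expectation (\<lambda>\<omega>. cocycle f w (walk (Suc j * n) \<omega>)) = expectation ?X"
      by (rule integral_comb_seq(1)[OF int_c])
    also have "\<dots> \<le> expectation (\<lambda>\<omega>. ?Z \<omega> - real j - 7 / 2 + ?R \<omega>)"
    proof (rule integral_mono[OF integral_comb_seq(2)[OF int_c] _ pt])
      show "integrable S (\<lambda>\<omega>. ?Z \<omega> - real j - 7 / 2 + ?R \<omega>)"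
      proof -
        have "integrable S (\<lambda>\<omega>. Z \<omega> - real j - 7 / 2 + R \<omega>)"
          if "integrable S Z" "integrable S R" for Z R :: "(nat \<Rightarrow> 'k ^ 'd ^ 'd) \<Rightarrow> real"
          using that by simp
        from this[OF integral_comb_seq(2)[OF min_int[of "Suc j" f w], of n] R_int] show ?thesis .
      qed
    qed
    also have "\<dots> = expectation ?Z - real j - 7 / 2 + expectation ?R"
    proof -
      have "expectation (\<lambda>\<omega>. Z \<omega> - real j - 7 / 2 + R \<omega>) = expectation Z - real j - 7 / 2 + expectation R"
        if "integrable S Z" "integrable S R" for Z R :: "(nat \<Rightarrow> 'k ^ 'd ^ 'd) \<Rightarrow> real"
        using that by (simp add: P.prob_space)
      from this[OF integral_comb_seq(2)[OF min_int[of "Suc j" f w], of n] R_int] show ?thesis .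
    qed
    also have "expectation ?Z = expectation (\<lambda>\<omega>. min (peak n (Suc j) f w \<omega>) s)"
      by (rule integral_comb_seq(1)[OF min_int, symmetric])
    also have "expectation ?R = 4 * prob {\<omega> \<in> space S. - K
        < ?Y \<omega>} + 2 * \<eta> * expectation \<kappa> + 4 / s * expectation (\<lambda>\<omega>. (\<kappa> \<omega>)\<^sup>2)"
      using Yset \<kappa>_int by (simp add: P.emeasure_eq_measure)
    also have "\<dots> \<le> 4 * (1 / 8) + 1 + 1"
      using n[OF adm] \<eta>(2) s1 by (intro add_mono) (auto simp: mult_ac)
    finally show ?case by simp
  qed
  obtain j :: nat where j: "s + 1 \<le> real j" using real_arch_simple by blast
  have "expectation (\<lambda>\<omega>. cocycle f w (walk (j * n) \<omega>)) \<le> - 1" if "admissible f w" for f w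
  proof -
    have "expectation (\<lambda>\<omega>. min (peak n j f w \<omega>) s) \<le> expectation (\<lambda>\<omega>. s)"
      by (intro integral_mono min_int) auto
    then show ?thesis using main[OF that, of j] j by (simp add: P.prob_space)
  qed
  then show ?thesis by blast
qed

section \<open>Exponential contraction of the cocycle\<close>

lemma exp_cocycle_integrable:
  assumes adm: "admissible f w" and \<alpha>: "0 < \<alpha>" "4 * \<alpha> \<le> \<beta>"
  shows "integrable S (\<lambda>\<omega>. exp (\<alpha> * cocycle f w (walk n \<omega>)))"
proof (rule Bochner_Integration.integrable_bound[OF distortion_integrable])
  show "(\<lambda>\<omega>. exp (\<alpha> * cocycle f w (walk n \<omega>))) \<in> borel_measurable S"
    using cocycle_walk_measurable by measurable
  show "AE \<omega> in S. norm (exp (\<alpha> * cocycle f w (walk n \<omega>))) \<le> norm (distortion (walk n \<omega>) powr \<beta>)"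
  proof (rule AE_I2)
    fix \<omega> assume w: "\<omega> \<in> space S"
    let ?D = "distortion (walk n \<omega>)"
    have "\<alpha> * cocycle f w (walk n \<omega>) \<le> \<alpha> * (4 * ln ?D)"
      using abs_cocycle_le[OF adm walk_SL[OF w], of n] \<alpha>(1) by (intro mult_left_mono) auto
    also have "\<dots> = (4 * \<alpha>) * ln ?D" by simp
    also have "\<dots> \<le> \<beta> * ln ?D" using \<alpha>(2) ln_distortion_nonneg by (intro mult_right_mono)
    finally show "norm (exp (\<alpha> * cocycle f w (walk n \<omega>))) \<le> norm (?D powr \<beta>)"
      using distortion_ge_1[of "walk n \<omega>"] by (simp add: powr_def)
  qed
qed

text \<open>For small \<open>\<alpha>\<close> a second order expansion turns the drift into
  \<open>1 - \<alpha> + \<alpha>\<^sup>2 * B\<close>, which is at most \<open>q\<close>. Since drift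
  and second order term are uniform in the pair, blocks can be multiplied by the Markov
  property.\<close>

lemma exp_cocycle_contraction:
  obtains n \<alpha> q where "0 < \<alpha>" "1 / 2 \<le> q" "q < 1"
    "\<And>f w m. admissible f w \<Longrightarrow> integrable S (\<lambda>\<omega>. exp (\<alpha> * cocycle f w (walk (m * n) \<omega>)))"
    "\<And>f w m. admissible f w \<Longrightarrow> expectation (\<lambda>\<omega>. exp (\<alpha> * cocycle f w (walk (m * n) \<omega>))) \<le> q ^ m"
proof -
  obtain n where n: "\<And>f w. admissible f w \<Longrightarrow> expectation (\<lambda>\<omega>. cocycle f w (walk n \<omega>)) \<le> - 1"
    using cocycle_drift by blast
  \<comment> \<open>Bounds the mean of the quadratic remainder. The square of the cocycle is at most
    \<open>(16 / \<beta>)\<^sup>2\<close> times the power \<open>\<beta> / 2\<close> of the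
    distortion, and the exponential factor contributes another \<open>\<beta> / 2\<close>.\<close>
  define B where "B = 256 / \<beta>\<^sup>2 * C ^ Suc n"
  have B: "0 < B" using \<beta> C by (simp add: B_def)
  \<comment> \<open>The bound \<open>\<beta> / 8\<close> keeps the exponential factor below the
    power \<open>\<beta> / 2\<close> of the distortion, \<open>1 / (2 * B)\<close> makes the
    remainder at most \<open>\<alpha> / 2\<close>, and 1 keeps \<open>q\<close> away from 0.\<close>
  define \<alpha> where "\<alpha> = min (\<beta> / 8) (min 1 (1 / (2 * B)))"
  have "\<alpha> \<le> \<beta> / 8" "\<alpha> \<le> 1 / (2 * B)" by (simp_all add: \<alpha>_def)
  then have \<alpha>: "0 < \<alpha>" "8 * \<alpha> \<le> \<beta>" "\<alpha> \<le> 1" "2 * \<alpha> * B \<le> 1"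
    using \<beta> B by (simp_all add: \<alpha>_def pos_le_divide_eq mult_ac)
  define q where "q = 1 - \<alpha> / 2"
  have q: "1 / 2 \<le> q" "q < 1" using \<alpha> by (auto simp: q_def)
  have int: "integrable S (\<lambda>\<omega>. exp (\<alpha> * cocycle f w (walk k \<omega>)))" if "admissible f w" for f w k
    using exp_cocycle_integrable[OF that] \<alpha> by simp
  have one: "expectation (\<lambda>\<omega>. exp (\<alpha> * cocycle f w (walk n \<omega>))) \<le> q" if adm: "admissible f w" for f w
  proof -
    let ?Y = "\<lambda>\<omega>. cocycle f w (walk n \<omega>)" and ?D = "\<lambda>\<omega>. distortion (walk n \<omega>)"
    have pt: "exp (\<alpha> * ?Y \<omega>) \<le> 1 + \<alpha> * ?Y \<omega> + \<alpha>\<^sup>2 * (256 / \<beta>\<^sup>2) * ?D \<omega> powr \<beta>" if w: "\<omega> \<in> space S" for \<omega>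
    proof -
      let ?L = "ln (?D \<omega>)"
      have D: "1 \<le> ?D \<omega>" by (rule distortion_ge_1)
      have Y: "\<bar>?Y \<omega>\<bar> \<le> 4 * ?L" by (rule abs_cocycle_le[OF adm walk_SL[OF w]])
      have "4 * ?L \<le> 16 / \<beta> * ?D \<omega> powr (\<beta> / 4)"
        using ln_distortion_le[of "\<beta> / 4" "walk n \<omega>"] \<beta> by simp
      then have "\<bar>?Y \<omega>\<bar> \<le> 16 / \<beta> * ?D \<omega> powr (\<beta> / 4)" using Y by linarith
      then have "\<bar>?Y \<omega>\<bar>\<^sup>2 \<le> (16 / \<beta> * ?D \<omega> powr (\<beta> / 4))\<^sup>2" by (intro power_mono) auto
      then have Y2: "(?Y \<omega>)\<^sup>2 \<le> 256 / \<beta>\<^sup>2 * ?D \<omega> powr (\<beta> / 2)"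
        using D by (simp add: power_mult_distrib power_divide powr_power)
      have "\<bar>\<alpha> * ?Y \<omega>\<bar> \<le> \<alpha> * (4 * ?L)" using Y \<alpha> by (simp add: abs_mult)
      also have "\<dots> \<le> \<beta> / 2 * ?L" using mult_right_mono[OF \<alpha>(2) ln_distortion_nonneg[of "walk n \<omega>"]] by simp
      finally have "exp \<bar>\<alpha> * ?Y \<omega>\<bar> \<le> ?D \<omega> powr (\<beta> / 2)" using D by (simp add: powr_def)
      then have "(?Y \<omega>)\<^sup>2 * exp \<bar>\<alpha> * ?Y \<omega>\<bar> \<le> (256 / \<beta>\<^sup>2 * ?D \<omega> powr (\<beta> / 2)) * ?D \<omega> powr (\<beta> / 2)"
        using Y2 by (intro mult_mono) auto
      also have "\<dots> = 256 / \<beta>\<^sup>2 * ?D \<omega> powr \<beta>" by (simp add: powr_add[symmetric])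
      finally have "\<alpha>\<^sup>2 * ((?Y \<omega>)\<^sup>2 * exp \<bar>\<alpha> * ?Y \<omega>\<bar>) \<le> \<alpha>\<^sup>2 * (256 / \<beta>\<^sup>2 * ?D \<omega> powr \<beta>)"
        by (intro mult_left_mono) auto
      then show ?thesis using exp_le_quadratic[of "\<alpha> * ?Y \<omega>"] by (simp add: power_mult_distrib mult.assoc)
    qed
    have int_Y: "integrable S ?Y" by (rule cocycle_integrable[OF adm])
    have "expectation (\<lambda>\<omega>. exp (\<alpha> * ?Y \<omega>)) \<le> expectation (\<lambda>\<omega>. 1 + \<alpha> * ?Y \<omega> + \<alpha>\<^sup>2 * (256 / \<beta>\<^sup>2) * ?D \<omega> powr \<beta>)"
      by (intro integral_mono int adm pt Bochner_Integration.integrable_add integrable_mult_right int_Y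
          distortion_integrable) simp
    also have "\<dots> = 1 + \<alpha> * expectation ?Y + \<alpha>\<^sup>2 * (256 / \<beta>\<^sup>2) * expectation (\<lambda>\<omega>. ?D \<omega> powr \<beta>)"
    proof -
      have "expectation (\<lambda>\<omega>. 1 + x * F \<omega> + y * G \<omega>) = 1 + x * expectation F + y * expectation G"
        if "integrable S F" "integrable S G" for x y and F G :: "(nat \<Rightarrow> 'k ^ 'd ^ 'd) \<Rightarrow> real"
        using that by (simp add: P.prob_space)
      from this[OF int_Y distortion_integrable] show ?thesis .
    qed
    also have "\<dots> \<le> 1 + \<alpha> * (- 1) + \<alpha>\<^sup>2 * (256 / \<beta>\<^sup>2) * C ^ Suc n"
      using \<alpha>(1) by (intro add_mono mult_left_mono n[OF adm] distortion_expectation) auto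
    also have "\<dots> = 1 - \<alpha> + \<alpha> * (\<alpha> * B)" by (simp add: B_def power2_eq_square)
    also have "\<dots> \<le> 1 - \<alpha> + \<alpha> * (1 / 2)" using \<alpha> by (intro add_left_mono mult_left_mono) auto
    finally show ?thesis by (simp add: q_def)
  qed
  have "expectation (\<lambda>\<omega>. exp (\<alpha> * cocycle f w (walk (m * n) \<omega>))) \<le> q ^ m" if "admissible f w" for f w m
    using that
  proof (induction m arbitrary: f w)
    case 0
    then show ?case by (simp add: cocycle_one P.prob_space)
  next
    case (Suc m)
    note adm = Suc.prems
    have "expectation (\<lambda>\<omega>. exp (\<alpha> * cocycle f w (walk (n + m * n) \<omega>)))
        = expectation (\<lambda>\<omega>. \<integral>\<omega>'. exp (\<alpha> * cocycle f w (walk (n + m * n) (comb_seq n \<omega> \<omega>'))) \<partial>S)"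
      by (rule integral_comb_seq(1)[OF int[OF adm]])
    also have "\<dots> \<le> expectation (\<lambda>\<omega>. exp (\<alpha> * cocycle f w (walk n \<omega>)) * q ^ m)"
    proof (rule integral_mono[OF integral_comb_seq(2)[OF int[OF adm]]])
      show "integrable S (\<lambda>\<omega>. exp (\<alpha> * cocycle f w (walk n \<omega>)) * q ^ m)"
        by (intro integrable_mult_left int adm)
      fix \<omega> assume w: "\<omega> \<in> space S"
      let ?f = "f v* walk n \<omega>" and ?w = "pullback (walk n \<omega>) w"
      have adm': "admissible ?f ?w" using adm w by (intro admissible_action walk_SL)
      have "(\<integral>\<omega>'. exp (\<alpha> * cocycle f w (walk (n + m * n) (comb_seq n \<omega> \<omega>'))) \<partial>S)
          = (\<integral>\<omega>'. exp (\<alpha> * cocycle f w (walk n \<omega>)) * exp (\<alpha> * cocycle ?f ?w (walk (m * n) \<omega>')) \<partial>S)"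
        by (intro Bochner_Integration.integral_cong refl) (simp add: cocycle_walk_comb_seq[OF adm w]
            distrib_left exp_add)
      also have "\<dots>
          = exp (\<alpha> * cocycle f w (walk n \<omega>)) * expectation (\<lambda>\<omega>'. exp (\<alpha> * cocycle ?f ?w (walk (m * n) \<omega>')))"
        by simp
      also have "\<dots> \<le> exp (\<alpha> * cocycle f w (walk n \<omega>)) * q ^ m"
        by (intro mult_left_mono Suc.IH adm') simp
      finally show "(\<integral>\<omega>'. exp (\<alpha> * cocycle f w (walk (n + m * n) (comb_seq n \<omega> \<omega>'))) \<partial>S)
          \<le> exp (\<alpha> * cocycle f w (walk n \<omega>)) * q ^ m" .
    qed
    also have "\<dots> = expectation (\<lambda>\<omega>. exp (\<alpha> * cocycle f w (walk n \<omega>))) * q ^ m" by simp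
    also have "\<dots> \<le> q * q ^ m" using q by (intro mult_right_mono one adm) auto
    finally show ?case by simp
  qed
  then show thesis using that[OF \<alpha>(1) q int] by blast
qed

section \<open>Hoelder regularity of the stationary measure\<close>

lemma stretch_le_exp_cocycle:
  assumes f: "f \<noteq> 0" and g: "g \<in> SL" and b: "0 \<le> b" "b < stretch f g"
  shows "\<exists>i. admissible f (wedge f (axis i 1)) \<and> b / (2 * real CARD('d))
      < exp (cocycle f (wedge f (axis i 1 :: 'k ^ 'd)) g)"
proof -
  let ?w = "\<lambda>i. wedge f (axis i 1 :: 'k ^ 'd)" and ?d = "real CARD('d)"
  let ?t = "\<lambda>i. mnorm (pullback g (?w i)) * vnorm f / (vnorm (f v* g))\<^sup>2"
  have pos: "0 < vnorm f" "0 < vnorm (f v* g)" using vnorm_pos[OF f] vnorm_pos[OF SL_vector_matrix_nz[OF g f]]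
    by auto
  \<comment> \<open>One of the \<open>d\<close> summands is at least average. The further factor 2
    comes from \<open>mnorm_wedge_le\<close>, and \<open>0 \<le> b\<close> forces the chosen wedge
    to be non-zero.\<close>
  have "\<exists>i. b / ?d < ?t i"
  proof (rule ccontr)
    assume "\<not> (\<exists>i. b / ?d < ?t i)"
    then have "stretch f g \<le> (\<Sum>i\<in>(UNIV :: 'd set). b / ?d)"
      unfolding stretch_def by (intro sum_mono) (simp add: not_less)
    then show False using b by simp
  qed
  then obtain i where i: "b / ?d < ?t i" by blast
  have wi: "?w i \<noteq> 0"
  proof
    assume "?w i = 0"
    then have "mnorm (pullback g (?w i)) = 0" by (simp add: pullback_def mnorm_eq_0_iff)
    then have "b / ?d < 0" using i by simp
    then show False using b by (simp add: divide_less_0_iff)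
  qed
  then have adm: "admissible f (?w i)" using f by (simp add: admissible_def alternating_wedge)
  have pos': "0 < mnorm (?w i)" "0 < mnorm (pullback g (?w i))"
    using mnorm_pos[OF wi] mnorm_pos[OF SL_pullback_nz[OF g wi]] by auto
  have "2 * ln (vnorm (f v* g) / vnorm f) = ln ((vnorm (f v* g) / vnorm f)\<^sup>2)"
    using pos by (simp add: ln_realpow)
  then have e:
    "exp (cocycle f (?w i) g) = mnorm (pullback g (?w i)) / mnorm (?w i) / (vnorm (f v* g) / vnorm f)\<^sup>2"
    using pos pos' by (simp add: cocycle_def exp_diff)
  have "?t i = exp (cocycle f (?w i) g) * (mnorm (?w i) / vnorm f)"
    unfolding e using pos pos' by (simp add: power2_eq_square)
  also have "\<dots> \<le> exp (cocycle f (?w i) g) * 2"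
    using mnorm_wedge_le[of f "axis i 1"] pos
      by (intro mult_left_mono) (simp_all add: vnorm_axis pos_divide_le_eq)
  finally have "b / (2 * ?d) < exp (cocycle f (?w i) g)" using i by simp
  then show ?thesis using adm by blast
qed

lemma mass_near_le:
  assumes g: "g \<in> SL" and f: "f \<noteq> 0" and \<epsilon>: "0 \<le> \<epsilon>" and b: "stretch f g \<le> b"
    and small: "2 * (real CARD('d))\<^sup>2 * \<epsilon> * vnorm f * mnorm g \<le> vnorm (f v* g)"
  shows "mass (near f \<epsilon>) g \<le> \<nu>.prob (near (f v* g) (2 * real CARD('d) * \<epsilon> * b))"
  unfolding mass_near[OF g]
proof (rule \<nu>.finite_measure_mono)
  show "near (f v* g) (2 * real CARD('d) * \<epsilon> * b) \<in> \<nu>.events" using near_sets by (simp add: sets_\<nu>)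
  show "{L \<in> proj_space. absval (pairing f (g *v rep L)) \<le> \<epsilon> * vnorm f * vnorm (g *v rep L)}
      \<subseteq> near (f v* g) (2 * real CARD('d) * \<epsilon> * b)"
  proof safe
    fix L :: "('k ^ 'd) set"
    assume L: "L \<in> proj_space" "absval (pairing f (g *v rep L)) \<le> \<epsilon> * vnorm f * vnorm (g *v rep L)"
    have "absval (pairing (f v* g) (rep L))
        \<le> 2 * real CARD('d) * \<epsilon> * stretch f g * vnorm (f v* g) * vnorm (rep L)"
      by (rule pairing_contraction[OF L(2) \<epsilon> small SL_vector_matrix_nz[OF g f]])
    also have "\<dots> \<le> 2 * real CARD('d) * \<epsilon> * b * vnorm (f v* g) * vnorm (rep L)"
      using b \<epsilon> by (intro mult_right_mono mult_left_mono vnorm_nonneg) auto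
    finally show "L \<in> near (f v* g) (2 * real CARD('d) * \<epsilon> * b)" using L(1) by (simp add: near_def)
  qed
qed

text \<open>Passing from scale \<open>t ^ m\<close> to \<open>t ^ Suc m\<close> uses
  \<open>m * n\<close> steps of the walk, so that both exceptional events have probability of order
  \<open>q ^ m\<close>: a stretch above \<open>b\<close> by the contraction of the cocycle, a
  distortion of order \<open>1 / t ^ m\<close> by its moment.\<close>

lemma hoelder_regularity:
  obtains t q R where "0 < t" "t < 1" "0 < q" "q < 1" "0 \<le> R"
    "\<And>f m. f \<noteq> 0 \<Longrightarrow> \<nu>.prob (near f (t ^ m)) \<le> R * q ^ m"
proof -
  obtain n \<alpha> q where \<alpha>: "0 < \<alpha>" and q: "1 / 2 \<le> q" "q < 1"
    and int: "\<And>f w m. admissible f w \<Longrightarrow> integrable S (\<lambda>\<omega>. exp (\<alpha> * cocycle f w (walk (m * n) \<omega>)))"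
    and decay: "\<And>f w m. admissible f w \<Longrightarrow> expectation (\<lambda>\<omega>. exp (\<alpha> * cocycle f w (walk (m * n) \<omega>))) \<le> q ^ m"
  proof (rule exp_cocycle_contraction, goal_cases)
    case (1 n \<alpha> q)
    show ?thesis by (rule 1(1)[OF 1(2-)])
  qed
  let ?d = "real CARD('d)"
  \<comment> \<open>The power makes \<open>t powr \<beta> * C ^ n\<close> at most \<open>q\<close>,
    so the scale beats the growth of the distortion in each round; the \<open>1 / 2\<close> keeps
    \<open>t\<close> below 1.\<close>
  define t where "t = min (1 / 2) ((q / C ^ n) powr (1 / \<beta>))"
  have t: "0 < t" "t < 1" using q C by (auto simp: t_def)
  have "t powr \<beta> \<le> ((q / C ^ n) powr (1 / \<beta>)) powr \<beta>"
    using t \<beta> by (intro powr_mono2) (auto simp: t_def)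
  also have "\<dots> = q / C ^ n" using \<beta> q C by (simp add: powr_powr)
  finally have tq: "t powr \<beta> * C ^ n \<le> q" using C by (simp add: field_simps)
  \<comment> \<open>Solves \<open>2 * ?d * t ^ m * b = t ^ Suc m\<close>, the loss in
    \<open>mass_near_le\<close>. The next constant is the level of the cocycle that belongs to a
    stretch \<open>b\<close>.\<close>
  define b where "b = t / (2 * ?d)"
  define c where "c = b / (2 * ?d)"
  have b: "0 < b" "0 < c" using t by (simp_all add: b_def c_def)
  \<comment> \<open>The two summands are the Markov bounds for the stretched and for the distorted
    event.\<close>
  define R where "R = ?d / c powr \<alpha> + (2 * ?d\<^sup>2) powr \<beta> * C"
  have R: "0 \<le> R" using C by (simp add: R_def)
  define P where "P m a \<longleftrightarrow> (\<forall>f. f \<noteq> 0 \<longrightarrow> \<nu>.prob (near f (t ^ m)) \<le> a)" for m a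
  have step: "P m (a + R * q ^ m)" if a: "P (Suc m) a" for m a
    unfolding P_def
  proof (intro allI impI)
    fix f :: "'k ^ 'd" assume f: "f \<noteq> 0"
    let ?w = "\<lambda>i. wedge f (axis i 1 :: 'k ^ 'd)"
    let ?D = "\<lambda>\<omega>. distortion (walk (m * n) \<omega>)"
    \<comment> \<open>A Markov majorant of the event that the cocycle at the \<open>i\<close>-th
      wedge is large. The value is 0 when the wedge vanishes, which happens when \<open>f\<close> is
      a multiple of \<open>axis i 1\<close>.\<close>
    define h where "h i \<omega>
        = (if admissible f (?w i) then exp (\<alpha> * cocycle f (?w i) (walk (m * n) \<omega>)) / c powr \<alpha> else 0)" for i \<omega>
    have h0: "0 \<le> h i \<omega>" for i \<omega> by (simp add: h_def)
    have h_int: "integrable S (h i)" for i unfolding h_def using int[of f "?w i" m]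
      by (cases "admissible f (?w i)") simp_all
    have h_le: "expectation (h i) \<le> q ^ m / c powr \<alpha>" for i
      unfolding h_def using decay[of f "?w i" m] q
        by (cases "admissible f (?w i)") (simp_all add: divide_right_mono)
    let ?e = "2 * ?d\<^sup>2 * t ^ m"
    have e: "0 < ?e" using t by simp
    have a0: "0 \<le> a"
      using order_trans[OF measure_nonneg a[unfolded P_def, rule_format, OF f]] .
    have pt: "mass (near f (t ^ m)) (mat 1 ** walk (m * n) \<omega>) \<le> a + (\<Sum>i\<in>UNIV. h i \<omega>) + ?e powr \<beta> * ?D \<omega> powr \<beta>"
      if w: "\<omega> \<in> space S" for \<omega>
    proof -
      let ?g = "walk (m * n) \<omega>"
      have g: "?g \<in> SL" by (rule walk_SL[OF w])
      have D: "1 \<le> ?D \<omega>" by (rule distortion_ge_1)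
      have sum0: "0 \<le> (\<Sum>i\<in>UNIV. h i \<omega>)" by (intro sum_nonneg h0)
      have pw0: "0 \<le> ?e powr \<beta> * ?D \<omega> powr \<beta>" by simp
      \<comment> \<open>In the first two cases the mass is bounded by 1, and that 1 is charged to
        the distortion term or to some \<open>h i\<close>. In the third case
        \<open>mass_near_le\<close> applies.\<close>
      consider (wild) "vnorm (f v* ?g) < ?e * vnorm f * mnorm ?g" | (stretched) "b < stretch f ?g"
        | (good) "?e * vnorm f * mnorm ?g \<le> vnorm (f v* ?g)" "stretch f ?g \<le> b" by linarith
      then show ?thesis
      proof cases
        case wild
        also have "?e * vnorm f * mnorm ?g = ?e * (mnorm ?g * vnorm f)" by simp
        also have "\<dots> \<le> ?e * (?D \<omega> * vnorm (f v* ?g))"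
          using e by (intro mult_left_mono mnorm_le_distortion_vnorm g) auto
        finally have "1 * vnorm (f v* ?g) < (?e * ?D \<omega>) * vnorm (f v* ?g)" by (simp add: mult.assoc)
        then have "1 < ?e * ?D \<omega>" by (rule mult_right_less_imp_less) (rule vnorm_nonneg)
        then have "1 \<le> (?e * ?D \<omega>) powr \<beta>" using \<beta> by (intro ge_one_powr_ge_zero) auto
        also have "\<dots> = ?e powr \<beta> * ?D \<omega> powr \<beta>" by (rule powr_mult)
        finally show ?thesis using mass_le_1[of "near f (t ^ m)" "mat 1 ** ?g"] sum0 a0 by linarith
      next
        case stretched
        then obtain i where i: "admissible f (?w i)" "c < exp (cocycle f (?w i) ?g)"
          using stretch_le_exp_cocycle[OF f g less_imp_le[OF b(1)]] unfolding c_def by blast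
        have "c powr \<alpha> \<le> exp (cocycle f (?w i) ?g) powr \<alpha>" using i b \<alpha> by (intro powr_mono2) auto
        also have "\<dots> = exp (\<alpha> * cocycle f (?w i) ?g)" by (simp add: powr_def)
        finally have "1 \<le> h i \<omega>" using i(1) b by (simp add: h_def)
        also have "\<dots> \<le> (\<Sum>i\<in>UNIV. h i \<omega>)" using h0 by (intro member_le_sum) auto
        finally show ?thesis using mass_le_1[of "near f (t ^ m)" "mat 1 ** ?g"] pw0 a0 by linarith
      next
        case good
        have "mass (near f (t ^ m)) ?g \<le> \<nu>.prob (near (f v* ?g) (2 * ?d * t ^ m * b))"
          using good t by (intro mass_near_le g f) (simp_all add: mult_ac)
        also have "2 * ?d * t ^ m * b = t ^ Suc m" by (simp add: b_def)
        also have "\<nu>.prob (near (f v* ?g) (t ^ Suc m)) \<le> a"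
          using a SL_vector_matrix_nz[OF g f] by (simp add: P_def)
        finally show ?thesis using sum0 pw0 unfolding matrix_mul_lid by linarith
      qed
    qed
    have "\<nu>.prob (near f (t ^ m)) = expectation (\<lambda>\<omega>. mass (near f (t ^ m)) (mat 1 ** walk (m * n) \<omega>))"
      using mass_harmonic[OF near_sets SL_one] by (simp only: mass_near_one[symmetric])
    also have "\<dots> \<le> expectation (\<lambda>\<omega>. a + (\<Sum>i\<in>UNIV. h i \<omega>) + ?e powr \<beta> * ?D \<omega> powr \<beta>)"
      by (intro integral_mono mass_walk_integrable near_sets SL_one pt Bochner_Integration.integrable_add
          Bochner_Integration.integrable_sum h_int integrable_mult_right distortion_integrable) simp
    also have "\<dots> = a + (\<Sum>i\<in>UNIV. expectation (h i)) + ?e powr \<beta> * expectation (\<lambda>\<omega>. ?D \<omega> powr \<beta>)"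
    proof -
      have "expectation (\<lambda>\<omega>. a + F \<omega> + y * G \<omega>) = a + expectation F + y * expectation G"
        if "integrable S F" "integrable S G" for y and F G :: "(nat \<Rightarrow> 'k ^ 'd ^ 'd) \<Rightarrow> real"
        using that by (simp add: P.prob_space)
      from this[OF Bochner_Integration.integrable_sum[OF h_int] distortion_integrable]
      show ?thesis by (simp add: Bochner_Integration.integral_sum[OF h_int])
    qed
    also have "\<dots> \<le> a + (\<Sum>i\<in>(UNIV :: 'd set). q ^ m / c powr \<alpha>) + ?e powr \<beta> * C ^ Suc (m * n)"
      by (intro add_mono sum_mono mult_left_mono h_le distortion_expectation) auto
    also have "?e powr \<beta> * C ^ Suc (m * n) = (2 * ?d\<^sup>2) powr \<beta> * C * (t powr \<beta> * C ^ n) ^ m"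
    proof -
      have "(t ^ m) powr \<beta> = (t powr \<beta>) ^ m"
        using t by (simp add: powr_realpow[symmetric] powr_powr mult.commute)
      moreover have "?e powr \<beta> = (2 * ?d\<^sup>2) powr \<beta> * (t ^ m) powr \<beta>" by (rule powr_mult)
      moreover have "C ^ (m * n) = (C ^ n) ^ m" by (simp add: power_mult[symmetric] mult.commute)
      ultimately show ?thesis by (simp add: power_mult_distrib)
    qed
    also have "(2 * ?d\<^sup>2) powr \<beta> * C * (t powr \<beta> * C ^ n) ^ m \<le> (2 * ?d\<^sup>2) powr \<beta> * C * q ^ m"
      using tq C by (intro mult_left_mono power_mono) auto
    finally show "\<nu>.prob (near f (t ^ m)) \<le> a + R * q ^ m" by (simp add: R_def distrib_right)
  qed
  have iterate: "P m (a + R * (q ^ m - q ^ (m + N)) / (1 - q))" if "P (m + N) a" for m N a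
    using that
  proof (induction N arbitrary: m)
    case (Suc N)
    have "P (Suc m) (a + R * (q ^ Suc m - q ^ (Suc m + N)) / (1 - q))"
      using Suc.IH[of "Suc m"] Suc.prems by simp
    from step[OF this]
    have "P m (a + R * (q ^ Suc m - q ^ (Suc m + N)) / (1 - q) + R * q ^ m)" .
    also have "a + R * (q ^ Suc m - q ^ (Suc m + N)) / (1 - q) + R * q ^ m
        = a + R * (q ^ m - q ^ (m + Suc N)) / (1 - q)"
      using q by (simp add: field_simps)
    finally show ?case .
  qed simp
  show thesis
  proof (rule that[of t q "R / (1 - q)"])
    show "0 < t" "t < 1" "0 < q" "q < 1" "0 \<le> R / (1 - q)" using t q R by auto
    fix f :: "'k ^ 'd" and m :: nat assume f: "f \<noteq> 0"
    show "\<nu>.prob (near f (t ^ m)) \<le> R / (1 - q) * q ^ m"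
    proof (rule field_le_epsilon)
      fix \<eta> :: real assume "0 < \<eta>"
      then obtain \<epsilon> where \<epsilon>: "0 < \<epsilon>" "\<forall>f. f \<noteq> 0 \<longrightarrow> \<nu>.prob (near f \<epsilon>) \<le> \<eta>" using hyperplane_concentration by blast
      \<comment> \<open>The recursion is started at a scale so fine that concentration gives
        \<open>\<eta>\<close>. The geometric sum is bounded independently of \<open>N\<close>, so
        \<open>\<eta>\<close> can be made arbitrarily small.\<close>
      obtain N where N: "t ^ N < \<epsilon>" using real_arch_pow_inv[OF \<epsilon>(1) t(2)] by blast
      have "t ^ (m + N) \<le> t ^ N" using t by (intro power_decreasing) auto
      then have "P (m + N) \<eta>"
        unfolding P_def using \<epsilon>(2) N by (auto intro!: order_trans[OF prob_near_mono[of "t ^ (m + N)" \<epsilon>]])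
      from iterate[OF this] f have "\<nu>.prob (near f (t ^ m)) \<le> \<eta> + R * (q ^ m - q ^ (m + N)) / (1 - q)"
        by (simp add: P_def)
      also have "\<dots> \<le> \<eta> + R * q ^ m / (1 - q)"
        using q R by (intro add_left_mono divide_right_mono mult_left_mono) auto
      finally show "\<nu>.prob (near f (t ^ m)) \<le> R / (1 - q) * q ^ m + \<eta>" by simp
    qed
  qed
qed

end

section \<open>From the regularity estimate to the limit superior\<close>

theorem theorem4p18:
  fixes \<mu> :: "('k::absval_field ^ 'd ^ 'd) measure"
    and \<nu> :: "('k ^ 'd) set measure"
    and M :: "'w measure" and Z :: "'w \<Rightarrow> ('k ^ 'd) set"
    and t :: real
  assumes "local_field TYPE('k)"
    and "CARD('d) \<ge> 2"
    and "prob_on_SL \<mu>"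
    and "exp_local_moment \<mu>"
    and "strongly_irreducible (generated_closed_semigroup \<mu>)"
    and "contracting (generated_closed_semigroup \<mu>)"
    and "invariant_prob \<mu> \<nu>"
    and "prob_space M" and "Z \<in> measurable M proj_borel" and "distr M proj_borel Z = \<nu>"
    and "0 < t" and "t < 1"
  shows "limsup (\<lambda>n. ereal (root n
           (SUP H\<in>hyperplanes. measure M {\<omega> \<in> space M. delta_hyp (Z \<omega>) H \<le> t ^ n}))) < 1"
proof -
  interpret contracting_walk \<mu> \<nu>
    using local_field_countably_dense[OF assms(1)] local_field_subconverge[OF assms(1)] assms(3,5,6,7)
    by unfold_locales
  obtain \<beta> C where moment: "0 < \<beta>" "1 \<le> C"
    "\<And>n. (\<integral>\<^sup>+ \<omega>. ennreal (distortion (walk n \<omega>) powr \<beta>) \<partial>S) \<le> ennreal (C ^ Suc n)"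
    using distortion_moment[OF assms(4)] by blast
  interpret exponential_walk \<mu> \<nu> \<beta> C
    using moment by unfold_locales
  interpret M: prob_space M by fact
  obtain s q R where s: "0 < s" "s < 1" and q: "0 < q" "q < 1" and R: "0 \<le> R"
    and reg: "\<And>f m. f \<noteq> 0 \<Longrightarrow> \<nu>.prob (near f (s ^ m)) \<le> R * q ^ m"
  proof (rule hoelder_regularity, goal_cases)
    case (1 s q R)
    show ?thesis by (rule 1(1)[OF 1(2-)])
  qed
  have event_le: "M.prob {\<omega> \<in> space M. delta_hyp (Z \<omega>) H \<le> \<epsilon>} \<le> R * q ^ m"
    if H: "H \<in> hyperplanes" and \<epsilon>: "0 \<le> \<epsilon>" "\<epsilon> \<le> s ^ m" for H \<epsilon> m
  proof -
    obtain f where f: "f \<in> dual_space" "f \<noteq> (\<lambda>_. 0)" and H_eq: "H = ker f"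
      using H unfolding hyperplanes_def by blast
    define v where "v = (\<chi> i. f (axis i 1))"
    have f_eq: "f x = pairing v x" for x unfolding v_def by (rule dual_space_pairing[OF f(1)])
    have v: "v \<noteq> 0"
    proof
      assume "v = 0"
      then have "f = (\<lambda>_. 0)" by (simp add: fun_eq_iff f_eq pairing_def)
      then show False using f(2) by contradiction
    qed
    have sub: "{\<omega> \<in> space M. delta_hyp (Z \<omega>) H \<le> \<epsilon>} \<subseteq> Z -` near v \<epsilon> \<inter> space M"
    proof (rule subsetI)
      fix \<omega> assume "\<omega> \<in> {\<omega> \<in> space M. delta_hyp (Z \<omega>) H \<le> \<epsilon>}"
      then have \<omega>: "\<omega> \<in> space M" and d: "delta_hyp (Z \<omega>) H \<le> \<epsilon>" by simp_all
      let ?x = "rep (Z \<omega>)"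
      have L: "Z \<omega> \<in> proj_space" using measurable_space[OF assms(9) \<omega>] by (simp add: space_proj_borel)
      have pos: "0 < dual_norm f" "0 < canonical_norm ?x"
        using dual_norm_pos[OF f] canonical_norm_pos[OF rep_neq_0[OF L]] .
      have "absval (f ?x) / (dual_norm f * canonical_norm ?x) \<le> \<epsilon>"
        using d delta_hyp_eq[OF rep_neq_0[OF L] f] by (simp only: line_rep[OF L] H_eq)
      then have "absval (pairing v ?x) \<le> \<epsilon> * (dual_norm f * canonical_norm ?x)"
        using pos by (simp add: pos_divide_le_eq f_eq)
      also have "\<dots> \<le> \<epsilon> * (vnorm v * vnorm ?x)"
        unfolding v_def using \<epsilon>(1) pos
        by (intro mult_left_mono mult_mono dual_norm_le_vnorm[OF f(1)] canonical_norm_le_vnorm vnorm_nonneg)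
            auto
      finally show "\<omega> \<in> Z -` near v \<epsilon> \<inter> space M" using \<omega> L by (simp add: near_def mult.assoc)
    qed
    have "M.prob {\<omega> \<in> space M. delta_hyp (Z \<omega>) H \<le> \<epsilon>} \<le> M.prob (Z -` near v \<epsilon> \<inter> space M)"
      by (rule M.finite_measure_mono[OF sub measurable_sets[OF assms(9) near_sets]])
    also have "\<dots> = \<nu>.prob (near v \<epsilon>)"
      unfolding measure_distr[OF assms(9) near_sets, symmetric] assms(10) ..
    also have "\<dots> \<le> \<nu>.prob (near v (s ^ m))" by (rule prob_near_mono[OF \<epsilon>(2)])
    also have "\<dots> \<le> R * q ^ m" by (rule reg[OF v])
    finally show ?thesis .
  qed
  \<comment> \<open>The regularity estimate has its own ratio \<open>s\<close>, while
    \<open>t\<close> is arbitrary. With \<open>t ^ k < s\<close> the scale \<open>t ^ n\<close> lies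
    below \<open>s ^ (n div k)\<close>, and the decay per step becomes the \<open>k\<close>-th root
    of \<open>q\<close>.\<close>
  obtain k where k: "t ^ k < s" using real_arch_pow_inv[OF s(1) assms(12)] by blast
  have k0: "0 < k" using k s by (cases k) auto
  define r where "r = root k q"
  have r: "0 < r" "r < 1" "r ^ k = q" using q k0 by (simp_all add: r_def)
  have ne: "hyperplanes \<noteq> ({} :: ('k ^ 'd) set set)"
  proof -
    have "(\<lambda>x :: 'k ^ 'd. x $ undefined) \<in> dual_space" by (simp add: dual_space_iff)
    moreover have "(\<lambda>x :: 'k ^ 'd. x $ undefined) \<noteq> (\<lambda>_. 0)"
      by (auto simp: fun_eq_iff intro!: exI[of _ "axis undefined 1"])
    ultimately show ?thesis unfolding hyperplanes_def by blast
  qed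
  \<comment> \<open>The division by \<open>q\<close> compensates for rounding \<open>n / k\<close>
    down. The added 1 keeps \<open>?K\<close> positive, so that its \<open>n\<close>-th roots tend
    to 1.\<close>
  let ?K = "(R + 1) / q"
  have K: "0 < ?K" using R q by simp
  have sup_le: "(SUP H\<in>hyperplanes. M.prob {\<omega> \<in> space M. delta_hyp (Z \<omega>) H \<le> t ^ n}) \<le> ?K * r ^ n" for n
  proof (rule cSUP_least[OF ne])
    fix H :: "('k ^ 'd) set" assume H: "H \<in> hyperplanes"
    have "t ^ n \<le> t ^ (k * (n div k))"
      using assms(11,12) by (intro power_decreasing) auto
    also have "\<dots> \<le> s ^ (n div k)"
      unfolding power_mult using k assms(11) by (intro power_mono) auto
    finally have "M.prob {\<omega> \<in> space M. delta_hyp (Z \<omega>) H \<le> t ^ n} \<le> R * q ^ (n div k)"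
      using assms(11) by (intro event_le H) auto
    also have "\<dots> \<le> (R + 1) * q ^ (n div k)" using q by (intro mult_right_mono) auto
    also have "q * q ^ (n div k) = r ^ (k * Suc (n div k))" by (simp only: power_mult r(3) power_Suc)
    then have "(R + 1) * q ^ (n div k) = ?K * r ^ (k * Suc (n div k))" using q by (simp add: field_simps)
    also have "?K * r ^ (k * Suc (n div k)) \<le> ?K * r ^ n"
    proof (intro mult_left_mono power_decreasing)
      show "n \<le> k * Suc (n div k)"
        using mult_div_mod_eq[of k n] mod_less_divisor[OF k0, of n] unfolding mult_Suc_right by linarith
    qed (use r K in auto)
    finally show "M.prob {\<omega> \<in> space M. delta_hyp (Z \<omega>) H \<le> t ^ n} \<le> ?K * r ^ n" .
  qed
  have "limsup (\<lambda>n. ereal (root n (SUP H\<in>hyperplanes. M.prob {\<omega> \<in> space M. delta_hyp (Z \<omega>) H \<le> t ^ n})))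
      \<le> limsup (\<lambda>n. ereal (root n ?K * r))"
  proof (rule Limsup_mono[OF eventually_sequentiallyI[of 1]])
    \<comment> \<open>Index 0 is left out because \<open>root 0\<close> is 0 by convention and does
      not invert powers.\<close>
    fix n :: nat assume n: "1 \<le> n"
    have "root n (SUP H\<in>hyperplanes. M.prob {\<omega> \<in> space M. delta_hyp (Z \<omega>) H \<le> t ^ n}) \<le> root n (?K * r ^ n)"
      using n sup_le by (intro real_root_le_mono) auto
    also have "\<dots> = root n ?K * r"
      using n r by (simp only: real_root_mult real_root_power_cancel[OF less_le_trans[OF zero_less_one n]]
          less_imp_le)
    finally show "ereal (root n (SUP H\<in>hyperplanes. M.prob {\<omega> \<in> space M. delta_hyp (Z \<omega>) H \<le> t ^ n}))
        \<le> ereal (root n ?K * r)" by simp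
  qed
  also have "\<dots> = ereal (1 * r)"
    by (intro lim_imp_Limsup tendsto_intros LIMSEQ_root_const K) simp
  also have "\<dots> < 1" using r by simp
  finally show ?thesis .
qed

end
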